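(* Let $b:\mathbb{R}^d\to\mathbb{R}^d$ be such that (i) there is $L>0$ with $|b(x)-b(y)|\le L|x-y|$ for all $x,y\in\mathbb{R}^d$; (ii) there are $K,\mathcal{R}>0$ with $\langle x-y,b(x)-b(y)\rangle\le -K|x-y|^2$ for all $x,y\in\mathbb{R}^d$ with $|x-y|>\mathcal{R}$. Let $\mu_0\in\mathcal{P}_2(\mathbb{R}^d)$, and for $h>0$ let $(X_k)_{k\ge0}$ be the Markov chain $X_0\sim\mu_0$, $X_{k+1}=X_k+b(X_k)h+\sqrt{h}\,\xi_{k+1}$, where $(\xi_k)_{k\ge1}$ are i.i.d. $N(0,I)$ random vectors independent of $X_0$. Let $\pi$ be the unique invariant probability measure of the SDE $dY_t=b(Y_t)\,dt+dW_t$. Then there exist an increasing function $f:[0,\infty)\to[0,\infty)$ and constants $h_0,\hat c_1,\hat c_2,C_1,C_2,\widetilde c_1,\widetilde c_2>0$ (independent of $h$ and $k$) such that for all $h\in(0,h_0)$ and all $k\ge 1$ $$W_2(\mathcal{L}(X_k),\pi)\le C_2(1-\hat c_2h)^{k/2}\big(W_f(\mathcal{L}(X_0),\pi)\big)^{1/2}+\widetilde c_2h^{1/4}$$ and $$W_1(\mathcal{L}(X_k),\pi)\le C_1(1-\hat c_1h)^{k}\,W_f(\mathcal{L}(X_0),\pi)+\widetilde c_1h^{1/2}.$$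
   Context: $|\cdot|$ is the Euclidean norm on $\mathbb{R}^d$; $\mathcal{L}(X)$ is the law of $X$; $\mathcal{P}_p(\mathbb{R}^d)$ is the set of probability measures on $\mathbb{R}^d$ with finite $p$-th moment. $W_p(\mu,\nu)=\big(\inf_{\gamma\in\Pi(\mu,\nu)}\int|x-y|^p\,\gamma(dx\,dy)\big)^{1/p}$, where $\Pi(\mu,\nu)$ is the set of couplings of $\mu$ and $\nu$. For an increasing $f:[0,\infty)\to[0,\infty)$, $W_f(\mu,\nu)=\inf_{\gamma\in\Pi(\mu,\nu)}\int f(|x-y|)\,\gamma(dx\,dy)$. $(W_t)_{t\ge0}$ is a standard $d$-dimensional Brownian motion. Under (i)-(ii) the SDE has a non-exploding solution and a unique invariant probability measure $\pi$. *)

theory Defs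
  imports "HOL-Probability.Probability"
begin

section \<open>Wasserstein distances\<close>

definition couplings :: "('a::euclidean_space) measure \<Rightarrow> 'a measure \<Rightarrow> ('a \<times> 'a) measure set" where
  "couplings \<mu> \<nu> = {\<gamma>. prob_space \<gamma> \<and> sets \<gamma> = sets (borel \<Otimes>\<^sub>M borel) \<and>
     distr \<gamma> borel fst = \<mu> \<and> distr \<gamma> borel snd = \<nu>}"

definition prob_measures_moment :: "real \<Rightarrow> ('a::euclidean_space) measure set" where
  "prob_measures_moment p = {\<mu>. prob_space \<mu> \<and> sets \<mu> = sets borel \<and>
     integrable \<mu> (\<lambda>x. norm x powr p)}"

text \<open>
  Transport costs take values in the extended nonnegative reals, so that an infinite cost really is
  infinite and not a conventional real value.
\<close>

definition transport_cost ::
  "(real \<Rightarrow> real) \<Rightarrow> ('a::euclidean_space) measure \<Rightarrow> 'a measure \<Rightarrow> ennreal" where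
  "transport_cost f \<mu> \<nu> =
     (INF \<gamma>\<in>couplings \<mu> \<nu>. \<integral>\<^sup>+ z. ennreal (f (norm (fst z - snd z))) \<partial>\<gamma>)"

text \<open>Real powers of extended nonnegative reals; only meant for exponents \<open>p > 0\<close>.\<close>

definition ennreal_powr :: "ennreal \<Rightarrow> real \<Rightarrow> ennreal" where
  "ennreal_powr x p = (if x = \<infinity> then \<infinity> else ennreal (enn2real x powr p))"

definition wasserstein ::
  "real \<Rightarrow> ('a::euclidean_space) measure \<Rightarrow> 'a measure \<Rightarrow> ennreal" where
  "wasserstein p \<mu> \<nu> = ennreal_powr (transport_cost (\<lambda>r. r powr p) \<mu> \<nu>) (1 / p)"


section \<open>The SDE and its invariant measures\<close>

text \<open>The law \<open>N(0, \<sigma>\<^sup>2 I)\<close>, for \<open>\<sigma> > 0\<close>.\<close>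

definition gaussian :: "real \<Rightarrow> (real ^ 'n) measure" where
  "gaussian \<sigma> = density lborel (\<lambda>x. \<Prod>i\<in>UNIV. ennreal (normal_density 0 \<sigma> (x $ i)))"

text \<open>
  Time is real; processes are only constrained at times \<open>t \<ge> 0\<close>.
\<close>

definition brownian_motion :: "'w measure \<Rightarrow> (real \<Rightarrow> 'w \<Rightarrow> real ^ 'n) \<Rightarrow> bool" where
  "brownian_motion M W \<longleftrightarrow>
     prob_space M \<and>
     (\<forall>t\<ge>0. W t \<in> borel_measurable M) \<and>
     (AE \<omega> in M. W 0 \<omega> = 0) \<and>
     (\<forall>(n::nat) t. 0 \<le> t 0 \<and> (\<forall>i<n. t i \<le> t (Suc i)) \<longrightarrow>
        prob_space.indep_vars M (\<lambda>_. borel) (\<lambda>i \<omega>. W (t (Suc i)) \<omega> - W (t i) \<omega>) {..<n}) \<and>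
     (\<forall>s t. 0 \<le> s \<and> s < t \<longrightarrow>
        distr M borel (\<lambda>\<omega>. W t \<omega> - W s \<omega>) = gaussian (sqrt (t - s))) \<and>
     (AE \<omega> in M. continuous_on {0..} (\<lambda>t. W t \<omega>))"

text \<open>
  \<open>Y\<close> solves \<open>dY\<^sub>t = b(Y\<^sub>t) dt + dW\<^sub>t\<close> on \<open>[0, \<infinity>)\<close> with \<open>Y\<^sub>0 = x\<close>.  The noise is additive, so the
  stochastic integral in the integral equation is just \<open>W\<^sub>t\<close> and the equation is read pathwise.
  For Lipschitz \<open>b\<close> it determines \<open>Y\<close> from \<open>x\<close> and \<open>W\<close> up to a null set, so adaptedness need not
  be required separately.
\<close>

definition sde_solution ::
  "'w measure \<Rightarrow> (real \<Rightarrow> 'w \<Rightarrow> real ^ 'n) \<Rightarrow> (real ^ 'n \<Rightarrow> real ^ 'n) \<Rightarrow> real ^ 'n \<Rightarrow>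
   (real \<Rightarrow> 'w \<Rightarrow> real ^ 'n) \<Rightarrow> bool" where
  "sde_solution M W b x Y \<longleftrightarrow>
     (\<forall>t\<ge>0. Y t \<in> borel_measurable M) \<and>
     (AE \<omega> in M. continuous_on {0..} (\<lambda>t. Y t \<omega>) \<and>
        (\<forall>t\<ge>0. ((\<lambda>s. b (Y s \<omega>)) has_integral (Y t \<omega> - x - W t \<omega>)) {0..t}))"

text \<open>
  Invariance of \<open>\<pi>\<close> under the transition kernels \<open>P\<^sub>t(x, A) = P(Y\<^sub>t\<^sup>x \<in> A)\<close>, where \<open>Y x\<close> is the
  process started at \<open>x\<close>.
\<close>

definition invariant_measure ::
  "'w measure \<Rightarrow> (real ^ 'n \<Rightarrow> real \<Rightarrow> 'w \<Rightarrow> real ^ 'n) \<Rightarrow> (real ^ 'n) measure \<Rightarrow> bool" where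
  "invariant_measure M Y \<pi> \<longleftrightarrow>
     prob_space \<pi> \<and> sets \<pi> = sets borel \<and>
     (\<forall>t\<ge>0. \<forall>A\<in>sets borel. (\<integral>\<^sup>+ x. emeasure (distr M borel (Y x t)) A \<partial>\<pi>) = emeasure \<pi> A)"


section \<open>The Euler--Maruyama chain\<close>

text \<open>
  Joint independence of the sequence \<open>X\<^sub>0, \<xi>\<^sub>1, \<xi>\<^sub>2, \<dots>\<close> says both that the \<open>\<xi>\<^sub>k\<close> are independent
  and that they are independent of \<open>X\<^sub>0\<close>.  The value \<open>\<xi> 0\<close> is irrelevant.
\<close>

definition euler_chain ::
  "(real ^ 'n \<Rightarrow> real ^ 'n) \<Rightarrow> (real ^ 'n) measure \<Rightarrow> real \<Rightarrow> 's measure \<Rightarrow>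
   (nat \<Rightarrow> 's \<Rightarrow> real ^ 'n) \<Rightarrow> (nat \<Rightarrow> 's \<Rightarrow> real ^ 'n) \<Rightarrow> bool" where
  "euler_chain b \<mu>\<^sub>0 h N \<xi> X \<longleftrightarrow>
     prob_space N \<and>
     prob_space.indep_vars N (\<lambda>_. borel) (\<lambda>k. if k = 0 then X 0 else \<xi> k) UNIV \<and>
     distr N borel (X 0) = \<mu>\<^sub>0 \<and>
     (\<forall>k\<ge>1. distr N borel (\<xi> k) = gaussian 1) \<and>
     (\<forall>k. \<forall>\<omega>\<in>space N.
        X (Suc k) \<omega> = X k \<omega> + h *\<^sub>R b (X k \<omega>) + sqrt h *\<^sub>R \<xi> (Suc k) \<omega>)"

end

theory Submission
  imports Defs
begin

text \<open>
  The cost \<open>f(r) = 1 - exp(- a r) + \<epsilon> r\<^sup>2\<close> is concave up to a small quadratic term near the origin and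
  quadratic at infinity, so it dominates both \<open>r\<close> and \<open>r\<^sup>2\<close> up to constants.  One Euler step is coupled
  with one step of the stationary diffusion as follows.  Write \<open>r\<close> for the current distance of the two
  positions \<open>x\<close> and \<open>y\<close>, and \<open>z\<close> for the difference of their images under the Euler drift.  If \<open>r > R\<close>,
  both use the same noise, and the quadratic part of \<open>f\<close> contracts by dissipativity.  If
  \<open>r \<le> 4 \<surd>h\<close>, they also use the same noise, and \<open>f\<close> grows by at most \<open>O(h r) = O(h\<^sup>3\<^sup>/\<^sup>2)\<close>.  Otherwise
  the noise of the chain is reflected along \<open>z\<close>, but only when its component along \<open>z\<close> is at
  most \<open>\<surd>h\<close>; the distance then never overshoots zero, it receives a bounded symmetric increment of
  variance of order \<open>h\<close>, and the concavity of \<open>f\<close> yields a gain of order \<open>h\<close>.  The diffusion differs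
  from its own Euler step by an error whose second moment is \<open>O(h\<^sup>3 (1 + \<bar>y\<bar>\<^sup>2))\<close>.  Hence the
  transport cost to \<open>\<pi>\<close> satisfies \<open>D\<^sub>k\<^sub>+\<^sub>1 \<le> (1 - \<kappa> h) D\<^sub>k + C h\<^sup>3\<^sup>/\<^sup>2\<close>.  Only the invariance of
  \<open>\<pi>\<close> at the single time \<open>h\<close> enters, never the Markov property of the diffusion.
\<close>

text \<open>Within distance R the drift may push two points apart at rate L r, so only the noise can
  bring them together, in second order, through the concavity of f. A full reflection could carry
  the distance through zero, where folding by the absolute value spoils the symmetric expansion
  behind this gain. Hence the truncation, and the threshold \<open>4 * sqrt h\<close>: an Euler
  drift still leaves more than the largest displacement \<open>2 * sqrt h\<close>. The slope a makes
  the gain four times the first order loss to the drift; \<epsilon> is small enough that the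
  quadratic part does not consume the surplus. The remainder has two sources. Below the threshold
  nothing is gained, but h f(r) is itself of order h^(3/2); and the Euler error has root mean square
  h^(3/2) and is multiplied by the slope of f. The geometric series turns h^(3/2) into h^(1/2). The
  cost bounds only the square of the W_2 distance, so h^(1/4) is left there. Two facts must be
  earned: \<pi> has a finite second moment, and the solutions, given separately for each starting
  point, have a jointly measurable version, without which they cannot be integrated over random
  positions.\<close>

section \<open>Gaussian measures and truncated reflections\<close>

text \<open>Uniqueness of Haar measure: both sides of the conclusion are the \<open>\<mu> \<times> \<nu>\<close>-measure of
  \<open>{(x, y). x \<in> A \<and> x + y \<in> B}\<close>.\<close>

lemma translation_invariant_emeasure_mult:
  fixes \<mu> :: "'a::euclidean_space measure"
  assumes "sigma_finite_measure \<mu>" and [measurable_cong]: "sets \<mu> = sets borel"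
    and tr: "\<And>c. distr \<mu> borel (\<lambda>x. x + c) = \<mu>"
    and [measurable]: "A \<in> sets borel" "B \<in> sets borel"
  shows "emeasure \<mu> A * emeasure lborel B = emeasure lborel A * emeasure \<mu> B"
proof -
  interpret \<mu>: sigma_finite_measure \<mu> by fact
  interpret pair_sigma_finite \<mu> lborel ..
  have l: "(\<integral>\<^sup>+y. indicator B (x + y) \<partial>lborel) = emeasure lborel B" for x :: 'a
  proof -
    have "(\<integral>\<^sup>+y. indicator B (x + y) \<partial>lborel) = (\<integral>\<^sup>+y. indicator B y \<partial>distr lborel borel ((+) x))"
      by (subst nn_integral_distr) auto
    then show ?thesis by (simp add: lborel_distr_plus)
  qed
  have r: "(\<integral>\<^sup>+y. indicator A (x - y) \<partial>lborel) = emeasure lborel A" for x :: 'a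
  proof -
    have "distr lborel borel (\<lambda>y. x - y) = lborel"
      using lborel_affine[of "-1::real" x] by (simp add: density_1)
    moreover have "(\<integral>\<^sup>+y. indicator A (x - y) \<partial>lborel) = (\<integral>\<^sup>+y. indicator A y \<partial>distr lborel borel (\<lambda>y. x - y))"
      by (subst nn_integral_distr) auto
    ultimately show ?thesis by simp
  qed
  have "emeasure \<mu> A * emeasure lborel B = (\<integral>\<^sup>+x. indicator A x * emeasure lborel B \<partial>\<mu>)"
    by (simp add: nn_integral_multc)
  also have "\<dots> = (\<integral>\<^sup>+x. \<integral>\<^sup>+y. indicator A x * indicator B (x + y) \<partial>lborel \<partial>\<mu>)"
    by (intro nn_integral_cong) (simp add: nn_integral_cmult l)
  also have "\<dots> = (\<integral>\<^sup>+y. \<integral>\<^sup>+x. indicator A x * indicator B (x + y) \<partial>\<mu> \<partial>lborel)"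
    by (intro Fubini'[symmetric]) measurable
  also have "\<dots> = (\<integral>\<^sup>+y. \<integral>\<^sup>+x. indicator A (x - y) * indicator B x \<partial>\<mu> \<partial>lborel)"
  proof (rule nn_integral_cong)
    fix y :: 'a
    have "(\<integral>\<^sup>+x. indicator A (x - y) * indicator B x \<partial>\<mu>)
        = (\<integral>\<^sup>+x. indicator A (x - y) * indicator B x \<partial>distr \<mu> borel (\<lambda>x. x + y))"
      by (simp add: tr)
    also have "\<dots> = (\<integral>\<^sup>+x. indicator A x * indicator B (x + y) \<partial>\<mu>)"
      by (subst nn_integral_distr) auto
    finally show "(\<integral>\<^sup>+x. indicator A x * indicator B (x + y) \<partial>\<mu>)
        = (\<integral>\<^sup>+x. indicator A (x - y) * indicator B x \<partial>\<mu>)" ..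
  qed
  also have "\<dots> = (\<integral>\<^sup>+x. \<integral>\<^sup>+y. indicator A (x - y) * indicator B x \<partial>lborel \<partial>\<mu>)"
    by (intro Fubini') measurable
  also have "\<dots> = (\<integral>\<^sup>+x. emeasure lborel A * indicator B x \<partial>\<mu>)"
    by (intro nn_integral_cong) (simp add: nn_integral_multc r)
  also have "\<dots> = emeasure lborel A * emeasure \<mu> B"
    by (simp add: nn_integral_cmult)
  finally show ?thesis .
qed

section \<open>Lebesgue and Gaussian measures under rotations and scalings\<close>

lemma borel_measurable_orthogonal_transformation:
  "orthogonal_transformation T \<Longrightarrow> T \<in> borel_measurable borel"
  for T :: "'a::euclidean_space \<Rightarrow> 'a"
  by (intro borel_measurable_continuous_onI linear_continuous_on)
    (simp add: orthogonal_transformation_def linear_linear)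

text \<open>The image measure is again translation invariant, because T is linear and onto, so it is
  a multiple of Lebesgue measure. The unit ball is its own preimage under T and forces the factor
  1.\<close>

lemma distr_lborel_orthogonal:
  fixes T :: "'a::euclidean_space \<Rightarrow> 'a"
  assumes T: "orthogonal_transformation T"
  shows "distr lborel borel T = lborel"
proof (rule measure_eqI)
  note Tm[measurable] = borel_measurable_orthogonal_transformation[OF T]
  let ?\<mu> = "distr lborel borel T"
  have ball: "emeasure ?\<mu> (ball 0 r) = emeasure lborel (ball (0::'a) r)" for r
  proof -
    have "T -` ball 0 r = ball 0 r"
      by (auto simp: orthogonal_transformation_norm[OF T])
    then show ?thesis by (simp add: emeasure_distr)
  qed
  have fin: "emeasure lborel (ball (0::'a) r) < \<infinity>" for r
    by (rule emeasure_bounded_finite) simp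
  have sf: "sigma_finite_measure ?\<mu>"
  proof (intro sigma_finite_measure.intro exI conjI)
    show "countable (range (\<lambda>n::nat. ball (0::'a) n))" by simp
    show "range (\<lambda>n::nat. ball (0::'a) n) \<subseteq> sets ?\<mu>" by auto
    show "\<Union> (range (\<lambda>n::nat. ball (0::'a) n)) = space ?\<mu>"
      using reals_Archimedean2 by auto
    show "\<forall>a\<in>range (\<lambda>n::nat. ball (0::'a) n). emeasure ?\<mu> a \<noteq> \<infinity>"
      using fin by (auto simp: ball less_top[symmetric])
  qed
  have tr: "distr ?\<mu> borel (\<lambda>x. x + c) = ?\<mu>" for c
  proof -
    obtain d where d: "T d = c"
      using orthogonal_transformation_surj[OF T] by (metis surjD)
    have "distr ?\<mu> borel (\<lambda>x. x + c) = distr lborel borel (\<lambda>x. T (d + x))"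
      using linear_add[OF orthogonal_transformation_linear[OF T]]
      by (simp add: distr_distr comp_def d add.commute)
    also have "\<dots> = distr (distr lborel borel ((+) d)) borel T"
      by (simp add: distr_distr comp_def)
    finally show ?thesis by (simp add: lborel_distr_plus)
  qed
  fix A assume "A \<in> sets ?\<mu>"
  then have A: "A \<in> sets borel" by simp
  have eq: "emeasure ?\<mu> A * emeasure lborel (ball (0::'a) 1) = emeasure lborel A * emeasure lborel (ball (0::'a) 1)"
    using translation_invariant_emeasure_mult[OF sf _ tr A, of "ball 0 1"] by (simp add: ball)
  have "emeasure lborel (ball (0::'a) 1) \<noteq> 0"
    using less_imp_neq[OF unit_ball_vol_pos[of "real DIM('a)"]] by (simp add: emeasure_ball)
  then show "emeasure ?\<mu> A = emeasure lborel A"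
    using eq fin[of 1] unfolding mult.commute[of _ "emeasure lborel (ball (0::'a) 1)"] ennreal_mult_cancel_left
    by auto
qed simp

text \<open>The product form of the density hides rotation invariance; here x enters through its
  norm alone.\<close>

lemma gaussian_eq_density:
  assumes "\<sigma> > 0"
  shows "(gaussian \<sigma> :: (real ^ 'n) measure) = density lborel
    (\<lambda>x. ennreal ((1 / sqrt (2 * pi * \<sigma>\<^sup>2)) ^ CARD('n) * exp (- (norm x)\<^sup>2 / (2 * \<sigma>\<^sup>2))))"
proof -
  have "(\<Prod>i\<in>UNIV. ennreal (normal_density 0 \<sigma> (x $ i)))
      = ennreal ((1 / sqrt (2 * pi * \<sigma>\<^sup>2)) ^ CARD('n) * exp (- (norm x)\<^sup>2 / (2 * \<sigma>\<^sup>2)))" for x :: "real ^ 'n"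
  proof -
    have "(norm x)\<^sup>2 = (\<Sum>i\<in>UNIV. (x $ i)\<^sup>2)"
      unfolding power2_norm_eq_inner inner_vec_def by (simp add: power2_eq_square)
    then show ?thesis
      by (simp add: prod_ennreal normal_density_def prod.distrib exp_sum[symmetric] sum_negf sum_divide_distrib
          prod_dividef power_one_over del: power_divide)
  qed
  then show ?thesis
    unfolding gaussian_def by simp
qed

lemma sets_gaussian [simp, measurable_cong]: "sets (gaussian \<sigma>) = sets borel"
  and space_gaussian [simp]: "space (gaussian \<sigma>) = UNIV"
  by (simp_all add: gaussian_def)

lemma distr_gaussian_orthogonal:
  fixes T :: "real ^ 'n \<Rightarrow> real ^ 'n"
  assumes T: "orthogonal_transformation T" and \<sigma>: "\<sigma> > 0"
  shows "distr (gaussian \<sigma>) borel T = gaussian \<sigma>"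
proof (rule measure_eqI)
  note Tm[measurable] = borel_measurable_orthogonal_transformation[OF T]
  let ?g = "\<lambda>x::real ^ 'n. ennreal ((1 / sqrt (2 * pi * \<sigma>\<^sup>2)) ^ CARD('n) * exp (- (norm x)\<^sup>2 / (2 * \<sigma>\<^sup>2)))"
  fix A assume "A \<in> sets (distr (gaussian \<sigma>) borel T)"
  then have A[measurable]: "A \<in> sets borel" by simp
  have "emeasure (gaussian \<sigma>) A = (\<integral>\<^sup>+x. ?g x * indicator A x \<partial>distr lborel borel T)"
    by (simp add: gaussian_eq_density[OF \<sigma>] emeasure_density distr_lborel_orthogonal[OF T])
  also have "\<dots> = (\<integral>\<^sup>+x. ?g (T x) * indicator A (T x) \<partial>lborel)"
    by (simp add: nn_integral_distr)
  also have "\<dots> = (\<integral>\<^sup>+x. ?g x * indicator (T -` A) x \<partial>lborel)"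
    by (simp add: orthogonal_transformation_norm[OF T] indicator_def)
  also have "\<dots> = emeasure (distr (gaussian \<sigma>) borel T) A"
    using measurable_sets[OF Tm A]
    by (simp add: gaussian_eq_density[OF \<sigma>] emeasure_density emeasure_distr)
  finally show "emeasure (distr (gaussian \<sigma>) borel T) A = emeasure (gaussian \<sigma>) A" ..
qed simp

text \<open>Reduces Gaussian integrals to dimension one: all factors 1 give the total mass, a single
  factor \<open>y\<^sup>2\<close> gives a second moment.\<close>

lemma nn_integral_gaussian_prod:
  fixes g :: "'n::finite \<Rightarrow> real \<Rightarrow> ennreal"
  assumes [measurable]: "\<And>i. g i \<in> borel_measurable borel"
  shows "(\<integral>\<^sup>+x. (\<Prod>i\<in>UNIV. g i (x $ i)) \<partial>gaussian \<sigma>)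
       = (\<Prod>i\<in>UNIV. \<integral>\<^sup>+y. g i y * normal_density 0 \<sigma> y \<partial>lborel)"
proof -
  define f :: "real ^ 'n \<Rightarrow> real \<Rightarrow> ennreal"
    where "f b y = g (axis_index b) y * normal_density 0 \<sigma> y" for b y
  have B: "(Basis :: (real ^ 'n) set) = range (\<lambda>i. axis i 1)"
    by (auto simp: Basis_vec_def)
  have inj: "inj (\<lambda>i. axis i (1::real) :: real ^ 'n)"
    by (auto simp: inj_on_def axis_eq_axis)
  have [simp]: "axis_index (axis i 1 :: real ^ 'n) = i" for i :: 'n
    by (simp add: axis_index_def axis_eq_axis)
  have "(\<integral>\<^sup>+x. (\<Prod>i\<in>UNIV. g i (x $ i)) \<partial>gaussian \<sigma>)
      = (\<integral>\<^sup>+x. (\<Prod>i\<in>UNIV. g i (x $ i) * normal_density 0 \<sigma> (x $ i)) \<partial>lborel)"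
    unfolding gaussian_def by (subst nn_integral_density) (simp_all add: prod.distrib mult.commute)
  also have "\<dots> = (\<integral>\<^sup>+x. (\<Prod>b\<in>Basis. f b (x \<bullet> b)) \<partial>lborel)"
    by (simp add: B prod.reindex[OF inj] f_def inner_axis)
  also have "\<dots> = (\<Prod>b\<in>Basis. \<integral>\<^sup>+y. f b y \<partial>lborel)"
    by (intro nn_integral_lborel_prod) (auto simp: f_def)
  also have "\<dots> = (\<Prod>i\<in>UNIV. \<integral>\<^sup>+y. g i y * normal_density 0 \<sigma> y \<partial>lborel)"
    by (simp add: B prod.reindex[OF inj] f_def)
  finally show ?thesis .
qed

lemma nn_integral_normal_density:
  assumes "\<sigma> > 0"
  shows "(\<integral>\<^sup>+y. ennreal (normal_density 0 \<sigma> y) \<partial>lborel) = 1"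
    and "(\<integral>\<^sup>+y. ennreal (y\<^sup>2) * ennreal (normal_density 0 \<sigma> y) \<partial>lborel) = ennreal (\<sigma>\<^sup>2)"
proof -
  show "(\<integral>\<^sup>+y. ennreal (normal_density 0 \<sigma> y) \<partial>lborel) = 1"
    using assms by (subst nn_integral_eq_integral) auto
  have "has_bochner_integral lborel (\<lambda>y. normal_density 0 \<sigma> y * (y - 0) ^ (2 * 1))
      (fact (2 * 1) / ((2 / \<sigma>\<^sup>2) ^ 1 * fact 1))"
    by (rule normal_moment_even[OF assms])
  then have "has_bochner_integral lborel (\<lambda>y. y\<^sup>2 * normal_density 0 \<sigma> y) (\<sigma>\<^sup>2)"
    by (simp add: mult.commute)
  then have i: "integrable lborel (\<lambda>y. y\<^sup>2 * normal_density 0 \<sigma> y)"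
    and e: "integral\<^sup>L lborel (\<lambda>y. y\<^sup>2 * normal_density 0 \<sigma> y) = \<sigma>\<^sup>2"
    by (auto simp: has_bochner_integral_iff)
  show "(\<integral>\<^sup>+y. ennreal (y\<^sup>2) * ennreal (normal_density 0 \<sigma> y) \<partial>lborel) = ennreal (\<sigma>\<^sup>2)"
    using nn_integral_eq_integral[OF i] assms e by (simp add: ennreal_mult)
qed

lemma prob_space_gaussian:
  assumes "\<sigma> > 0" shows "prob_space (gaussian \<sigma> :: (real ^ 'n) measure)"
proof
  show "emeasure (gaussian \<sigma> :: (real ^ 'n) measure) (space (gaussian \<sigma>)) = 1"
    using nn_integral_gaussian_prod[of "\<lambda>_ _. 1" \<sigma>] nn_integral_normal_density(1)[OF assms] by simp
qed

lemma nn_integral_gaussian_norm_sq: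
  assumes "\<sigma> > 0"
  shows "(\<integral>\<^sup>+x. ennreal ((norm x)\<^sup>2) \<partial>(gaussian \<sigma> :: (real ^ 'n) measure)) = ennreal (\<sigma>\<^sup>2 * CARD('n))"
proof -
  \<comment> \<open>Each squared coordinate is written as a product with one nontrivial factor, the
    shape to which the product formula applies.\<close>
  have "ennreal ((norm x)\<^sup>2) = (\<Sum>j\<in>UNIV. \<Prod>i\<in>UNIV. if i = j then ennreal ((x $ i)\<^sup>2) else 1)"
    (is "_ = (\<Sum>j\<in>UNIV. ?P j x)") for x :: "real ^ 'n"
    unfolding power2_norm_eq_inner inner_vec_def by (simp add: power2_eq_square sum_ennreal)
  then have "(\<integral>\<^sup>+x. ennreal ((norm x)\<^sup>2) \<partial>(gaussian \<sigma> :: (real ^ 'n) measure))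
      = (\<integral>\<^sup>+x. (\<Sum>j\<in>UNIV. ?P j x) \<partial>(gaussian \<sigma> :: (real ^ 'n) measure))"
    by (rule nn_integral_cong)
  also have "\<dots> = (\<Sum>j\<in>UNIV. \<integral>\<^sup>+x. ?P j x \<partial>(gaussian \<sigma> :: (real ^ 'n) measure))"
    by (rule nn_integral_sum) measurable
  also have "\<dots> = (\<Sum>j\<in>(UNIV::'n set). ennreal (\<sigma>\<^sup>2))"
  proof (rule sum.cong[OF refl])
    fix j :: 'n
    have "(\<integral>\<^sup>+x. (\<Prod>i\<in>UNIV. if i = j then ennreal ((x $ i)\<^sup>2) else 1) \<partial>(gaussian \<sigma> :: (real ^ 'n) measure))
      = (\<Prod>i\<in>UNIV. \<integral>\<^sup>+y. (if i = j then ennreal (y\<^sup>2) else 1) * normal_density 0 \<sigma> y \<partial>lborel)"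
      by (rule nn_integral_gaussian_prod) simp
    also have "\<dots> = (\<Prod>i\<in>UNIV. if i = j then ennreal (\<sigma>\<^sup>2) else 1)"
      by (intro prod.cong) (auto simp: nn_integral_normal_density[OF assms])
    finally show "(\<integral>\<^sup>+x. (\<Prod>i\<in>UNIV. if i = j then ennreal ((x $ i)\<^sup>2) else 1) \<partial>(gaussian \<sigma> :: (real ^ 'n) measure))
      = ennreal (\<sigma>\<^sup>2)" by simp
  qed
  also have "\<dots> = ennreal (\<sigma>\<^sup>2 * CARD('n))"
    by (simp add: ennreal_mult mult.commute ennreal_of_nat_eq_real_of_nat)
  finally show ?thesis .
qed

text \<open>Identifies the noise \<open>sqrt h *\<^sub>R \<xi>\<close> of the chain with the law of
  the Brownian increment over time h.\<close>

lemma distr_gaussian_scale: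
  assumes s: "s > 0"
  shows "distr (gaussian 1 :: (real ^ 'n) measure) borel (\<lambda>x. s *\<^sub>R x) = gaussian s"
proof (rule measure_eqI)
  let ?c = "1 / sqrt (2 * pi * s\<^sup>2)"
  fix A :: "(real ^ 'n) set" assume "A \<in> sets (distr (gaussian 1) borel (\<lambda>x. s *\<^sub>R x))"
  then have A[measurable]: "A \<in> sets borel" by simp
  \<comment> \<open>Per coordinate, the Jacobian s cancels the s in the normalising
    constant.\<close>
  have "?c * s = 1 / sqrt (2 * pi)"
    using s by (simp add: real_sqrt_mult)
  then have "?c ^ CARD('n) * s ^ CARD('n) = (1 / sqrt (2 * pi)) ^ CARD('n)"
    unfolding power_mult_distrib[symmetric] by simp
  then have c: "s ^ CARD('n) * (?c ^ CARD('n) * E) = (1 / sqrt (2 * pi)) ^ CARD('n) * E" for E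
    by (metis mult.assoc mult.commute)
  have "emeasure (gaussian s) A = (\<integral>\<^sup>+x. ennreal (?c ^ CARD('n) * exp (- (norm x)\<^sup>2 / (2 * s\<^sup>2))) * indicator A x
     \<partial>(density (distr lborel borel (\<lambda>x. 0 + s *\<^sub>R x)) (\<lambda>_. \<bar>s\<bar> ^ DIM(real ^ 'n))))"
    using s by (subst lborel_affine[symmetric]) (simp_all add: gaussian_eq_density emeasure_density)
  also have "\<dots> = (\<integral>\<^sup>+x. ennreal (s ^ CARD('n)) * (ennreal (?c ^ CARD('n) * exp (- (norm (s *\<^sub>R x))\<^sup>2 / (2 * s\<^sup>2))) * indicator A (s *\<^sub>R x)) \<partial>lborel)"
    using s by (simp add: nn_integral_density nn_integral_distr)
  also have "\<dots> = (\<integral>\<^sup>+x. ennreal ((1 / sqrt (2 * pi)) ^ CARD('n) * exp (- (norm x)\<^sup>2 / 2)) * indicator A (s *\<^sub>R x) \<partial>lborel)"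
  proof (rule nn_integral_cong)
    fix x :: "real ^ 'n"
    have "- (norm (s *\<^sub>R x))\<^sup>2 / (2 * s\<^sup>2) = - (norm x)\<^sup>2 / 2"
      using s by (simp add: power_mult_distrib)
    then have "ennreal (s ^ CARD('n)) * ennreal (?c ^ CARD('n) * exp (- (norm (s *\<^sub>R x))\<^sup>2 / (2 * s\<^sup>2)))
      = ennreal ((1 / sqrt (2 * pi)) ^ CARD('n) * exp (- (norm x)\<^sup>2 / 2))"
      using s by (subst ennreal_mult[symmetric]) (simp_all only: c, auto intro!: mult_nonneg_nonneg zero_le_power)
    then show "ennreal (s ^ CARD('n)) * (ennreal (?c ^ CARD('n) * exp (- (norm (s *\<^sub>R x))\<^sup>2 / (2 * s\<^sup>2))) * indicator A (s *\<^sub>R x))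
      = ennreal ((1 / sqrt (2 * pi)) ^ CARD('n) * exp (- (norm x)\<^sup>2 / 2)) * indicator A (s *\<^sub>R x)"
      by (simp only: mult.assoc[symmetric])
  qed
  also have "\<dots> = (\<integral>\<^sup>+x. ennreal ((1 / sqrt (2 * pi)) ^ CARD('n) * exp (- (norm x)\<^sup>2 / 2)) * indicator ((\<lambda>x. s *\<^sub>R x) -` A) x \<partial>lborel)"
    by (simp add: indicator_def)
  also have "\<dots> = emeasure (distr (gaussian 1) borel (\<lambda>x. s *\<^sub>R x)) A"
    using measurable_sets[of "\<lambda>x. s *\<^sub>R x" borel borel A]
    by (simp add: gaussian_eq_density emeasure_density emeasure_distr)
  finally show "emeasure (distr (gaussian 1) borel (\<lambda>x. s *\<^sub>R x)) A = emeasure (gaussian s) A" ..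
qed simp

section \<open>Reflections truncated to a slab\<close>

definition reflect :: "'a::euclidean_space \<Rightarrow> 'a \<Rightarrow> 'a" where
  "reflect e w = w - (2 * (e \<bullet> w)) *\<^sub>R e"

text \<open>The signed length of the displacement along -e. It is kept apart from the reflected
  vector because it is exactly what the distance of a reflected pair loses.\<close>

definition trunc_coord :: "real \<Rightarrow> 'a::euclidean_space \<Rightarrow> 'a \<Rightarrow> real" where
  "trunc_coord c e w = (if \<bar>e \<bullet> w\<bar> \<le> c then 2 * (e \<bullet> w) else 0)"

text \<open>Reflecting only while \<open>\<bar>e \<bullet> w\<bar> \<le> c\<close> still preserves every reflection invariant law, but
  displaces \<open>w\<close> by at most \<open>2 c\<close>.\<close>

definition trunc_reflect :: "real \<Rightarrow> 'a::euclidean_space \<Rightarrow> 'a \<Rightarrow> 'a" where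
  "trunc_reflect c e w = w - trunc_coord c e w *\<^sub>R e"

lemma trunc_coord_measurable [measurable]:
  "case_prod (trunc_coord c) \<in> borel \<Otimes>\<^sub>M borel \<rightarrow>\<^sub>M borel"
  unfolding trunc_coord_def[abs_def] split_def by measurable

lemma trunc_reflect_measurable [measurable]:
  "case_prod (trunc_reflect c) \<in> borel \<Otimes>\<^sub>M borel \<rightarrow>\<^sub>M borel"
  unfolding trunc_reflect_def[abs_def] split_def by measurable

text \<open>Oddness makes the increment of the distance symmetric under a Gaussian, so the cost may
  be symmetrised.\<close>

lemma trunc_coord_uminus: "trunc_coord c e (- w) = - trunc_coord c e w"
  by (simp add: trunc_coord_def)

lemma abs_trunc_coord_le: "c \<ge> 0 \<Longrightarrow> \<bar>trunc_coord c e w\<bar> \<le> 2 * c"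
  by (auto simp: trunc_coord_def abs_mult)

lemma inner_reflect:
  assumes "norm e = 1"
  shows "e \<bullet> reflect e w = - (e \<bullet> w)"
  using assms by (simp add: reflect_def inner_diff_right norm_eq_1)

lemma orthogonal_transformation_reflect:
  assumes "norm e = 1"
  shows "orthogonal_transformation (reflect e)"
proof -
  have "linear (reflect e)"
    unfolding reflect_def by (intro linearI) (simp_all add: algebra_simps)
  moreover have "reflect e v \<bullet> reflect e w = v \<bullet> w" for v w
    using assms by (simp add: reflect_def inner_diff_left inner_diff_right norm_eq_1 inner_commute[of v e] algebra_simps)
  ultimately show ?thesis
    by (simp add: orthogonal_transformation_def)
qed

text \<open>The reflection maps the slab S onto itself and preserves the Gaussian, so the mass
  inside S is only rearranged, while nothing outside S moves.\<close>

lemma distr_gaussian_trunc_reflect: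
  fixes e :: "real ^ 'n"
  assumes e: "norm e = 1" and \<sigma>: "\<sigma> > 0"
  shows "distr (gaussian \<sigma>) borel (trunc_reflect c e) = gaussian \<sigma>"
proof (rule measure_eqI)
  let ?G = "gaussian \<sigma> :: (real ^ 'n) measure"
  have G: "distr ?G borel (reflect e) = ?G"
    by (rule distr_gaussian_orthogonal[OF orthogonal_transformation_reflect[OF e] \<sigma>])
  have [measurable]: "reflect e \<in> borel_measurable borel"
    by (rule borel_measurable_orthogonal_transformation[OF orthogonal_transformation_reflect[OF e]])
  have [measurable]: "trunc_reflect c e \<in> borel_measurable borel"
    by measurable
  define S where "S = {w. \<bar>e \<bullet> w\<bar> \<le> c}"
  have S[measurable]: "S \<in> sets borel"
    unfolding S_def by measurable
  fix A assume "A \<in> sets (distr ?G borel (trunc_reflect c e))"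
  then have A[measurable]: "A \<in> sets borel" by simp
  have m: "trunc_reflect c e -` A \<in> sets borel" "reflect e -` (A \<inter> S) \<in> sets borel"
    using measurable_sets[of "trunc_reflect c e" borel borel A]
      measurable_sets[of "reflect e" borel borel "A \<inter> S"] by auto
  \<comment> \<open>A point of the slab stays in the slab, so the two pieces of A have disjoint
    preimages.\<close>
  have eq: "trunc_reflect c e -` A = reflect e -` (A \<inter> S) \<union> (A - S)"
    using inner_reflect[OF e] by (auto simp: trunc_reflect_def trunc_coord_def S_def reflect_def split: if_splits)
  have "emeasure ?G (trunc_reflect c e -` A) = emeasure ?G (reflect e -` (A \<inter> S)) + emeasure ?G (A - S)"
    unfolding eq using m inner_reflect[OF e] by (subst plus_emeasure) (auto simp: S_def)
  also have "emeasure ?G (reflect e -` (A \<inter> S)) = emeasure (distr ?G borel (reflect e)) (A \<inter> S)"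
    by (simp add: emeasure_distr)
  also have "\<dots> + emeasure ?G (A - S) = emeasure ?G A"
    unfolding G by (subst plus_emeasure) (auto intro!: arg_cong[where f="emeasure ?G"])
  finally show "emeasure (distr ?G borel (trunc_reflect c e)) A = emeasure ?G A"
    by (simp add: emeasure_distr)
qed simp

lemma distr_gaussian_uminus:
  "\<sigma> > 0 \<Longrightarrow> distr (gaussian \<sigma> :: (real ^ 'n) measure) borel uminus = gaussian \<sigma>"
  by (rule distr_gaussian_orthogonal)
    (simp_all add: orthogonal_transformation_def linear_iff)

lemma integrable_trunc_coord_sq:
  fixes e :: "real ^ 'n"
  assumes "\<sigma> > 0" "c \<ge> 0"
  shows "integrable (gaussian \<sigma>) (\<lambda>w. (trunc_coord c e w)\<^sup>2)"
proof -
  interpret prob_space "gaussian \<sigma> :: (real ^ 'n) measure"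
    by (rule prob_space_gaussian) fact
  show ?thesis
    using power_mono[OF abs_trunc_coord_le[OF assms(2)], where n=2]
    by (intro integrable_const_bound[where B="(2 * c)\<^sup>2"]) auto
qed

text \<open>Scaling produces the factor \<open>c\<^sup>2\<close> and rotation invariance removes e.
  The number \<open>s2\<close> is the integral of 4 t^2 over [-1, 1] under the one-dimensional
  standard normal law. It must not depend on e or c, because all later constants are built from it
  and have to be uniform in the positions and in h.\<close>

lemma trunc_coord_second_moment:
  obtains s2 where "s2 > 0"
    and "\<And>(e :: real ^ 'n) c. norm e = 1 \<Longrightarrow> c > 0 \<Longrightarrow> (\<integral>w. (trunc_coord c e w)\<^sup>2 \<partial>gaussian c) = c\<^sup>2 * s2"
proof -
  let ?G = "gaussian 1 :: (real ^ 'n) measure"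
  define I where "I e = (\<integral>w. (trunc_coord 1 e w)\<^sup>2 \<partial>?G)" for e
  have scale: "(\<integral>w. (trunc_coord c e w)\<^sup>2 \<partial>gaussian c) = c\<^sup>2 * I e" if "c > 0" for c and e :: "real ^ 'n"
  proof -
    have *: "(trunc_coord c e (c *\<^sub>R w))\<^sup>2 = c\<^sup>2 * (trunc_coord 1 e w)\<^sup>2" for w
      using that by (auto simp: trunc_coord_def abs_mult power_mult_distrib)
    have "(\<integral>w. (trunc_coord c e w)\<^sup>2 \<partial>gaussian c) = (\<integral>w. (trunc_coord c e w)\<^sup>2 \<partial>distr ?G borel (\<lambda>x. c *\<^sub>R x))"
      by (simp add: distr_gaussian_scale that)
    also have "\<dots> = c\<^sup>2 * I e"
      by (simp add: integral_distr I_def *)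
    finally show ?thesis .
  qed
  have inv: "I a = I b" if ab: "norm a = 1" "norm b = 1" for a b
  proof -
    obtain T where T: "orthogonal_transformation T" "T a = b"
      by (rule orthogonal_transformation_exists[of a b]) (use ab in auto)
    note [measurable] = borel_measurable_orthogonal_transformation[OF T(1)]
    have "b \<bullet> T w = a \<bullet> w" for w
      using T by (auto simp: orthogonal_transformation_def)
    then have *: "trunc_coord 1 b (T w) = trunc_coord 1 a w" for w
      by (simp add: trunc_coord_def)
    have "I b = (\<integral>w. (trunc_coord 1 b w)\<^sup>2 \<partial>distr ?G borel T)"
      by (simp add: I_def distr_gaussian_orthogonal[OF T(1)])
    also have "\<dots> = I a"
      by (simp add: integral_distr I_def *)
    finally show ?thesis ..
  qed
  have pos: "I e > 0" if e: "norm e = 1" for e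
  proof (rule ccontr)
    assume "\<not> I e > 0"
    moreover have "I e \<ge> 0" unfolding I_def by simp
    ultimately have "I e = 0" by simp
    then have "AE w in ?G. (trunc_coord 1 e w)\<^sup>2 = 0"
      unfolding I_def by (subst (asm) integral_nonneg_eq_0_iff_AE) (auto intro: integrable_trunc_coord_sq)
    then have "AE w in lborel. trunc_coord 1 e w = 0"
      unfolding gaussian_eq_density[OF zero_less_one] by (subst (asm) AE_density) auto
    then have "AE w in lborel. w \<notin> {w. 0 < e \<bullet> w \<and> e \<bullet> w < 1}"
      by eventually_elim (auto simp: trunc_coord_def)
    then have "{w. 0 < e \<bullet> w \<and> e \<bullet> w < 1} \<in> null_sets lborel"
      by (subst AE_iff_null_sets) auto
    moreover have "open {w. 0 < e \<bullet> w \<and> e \<bullet> w < 1}"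
      by (intro open_Collect_conj open_Collect_less continuous_intros)
    ultimately have "{w. 0 < e \<bullet> w \<and> e \<bullet> w < 1} = {}"
      using open_not_negligible negligible_iff_null_sets null_sets_completionI by blast
    moreover have "(1/2) *\<^sub>R e \<in> {w. 0 < e \<bullet> w \<and> e \<bullet> w < 1}"
      using e by (simp add: norm_eq_1)
    ultimately show False by blast
  qed
  obtain e0 :: "real ^ 'n" where "norm e0 = 1"
    by (rule that[of "axis undefined 1"]) simp
  show thesis
  proof (rule that[of "I e0"])
    show "I e0 > 0" by (rule pos) fact
    fix e :: "real ^ 'n" and c :: real assume "norm e = 1" "c > 0"
    then show "(\<integral>w. (trunc_coord c e w)\<^sup>2 \<partial>gaussian c) = c\<^sup>2 * I e0"
      using scale[of c e] inv[of e e0] \<open>norm e0 = 1\<close> by simp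
  qed
qed

section \<open>Pathwise estimates for the stochastic differential equation\<close>

text \<open>Left endpoint sums look at a path only at fixed times and are therefore random
  variables, whatever is known about joint measurability in time and \<omega>.\<close>

lemma riemann_sum_tendsto_integral:
  fixes g :: "real \<Rightarrow> real"
  assumes h: "h \<ge> 0" and g: "continuous_on {0..h} g"
  shows "(\<lambda>n. h / real n * (\<Sum>i<n. g (real i * h / real n))) \<longlonglongrightarrow> integral {0..h} g"
proof (rule LIMSEQ_I)
  fix r :: real assume r: "r > 0"
  \<comment> \<open>The summand 1 keeps the quotient meaningful when h is 0.\<close>
  define e where "e = r / (2 * (h + 1))"
  have e: "e > 0" "h * e < r"
    using r h by (auto simp: e_def field_simps intro: add_nonneg_pos)
  obtain \<delta> where \<delta>: "\<delta> > 0" and uc: "\<And>s t. s \<in> {0..h} \<Longrightarrow> t \<in> {0..h} \<Longrightarrow> dist s t < \<delta> \<Longrightarrow> dist (g s) (g t) < e"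
    using compact_uniformly_continuous[OF g] e(1) unfolding uniformly_continuous_on_def
    by (metis compact_Icc)
  obtain N :: nat where N: "h / \<delta> < N"
    using reals_Archimedean2 by blast
  show "\<exists>no. \<forall>n\<ge>no. norm (h / real n * (\<Sum>i<n. g (real i * h / real n)) - integral {0..h} g) < r"
  proof (intro exI[of _ "Suc N"] allI impI)
    fix n assume n: "Suc N \<le> n"
    define d where "d = h / real n"
    have n0: "real n > 0" using n by simp
    have "h / \<delta> < n" using N n by simp
    then have d: "d \<ge> 0" "d < \<delta>"
      using h n0 \<delta> by (auto simp: d_def field_simps)
    have kd: "real k * d \<le> h" if "k \<le> n" for k
      using that h n0 by (simp add: d_def field_simps mult_left_mono)
    have int: "g integrable_on {s..t}" if "0 \<le> s" "t \<le> h" for s t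
      using that by (intro integrable_continuous_real continuous_on_subset[OF g]) auto
    \<comment> \<open>Uniform continuity costs at most \<open>d * e\<close> per cell; the induction
      adds the cells up.\<close>
    have "\<bar>d * (\<Sum>i<k. g (real i * d)) - integral {0..real k * d} g\<bar> \<le> real k * d * e" if "k \<le> n" for k
      using that
    proof (induction k)
      case (Suc k)
      let ?s = "real k * d" and ?t = "real (Suc k) * d"
      have st: "0 \<le> ?s" "?s \<le> ?t" "?t \<le> h"
        using d kd[OF Suc.prems] by (auto simp: algebra_simps)
      have "((\<lambda>_. g ?s) has_integral (?t - ?s) * g ?s) {?s..?t}"
        using has_integral_const_real[of "g ?s" ?s ?t] st by simp
      then have c: "((\<lambda>u. g ?s - g u) has_integral (d * g ?s - integral {?s..?t} g)) {?s..?t}"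
        using int[of ?s ?t] st by (intro has_integral_diff) (auto simp: algebra_simps)
      have "norm (d * g ?s - integral {?s..?t} g) \<le> e * measure lborel {?s..?t}"
      proof (rule has_integral_bound_real[OF _ _ c])
        show "0 \<le> e" using e by simp
        show "finite ({} :: real set)" by simp
        fix u assume u: "u \<in> {?s..?t} - {}"
        have "0 \<le> u"
          using st(1) u by (intro order_trans[of 0 ?s u]) auto
        then have "dist (g ?s) (g u) < e"
          using u st d by (intro uc) (auto simp: dist_real_def algebra_simps)
        then show "norm (g ?s - g u) \<le> e" by (simp add: dist_real_def)
      qed
      then have "\<bar>d * g ?s - integral {?s..?t} g\<bar> \<le> d * e"
        using st d by (simp add: algebra_simps)
      moreover have "integral {0..?s} g + integral {?s..?t} g = integral {0..?t} g"
        using st by (intro Henstock_Kurzweil_Integration.integral_combine int) auto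
      moreover have "\<bar>d * (\<Sum>i<k. g (real i * d)) - integral {0..?s} g\<bar> \<le> real k * d * e"
        using Suc by simp
      ultimately show ?case
        by (simp add: algebra_simps)
    qed simp
    from this[of n] have "\<bar>d * (\<Sum>i<n. g (real i * d)) - integral {0..h} g\<bar> \<le> h * e"
      using n0 by (simp add: d_def)
    then show "norm (h / real n * (\<Sum>i<n. g (real i * h / real n)) - integral {0..h} g) < r"
      using e by (simp add: d_def)
  qed
qed

section \<open>Pathwise bounds on one short time interval\<close>

context
  fixes b :: "'a::euclidean_space \<Rightarrow> 'a" and L h :: real
  assumes L: "L > 0" "\<And>x y. norm (b x - b y) \<le> L * norm (x - y)"
    and h: "h \<ge> 0" "L * h \<le> 1 / 2"
begin

text \<open>Let I be the integral of the distance from the starting point x. The equation bounds I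
  by \<open>h\<^sup>2 * norm (b x) + J + (L * h) * I\<close>, and \<open>L * h \<le> 1 / 2\<close>
  absorbs the last term. The Euler error is at most \<open>L * I\<close>, so one absorption replaces
  Gronwall's inequality.\<close>

lemma euler_error_pathwise:
  assumes Y: "continuous_on {0..h} Y" and w: "continuous_on {0..h} w"
    and eq: "\<And>t. t \<in> {0..h} \<Longrightarrow> ((\<lambda>s. b (Y s)) has_integral (Y t - x - w t)) {0..t}"
  shows "norm (Y h - (x + h *\<^sub>R b x + w h)) \<le> 2 * L * (h\<^sup>2 * norm (b x) + integral {0..h} (\<lambda>s. norm (w s)))"
proof -
  define D where "D s = norm (Y s - x)" for s
  define I where "I = integral {0..h} D"
  define J where "J = integral {0..h} (\<lambda>s. norm (w s))"
  have Dc: "continuous_on {0..h} D"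
    unfolding D_def by (intro continuous_intros Y)
  have Di: "D integrable_on {0..t}" if "t \<in> {0..h}" for t
    using that by (intro integrable_continuous_real continuous_on_subset[OF Dc]) auto
  have bx: "norm (Y t - x - w t - t *\<^sub>R b x) \<le> L * I" if t: "t \<in> {0..h}" for t
  proof -
    have 1: "((\<lambda>s. b (Y s) - b x) has_integral (Y t - x - w t - t *\<^sub>R b x)) {0..t}"
      using has_integral_diff[OF eq[OF t] has_integral_const_real[of "b x" 0 t]] t by simp
    have "norm (integral {0..t} (\<lambda>s. b (Y s) - b x)) \<le> integral {0..t} (\<lambda>s. L * D s)"
      using 1 Di[OF t, unfolded D_def] by (intro integral_norm_bound_integral integrable_on_mult_right) (auto simp: D_def L)
    also have "\<dots> = L * integral {0..t} D" by simp
    also have "\<dots> \<le> L * I"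
      unfolding I_def using t L Di[of h] Di[OF t]
      by (intro mult_left_mono integral_subset_le) (auto simp: D_def)
    finally show ?thesis
      using 1 by (simp add: integral_unique)
  qed
  have Dle: "D t \<le> (h * norm (b x) + L * I) + norm (w t)" if t: "t \<in> {0..h}" for t
  proof -
    have "D t = norm ((Y t - x - w t - t *\<^sub>R b x) + t *\<^sub>R b x + w t)"
      by (simp add: D_def)
    also have "\<dots> \<le> norm (Y t - x - w t - t *\<^sub>R b x) + norm (t *\<^sub>R b x) + norm (w t)"
      by (meson norm_triangle_ineq order_trans add_right_mono)
    also have "norm (t *\<^sub>R b x) \<le> h * norm (b x)"
      using t by (simp add: mult_right_mono)
    finally show ?thesis using bx[OF t] by simp
  qed
  have wi: "(\<lambda>s. norm (w s)) integrable_on {0..h}"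
    by (intro integrable_continuous_real continuous_intros w)
  have "I \<le> integral {0..h} (\<lambda>t. (h * norm (b x) + L * I) + norm (w t))"
    unfolding I_def using Di[of h] h wi Dle
    by (intro integral_le integrable_add) (auto simp: I_def)
  also have "\<dots> = h * (h * norm (b x) + L * I) + J"
    using h wi by (subst Henstock_Kurzweil_Integration.integral_add) (auto simp: J_def)
  finally have "I \<le> h\<^sup>2 * norm (b x) + J + (L * h) * I"
    by (simp add: algebra_simps power2_eq_square)
  moreover have "I \<ge> 0"
    unfolding I_def by (rule Henstock_Kurzweil_Integration.integral_nonneg) (use Di[of h] h in \<open>auto simp: D_def\<close>)
  then have "(L * h) * I \<le> 1 / 2 * I"
    using h by (intro mult_right_mono) auto
  ultimately have "I \<le> 2 * (h\<^sup>2 * norm (b x) + J)"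
    by simp
  then have "L * I \<le> L * (2 * (h\<^sup>2 * norm (b x) + J))"
    using L by (intro mult_left_mono) auto
  with bx[of h] h show ?thesis
    by (simp add: J_def algebra_simps)
qed

text \<open>The common noise cancels in the difference, and the same absorption applies. This
  continuity in the starting point is what produces a jointly measurable flow.\<close>

lemma flow_lipschitz_pathwise:
  assumes Y: "continuous_on {0..h} Y" "continuous_on {0..h} Z"
    and eq: "\<And>t. t \<in> {0..h} \<Longrightarrow> ((\<lambda>s. b (Y s)) has_integral (Y t - x - w t)) {0..t}"
      "\<And>t. t \<in> {0..h} \<Longrightarrow> ((\<lambda>s. b (Z s)) has_integral (Z t - y - w t)) {0..t}"
  shows "norm (Y h - Z h) \<le> 2 * norm (x - y)"
proof -
  define D where "D s = norm (Y s - Z s)" for s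
  define I where "I = integral {0..h} D"
  have Dc: "continuous_on {0..h} D"
    unfolding D_def by (intro continuous_intros Y)
  have Di: "D integrable_on {0..t}" if "t \<in> {0..h}" for t
    using that by (intro integrable_continuous_real continuous_on_subset[OF Dc]) auto
  have Dle: "D t \<le> norm (x - y) + L * I" if t: "t \<in> {0..h}" for t
  proof -
    have 1: "((\<lambda>s. b (Y s) - b (Z s)) has_integral (Y t - Z t - (x - y))) {0..t}"
      using has_integral_diff[OF eq(1)[OF t] eq(2)[OF t]] by (simp add: algebra_simps)
    have "norm (integral {0..t} (\<lambda>s. b (Y s) - b (Z s))) \<le> integral {0..t} (\<lambda>s. L * D s)"
      using 1 Di[OF t, unfolded D_def] by (intro integral_norm_bound_integral integrable_on_mult_right) (auto simp: D_def L)
    also have "\<dots> = L * integral {0..t} D" by simp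
    also have "\<dots> \<le> L * I"
      unfolding I_def using t L Di[of h] Di[OF t]
      by (intro mult_left_mono integral_subset_le) (auto simp: D_def)
    finally have "norm (Y t - Z t - (x - y)) \<le> L * I"
      using 1 by (simp add: integral_unique)
    then show ?thesis
      unfolding D_def using norm_triangle_sub[of "Y t - Z t" "x - y"] by linarith
  qed
  have "I \<le> integral {0..h} (\<lambda>t. norm (x - y) + L * I)"
    unfolding I_def using Di[of h] h Dle by (intro integral_le) (auto simp: I_def)
  then have "I \<le> h * norm (x - y) + (L * h) * I"
    using h by (simp add: algebra_simps)
  moreover have "I \<ge> 0"
    unfolding I_def by (rule Henstock_Kurzweil_Integration.integral_nonneg) (use Di[of h] h in \<open>auto simp: D_def\<close>)
  then have "(L * h) * I \<le> 1 / 2 * I"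
    using h by (intro mult_right_mono) auto
  ultimately have "I \<le> 2 * (h * norm (x - y))"
    by simp
  then have "L * I \<le> L * (2 * (h * norm (x - y)))"
    using L by (intro mult_left_mono) auto
  also have "\<dots> = (L * h) * (2 * norm (x - y))" by simp
  also have "\<dots> \<le> 1 / 2 * (2 * norm (x - y))"
    using h by (intro mult_right_mono) auto
  finally show ?thesis
    using Dle[of h] h by (simp add: D_def)
qed

end

text \<open>One Brownian motion drives the solutions from all starting points, so two of them can be
  compared path by path.\<close>

locale dissipative_sde =
  fixes b :: "real ^ 'n \<Rightarrow> real ^ 'n"
    and L K R :: real
    and M :: "'w measure"
    and W :: "real \<Rightarrow> 'w \<Rightarrow> real ^ 'n"
    and Y :: "real ^ 'n \<Rightarrow> real \<Rightarrow> 'w \<Rightarrow> real ^ 'n"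
  assumes L: "L > 0" "\<And>x y. norm (b x - b y) \<le> L * norm (x - y)"
    and KR: "K > 0" "R > 0"
      "\<And>x y. norm (x - y) > R \<Longrightarrow> (x - y) \<bullet> (b x - b y) \<le> - K * (norm (x - y))\<^sup>2"
    and W: "brownian_motion M W"
    and Y: "\<And>x. sde_solution M W b x (Y x)"
begin

sublocale prob_space M
  using W by (simp add: brownian_motion_def)

lemma W_measurable [measurable]: "t \<ge> 0 \<Longrightarrow> W t \<in> borel_measurable M"
  using W by (simp add: brownian_motion_def)

lemma Y_measurable [measurable]: "t \<ge> 0 \<Longrightarrow> Y x t \<in> borel_measurable M"
  using Y[of x] by (simp add: sde_solution_def)

lemma b_measurable [measurable]: "b \<in> borel_measurable borel"
proof -
  have "L-lipschitz_on UNIV b"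
    using L by (intro lipschitz_onI) (auto simp: dist_norm)
  then show ?thesis
    by (intro borel_measurable_continuous_onI lipschitz_on_continuous_on)
qed

lemma distr_W:
  assumes t: "t > 0"
  shows "distr M borel (W t) = gaussian (sqrt t)"
proof -
  have "distr M borel (\<lambda>\<omega>. W t \<omega> - W 0 \<omega>) = gaussian (sqrt t)"
    using W t unfolding brownian_motion_def by (metis diff_zero order_refl)
  moreover have "AE \<omega> in M. W 0 \<omega> = 0"
    using W by (simp add: brownian_motion_def)
  then have "distr M borel (\<lambda>\<omega>. W t \<omega> - W 0 \<omega>) = distr M borel (W t)"
    using t by (intro distr_cong_AE) auto
  ultimately show ?thesis by simp
qed

lemma nn_integral_W_sq:
  assumes t: "t \<ge> 0"
  shows "(\<integral>\<^sup>+\<omega>. ennreal ((norm (W t \<omega>))\<^sup>2) \<partial>M) = ennreal (t * CARD('n))"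
\<comment> \<open>The Riemann sums begin at time 0, where the law of \<open>W t\<close> is
  degenerate and \<open>distr_W\<close> does not apply.\<close>
proof (cases "t = 0")
  case True
  have "AE \<omega> in M. W 0 \<omega> = 0"
    using W by (simp add: brownian_motion_def)
  then have "(\<integral>\<^sup>+\<omega>. ennreal ((norm (W 0 \<omega>))\<^sup>2) \<partial>M) = (\<integral>\<^sup>+\<omega>. 0 \<partial>M)"
    by (intro nn_integral_cong_AE) auto
  then show ?thesis using True by simp
next
  case False
  then have t: "t > 0" using t by simp
  have "(\<integral>\<^sup>+\<omega>. ennreal ((norm (W t \<omega>))\<^sup>2) \<partial>M) = (\<integral>\<^sup>+w. ennreal ((norm w)\<^sup>2) \<partial>distr M borel (W t))"
    using t by (subst nn_integral_distr) auto
  then show ?thesis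
    using t nn_integral_gaussian_norm_sq[of "sqrt t", where 'n='n] by (simp add: distr_W)
qed

lemma AE_paths:
  "AE \<omega> in M. continuous_on {0..} (\<lambda>t. W t \<omega>) \<and> continuous_on {0..} (\<lambda>t. Y x t \<omega>) \<and>
     (\<forall>t\<ge>0. ((\<lambda>s. b (Y x s \<omega>)) has_integral (Y x t \<omega> - x - W t \<omega>)) {0..t})"
  using W Y[of x] by (auto simp: brownian_motion_def sde_solution_def)

definition euler_error :: "real \<Rightarrow> real ^ 'n \<Rightarrow> 'w \<Rightarrow> real" where
  "euler_error h x \<omega> = norm (Y x h \<omega> - (x + h *\<^sub>R b x + W h \<omega>))"

text \<open>Riemann sums and Fatou's lemma replace a measurability argument for \<open>\<integral>\<^sub>0\<^sup>h \<bar>W\<^sub>s\<bar> ds\<close>.\<close>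

lemma euler_error_second_moment:
  assumes h: "h \<ge> 0" "L * h \<le> 1 / 2"
  shows "(\<integral>\<^sup>+\<omega>. ennreal ((euler_error h x \<omega>)\<^sup>2) \<partial>M)
    \<le> ennreal (8 * L\<^sup>2 * (h ^ 4 * (norm (b x))\<^sup>2 + h ^ 3 * CARD('n)))"
proof -
  define J where "J n \<omega> = h / real n * (\<Sum>i<n. norm (W (real i * h / real n) \<omega>))" for n \<omega>
  define \<phi> where "\<phi> j = (2 * L * (h\<^sup>2 * norm (b x) + j))\<^sup>2" for j
  have [simp]: "0 \<le> real i * h / real n" for i n :: nat
    using h by simp
  have [measurable]: "J n \<in> borel_measurable M" for n
    unfolding J_def by measurable
  have [measurable]: "\<phi> \<in> borel_measurable borel"
    unfolding \<phi>_def by measurable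
  have *: "AE \<omega> in M. ennreal ((euler_error h x \<omega>)\<^sup>2) \<le> liminf (\<lambda>n. ennreal (\<phi> (J n \<omega>)))"
    using AE_paths[of x]
  proof eventually_elim
    case (elim \<omega>)
    then have c: "continuous_on {0..h} (\<lambda>t. W t \<omega>)" "continuous_on {0..h} (\<lambda>t. Y x t \<omega>)"
      by (auto intro: continuous_on_subset)
    define I where "I = integral {0..h} (\<lambda>s. norm (W s \<omega>))"
    have "euler_error h x \<omega> \<le> 2 * L * (h\<^sup>2 * norm (b x) + I)"
      unfolding euler_error_def I_def using elim
      by (intro euler_error_pathwise L h c) auto
    then have "(euler_error h x \<omega>)\<^sup>2 \<le> \<phi> I"
      unfolding \<phi>_def by (intro power_mono) (auto simp: euler_error_def)
    moreover have "(\<lambda>n. J n \<omega>) \<longlonglongrightarrow> I"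
      unfolding J_def I_def by (intro riemann_sum_tendsto_integral h continuous_intros c)
    then have "(\<lambda>n. ennreal (\<phi> (J n \<omega>))) \<longlonglongrightarrow> ennreal (\<phi> I)"
      unfolding \<phi>_def by (intro tendsto_intros)
    then have "liminf (\<lambda>n. ennreal (\<phi> (J n \<omega>))) = ennreal (\<phi> I)"
      by (intro lim_imp_Liminf) auto
    ultimately show ?case by (simp add: ennreal_leI)
  qed
  let ?B = "8 * L\<^sup>2 * (h ^ 4 * (norm (b x))\<^sup>2 + h ^ 3 * CARD('n))"
  have B: "(\<integral>\<^sup>+\<omega>. ennreal (\<phi> (J n \<omega>)) \<partial>M) \<le> ennreal ?B" if n: "n > 0" for n
  proof -
    have S: "ennreal a + (\<Sum>i<n. ennreal c) = ennreal (a + real n * c)" if "a \<ge> 0" "c \<ge> 0" for a c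
      using that by (simp add: ennreal_mult ennreal_of_nat_eq_real_of_nat)
    let ?W = "\<lambda>i \<omega>. (norm (W (real i * h / real n) \<omega>))\<^sup>2"
    have "\<phi> (J n \<omega>) \<le> 8 * L\<^sup>2 * h ^ 4 * (norm (b x))\<^sup>2 + (\<Sum>i<n. 8 * L\<^sup>2 * h\<^sup>2 / n * ?W i \<omega>)" for \<omega>
    proof -
      \<comment> \<open>Cauchy-Schwarz: only the second moments of W at single times are then
        required, no joint law.\<close>
      have "(\<Sum>i<n. norm (W (real i * h / real n) \<omega>))\<^sup>2 \<le> (\<Sum>i<n. ?W i \<omega>) * n"
        using sum_squared_le_sum_of_squares[of "\<lambda>i. norm (W (real i * h / real n) \<omega>)" "{..<n}"] by simp
      then have "(J n \<omega>)\<^sup>2 \<le> (h / n)\<^sup>2 * ((\<Sum>i<n. ?W i \<omega>) * n)"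
        unfolding J_def power_mult_distrib by (intro mult_left_mono) auto
      also have "\<dots> = h\<^sup>2 / n * (\<Sum>i<n. ?W i \<omega>)"
        using n by (simp add: power2_eq_square field_simps)
      finally have J: "(J n \<omega>)\<^sup>2 \<le> h\<^sup>2 / n * (\<Sum>i<n. ?W i \<omega>)" .
      have "\<phi> (J n \<omega>) \<le> 4 * L\<^sup>2 * (2 * ((h\<^sup>2 * norm (b x))\<^sup>2 + (J n \<omega>)\<^sup>2))"
        unfolding \<phi>_def power_mult_distrib[of "2 * L"] using sum_squares_bound[of "h\<^sup>2 * norm (b x)" "J n \<omega>"]
        by (auto simp: power2_sum power_mult_distrib intro!: mult_left_mono)
      also have "\<dots> \<le> 4 * L\<^sup>2 * (2 * ((h\<^sup>2 * norm (b x))\<^sup>2 + h\<^sup>2 / n * (\<Sum>i<n. ?W i \<omega>)))"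
        using J by (intro mult_left_mono add_left_mono) auto
      also have "\<dots> = 8 * L\<^sup>2 * h ^ 4 * (norm (b x))\<^sup>2 + (\<Sum>i<n. 8 * L\<^sup>2 * h\<^sup>2 / n * ?W i \<omega>)"
        by (simp add: power_mult_distrib sum_distrib_left algebra_simps power2_eq_square eval_nat_numeral)
      finally show ?thesis .
    qed
    then have "(\<integral>\<^sup>+\<omega>. ennreal (\<phi> (J n \<omega>)) \<partial>M)
        \<le> (\<integral>\<^sup>+\<omega>. ennreal (8 * L\<^sup>2 * h ^ 4 * (norm (b x))\<^sup>2) + (\<Sum>i<n. ennreal (8 * L\<^sup>2 * h\<^sup>2 / n) * ennreal (?W i \<omega>)) \<partial>M)"
      by (intro nn_integral_mono)
        (simp add: ennreal_mult[symmetric] ennreal_plus[symmetric] sum_nonneg ennreal_leI del: ennreal_plus)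
    also have "\<dots> = ennreal (8 * L\<^sup>2 * h ^ 4 * (norm (b x))\<^sup>2) + (\<Sum>i<n. ennreal (8 * L\<^sup>2 * h\<^sup>2 / n) * ennreal (real i * h / real n * CARD('n)))"
      using h by (subst nn_integral_add) (auto simp: nn_integral_sum nn_integral_cmult nn_integral_W_sq emeasure_space_1)
    \<comment> \<open>Every grid time is at most h. The n equal terms then add up to the
      contribution of order h^3.\<close>
    also have "\<dots> \<le> ennreal (8 * L\<^sup>2 * h ^ 4 * (norm (b x))\<^sup>2) + (\<Sum>i<n. ennreal (8 * L\<^sup>2 * h\<^sup>2 / n * (h * CARD('n))))"
    proof (intro add_left_mono sum_mono)
      fix i assume "i \<in> {..<n}"
      then have "real i * h / real n * CARD('n) \<le> h * CARD('n)"
        using h n by (intro mult_right_mono) (auto simp: field_simps intro: mult_left_mono)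
      then show "ennreal (8 * L\<^sup>2 * h\<^sup>2 / n) * ennreal (real i * h / real n * CARD('n)) \<le> ennreal (8 * L\<^sup>2 * h\<^sup>2 / n * (h * CARD('n)))"
        using h by (subst ennreal_mult[symmetric]; (intro ennreal_leI mult_left_mono)?; simp)
    qed
    also have "\<dots> = ennreal (8 * L\<^sup>2 * h ^ 4 * (norm (b x))\<^sup>2 + n * (8 * L\<^sup>2 * h\<^sup>2 / n * (h * CARD('n))))"
      by (rule S) (use h in auto)
    also have "8 * L\<^sup>2 * h ^ 4 * (norm (b x))\<^sup>2 + n * (8 * L\<^sup>2 * h\<^sup>2 / n * (h * CARD('n))) = ?B"
      using n by (simp add: field_simps power2_eq_square eval_nat_numeral)
    finally show ?thesis .
  qed
  have "(\<integral>\<^sup>+\<omega>. ennreal ((euler_error h x \<omega>)\<^sup>2) \<partial>M) \<le> (\<integral>\<^sup>+\<omega>. liminf (\<lambda>n. ennreal (\<phi> (J n \<omega>))) \<partial>M)"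
    by (rule nn_integral_mono_AE) (rule *)
  also have "\<dots> \<le> liminf (\<lambda>n. \<integral>\<^sup>+\<omega>. ennreal (\<phi> (J n \<omega>)) \<partial>M)"
    by (rule nn_integral_liminf) measurable
  also have "\<dots> \<le> limsup (\<lambda>n. \<integral>\<^sup>+\<omega>. ennreal (\<phi> (J n \<omega>)) \<partial>M)"
    by (rule Liminf_le_Limsup) simp
  also have "\<dots> \<le> ennreal ?B"
    by (rule Limsup_bounded) (use B in \<open>auto intro: eventually_sequentiallyI[of 1]\<close>)
  finally show ?thesis .
qed

text \<open>\<open>Y\<close> itself is only measurable for each fixed starting point.\<close>

lemma jointly_measurable_flow:
  assumes h: "h \<ge> 0" "L * h \<le> 1 / 2"
  obtains Z where "case_prod Z \<in> borel \<Otimes>\<^sub>M M \<rightarrow>\<^sub>M borel" "\<And>x. AE \<omega> in M. Z x \<omega> = Y x h \<omega>"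
proof -
  obtain q :: "nat \<Rightarrow> real ^ 'n \<Rightarrow> real ^ 'n" where q: "\<And>i. simple_function borel (q i)" "\<And>x. (\<lambda>i. q i x) \<longlonglongrightarrow> x"
    using borel_measurable_implies_sequence_metric[of "\<lambda>x::real ^ 'n. x" borel 0] by auto
  \<comment> \<open>Where the sequence diverges, \<open>lim\<close> returns some default value; the
    limit function is measurable all the same.\<close>
  define Z where "Z x \<omega> = lim (\<lambda>i. Y (q i x) h \<omega>)" for x \<omega>
  show thesis
  proof (rule that[of Z])
    \<comment> \<open>A simple function \<open>q i\<close> takes finitely many values, so Y is only
      evaluated at finitely many fixed starting points.\<close>
    have "(\<lambda>z. Y (q i (fst z)) h (snd z)) \<in> borel \<Otimes>\<^sub>M M \<rightarrow>\<^sub>M borel" for i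
    proof (rule measurable_compose_countable'[where g="\<lambda>z. q i (fst z)" and I="range (q i)"])
      show "(\<lambda>z. Y y h (snd z)) \<in> borel \<Otimes>\<^sub>M M \<rightarrow>\<^sub>M borel" for y
        using h by measurable
      have fin: "finite (range (q i))"
        using simple_functionD(1)[OF q(1)[of i]] by simp
      then show "countable (range (q i))" by (rule countable_finite)
      have "q i \<in> borel \<rightarrow>\<^sub>M count_space (range (q i))"
        using simple_functionD(2)[OF q(1)[of i]] by (auto simp: measurable_count_space_eq2[OF fin])
      then show "(\<lambda>z. q i (fst z)) \<in> borel \<Otimes>\<^sub>M M \<rightarrow>\<^sub>M count_space (range (q i))"
        by measurable
    qed
    then show "case_prod Z \<in> borel \<Otimes>\<^sub>M M \<rightarrow>\<^sub>M borel"
      unfolding Z_def split_def by (rule borel_measurable_lim_metric)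
    fix x
    \<comment> \<open>For fixed x only countably many starting points occur, so the exceptional sets
      can be united. The resulting null set may still depend on x.\<close>
    have "AE \<omega> in M. \<forall>i. norm (Y (q i x) h \<omega> - Y x h \<omega>) \<le> 2 * norm (q i x - x)"
      unfolding AE_all_countable
    proof
      fix i
      show "AE \<omega> in M. norm (Y (q i x) h \<omega> - Y x h \<omega>) \<le> 2 * norm (q i x - x)"
        using AE_paths[of x] AE_paths[of "q i x"]
        by eventually_elim
          (rule flow_lipschitz_pathwise[OF L h], auto intro: continuous_on_subset)
    qed
    then show "AE \<omega> in M. Z x \<omega> = Y x h \<omega>"
    proof eventually_elim
      case (elim \<omega>)
      have "(\<lambda>i. 2 * norm (q i x - x)) \<longlonglongrightarrow> 0"
        using tendsto_mult_right_zero[OF tendsto_norm_zero[OF LIM_zero[OF q(2)[of x]]]] .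
      then have "(\<lambda>i. Y (q i x) h \<omega> - Y x h \<omega>) \<longlonglongrightarrow> 0"
        by (rule Lim_null_comparison[rotated]) (use elim in simp)
      then have "(\<lambda>i. Y (q i x) h \<omega>) \<longlonglongrightarrow> Y x h \<omega>"
        using LIM_zero_iff by blast
      then show ?case unfolding Z_def by (rule limI)
    qed
  qed
qed

text \<open>Invariance, given as an identity between averaged laws, becomes a statement about one
  map on a product space: a start drawn from \<pi>, independent of the noise, is sent to a point
  with law \<pi>.\<close>

lemma invariant_measure_flow:
  assumes inv: "invariant_measure M Y \<pi>" and h: "h \<ge> 0"
    and Z: "case_prod Z \<in> borel \<Otimes>\<^sub>M M \<rightarrow>\<^sub>M borel" "\<And>x. AE \<omega> in M. Z x \<omega> = Y x h \<omega>"
  shows "distr (\<pi> \<Otimes>\<^sub>M M) borel (case_prod Z) = \<pi>"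
proof (rule measure_eqI)
  have [measurable_cong]: "sets \<pi> = sets borel" and "prob_space \<pi>"
    using inv by (auto simp: invariant_measure_def)
  note Z(1)[measurable]
  fix A assume "A \<in> sets (distr (\<pi> \<Otimes>\<^sub>M M) borel (case_prod Z))"
  then have A[measurable]: "A \<in> sets borel" by simp
  have eq: "emeasure (distr M borel (Y x h)) A = (\<integral>\<^sup>+\<omega>. indicator A (Z x \<omega>) \<partial>M)" for x
  proof -
    have "emeasure (distr M borel (Y x h)) A = (\<integral>\<^sup>+\<omega>. indicator A (Y x h \<omega>) \<partial>M)"
      using h by (subst nn_integral_indicator[symmetric], simp, subst nn_integral_distr) auto
    also have "\<dots> = (\<integral>\<^sup>+\<omega>. indicator A (Z x \<omega>) \<partial>M)"
      using Z(2)[of x] by (intro nn_integral_cong_AE) auto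
    finally show ?thesis .
  qed
  have "emeasure (distr (\<pi> \<Otimes>\<^sub>M M) borel (case_prod Z)) A
      = (\<integral>\<^sup>+z. indicator A (case_prod Z z) \<partial>(\<pi> \<Otimes>\<^sub>M M))"
    by (subst nn_integral_indicator[symmetric], simp, subst nn_integral_distr) auto
  also have "\<dots> = (\<integral>\<^sup>+x. emeasure (distr M borel (Y x h)) A \<partial>\<pi>)"
    by (subst nn_integral_fst[symmetric]) (simp_all add: eq)
  also have "\<dots> = emeasure \<pi> A"
    using inv h A unfolding invariant_measure_def by blast
  finally show "emeasure (distr (\<pi> \<Otimes>\<^sub>M M) borel (case_prod Z)) A = emeasure \<pi> A" .
qed (use inv in \<open>simp add: invariant_measure_def\<close>)

end

section \<open>Second moment of the invariant measure\<close>

context dissipative_sde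
begin

definition drift_diff :: "real \<Rightarrow> real ^ 'n \<Rightarrow> real ^ 'n \<Rightarrow> real ^ 'n" where
  "drift_diff h x y = x - y + h *\<^sub>R (b x - b y)"

lemma norm_drift_diff_le:
  assumes "h \<ge> 0"
  shows "norm (drift_diff h x y) \<le> (1 + L * h) * norm (x - y)"
proof -
  have "norm (drift_diff h x y) \<le> norm (x - y) + h * norm (b x - b y)"
    unfolding drift_diff_def using assms by (metis abs_of_nonneg norm_scaleR norm_triangle_ineq)
  also have "\<dots> \<le> norm (x - y) + h * (L * norm (x - y))"
    using assms L(2) by (intro add_left_mono mult_left_mono) auto
  finally show ?thesis by (simp add: algebra_simps)
qed

lemma norm_drift_diff_ge:
  assumes "h \<ge> 0"
  shows "norm (drift_diff h x y) \<ge> (1 - L * h) * norm (x - y)"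
proof -
  have "norm (x - y) - h * norm (b x - b y) \<le> norm (drift_diff h x y)"
    unfolding drift_diff_def using assms norm_diff_ineq[of "x - y" "h *\<^sub>R (b x - b y)"] by simp
  moreover have "h * norm (b x - b y) \<le> h * (L * norm (x - y))"
    using assms L(2) by (intro mult_left_mono) auto
  ultimately show ?thesis by (simp add: algebra_simps)
qed

text \<open>In the expanded square, dissipativity contributes \<open>- 2 * K * h\<close> and the
  squared drift at most \<open>L\<^sup>2 * h\<^sup>2\<close>. Since
  \<open>L\<^sup>2 * h \<le> K\<close>, the latter spends at most half of the former.\<close>

lemma norm_drift_diff_far:
  assumes h: "h \<ge> 0" "L\<^sup>2 * h \<le> K" and r: "norm (x - y) > R"
  shows "(norm (drift_diff h x y))\<^sup>2 \<le> (1 - K * h) * (norm (x - y))\<^sup>2"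
proof -
  have *: "(norm (u + h *\<^sub>R v))\<^sup>2 = (norm u)\<^sup>2 + 2 * h * (u \<bullet> v) + h\<^sup>2 * (norm v)\<^sup>2" for u v :: "real ^ 'n"
    unfolding power2_norm_eq_inner
    by (simp add: inner_add_left inner_add_right inner_commute[of v u] power2_eq_square algebra_simps)
  have "(norm (drift_diff h x y))\<^sup>2
      = (norm (x - y))\<^sup>2 + 2 * h * ((x - y) \<bullet> (b x - b y)) + h\<^sup>2 * (norm (b x - b y))\<^sup>2"
    unfolding drift_diff_def by (rule *)
  also have "\<dots> \<le> (norm (x - y))\<^sup>2 + 2 * h * (- K * (norm (x - y))\<^sup>2) + h\<^sup>2 * (L * norm (x - y))\<^sup>2"
    using h KR(3)[OF r] L(2)[of x y] by (intro add_mono mult_left_mono power_mono) auto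
  also have "h\<^sup>2 * (L * norm (x - y))\<^sup>2 = (L\<^sup>2 * h) * (h * (norm (x - y))\<^sup>2)"
    by (simp add: power_mult_distrib power2_eq_square)
  also have "\<dots> \<le> K * (h * (norm (x - y))\<^sup>2)"
    using h by (intro mult_right_mono) auto
  finally show ?thesis by (simp add: algebra_simps)
qed

lemma norm_b_sq_le: "(norm (b x))\<^sup>2 \<le> 2 * (norm (b 0))\<^sup>2 + 2 * L\<^sup>2 * (norm x)\<^sup>2"
proof -
  have "norm (b x) \<le> norm (b 0) + L * norm x"
    using L(2)[of x 0] norm_triangle_sub[of "b x" "b 0"] by simp
  then have "(norm (b x))\<^sup>2 \<le> (norm (b 0) + L * norm x)\<^sup>2"
    by (intro power_mono) auto
  also have "\<dots> \<le> 2 * (norm (b 0))\<^sup>2 + 2 * (L * norm x)\<^sup>2"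
    using sum_squares_bound[of "norm (b 0)" "L * norm x"] by (simp add: power2_sum)
  finally show ?thesis by (simp add: power_mult_distrib)
qed

text \<open>Comparison with the Euler image of the origin: far from it the drift contracts, and near
  it the image lies in a ball of bounded radius.\<close>

lemma norm_euler_drift_le:
  assumes h: "h \<ge> 0" "L\<^sup>2 * h \<le> K" "K * h \<le> 1"
  shows "norm (x + h *\<^sub>R b x) \<le> (1 - K * h / 2) * norm x + ((1 + L * h) * R + h * norm (b 0))"
proof -
  have "norm (drift_diff h x 0) \<le> (1 - K * h / 2) * norm x + (1 + L * h) * R"
  proof (cases "norm x > R")
    case True
    have "(norm (drift_diff h x 0))\<^sup>2 \<le> (1 - K * h) * (norm x)\<^sup>2"
      using norm_drift_diff_far[OF h(1,2), of x 0] True by simp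
    also have "\<dots> \<le> (1 - K * h / 2)\<^sup>2 * (norm x)\<^sup>2"
    proof (intro mult_right_mono)
      have "1 - t \<le> (1 - t / 2)\<^sup>2" for t :: real
        using zero_le_power2[of t] by (simp add: power2_diff power_divide)
      then show "1 - K * h \<le> (1 - K * h / 2)\<^sup>2" .
    qed simp
    finally have "(norm (drift_diff h x 0))\<^sup>2 \<le> ((1 - K * h / 2) * norm x)\<^sup>2"
      by (simp only: power_mult_distrib)
    then have "norm (drift_diff h x 0) \<le> (1 - K * h / 2) * norm x"
      by (rule power2_le_imp_le) (intro mult_nonneg_nonneg, use h(3) in auto)
    moreover have "(1 + L * h) * R \<ge> 0" using KR L h by simp
    ultimately show ?thesis by simp
  next
    case False
    have "norm (drift_diff h x 0) \<le> (1 + L * h) * norm x"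
      using norm_drift_diff_le[OF h(1), of x 0] by simp
    also have "\<dots> \<le> (1 + L * h) * R"
      using False L h by (intro mult_left_mono) auto
    also have "\<dots> \<le> (1 - K * h / 2) * norm x + (1 + L * h) * R"
      using h by simp
    finally show ?thesis .
  qed
  moreover have "x + h *\<^sub>R b x = drift_diff h x 0 + h *\<^sub>R b 0"
    by (simp add: drift_diff_def algebra_simps)
  then have "norm (x + h *\<^sub>R b x) \<le> norm (drift_diff h x 0) + h * norm (b 0)"
    using h by (metis abs_of_nonneg norm_scaleR norm_triangle_ineq)
  ultimately show ?thesis by simp
qed

lemma euler_error_measurable: "h \<ge> 0 \<Longrightarrow> euler_error h x \<in> borel_measurable M"
  unfolding euler_error_def[abs_def] by measurable

text \<open>A Lyapunov bound for the squared norm. The constant C blows up as h tends to 0, which is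
  harmless because the bound is applied at one fixed h only.\<close>

lemma flow_second_moment:
  assumes h: "h > 0" "L * h \<le> 1 / 2" "L\<^sup>2 * h \<le> K" "K * h \<le> 1" "384 * L ^ 4 * h\<^sup>2 \<le> K\<^sup>2"
  obtains C where "C \<ge> 0"
    "\<And>x. (\<integral>\<^sup>+\<omega>. ennreal ((norm (Y x h \<omega>))\<^sup>2) \<partial>M) \<le> ennreal ((1 - K * h / 4) * (norm x)\<^sup>2 + C)"
proof -
  define \<delta> where "\<delta> = K * h / 2"
  define c where "c = (1 + L * h) * R + h * norm (b 0)"
  define d where "d = real CARD('n)"
  define C where "C = 3 / \<delta> * (c\<^sup>2 + h * d + 8 * L\<^sup>2 * (h ^ 4 * (2 * (norm (b 0))\<^sup>2) + h ^ 3 * d))"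
  have \<delta>: "0 < \<delta>" "\<delta> < 1"
    using h KR by (auto simp: \<delta>_def)
  have "C \<ge> 0"
    using \<delta> h by (simp add: C_def d_def)
  moreover have "(\<integral>\<^sup>+\<omega>. ennreal ((norm (Y x h \<omega>))\<^sup>2) \<partial>M) \<le> ennreal ((1 - K * h / 4) * (norm x)\<^sup>2 + C)" for x
  proof -
    let ?e = "euler_error h x"
    have [measurable]: "?e \<in> borel_measurable M"
      using h by (intro euler_error_measurable) simp
    have "(norm (Y x h \<omega>))\<^sup>2 \<le> ((1 - \<delta>) * (norm x)\<^sup>2 + 3 / \<delta> * c\<^sup>2) + (3 / \<delta> * (norm (W h \<omega>))\<^sup>2 + 3 / \<delta> * (?e \<omega>)\<^sup>2)" for \<omega>
    proof -
      define u where "u = c + norm (W h \<omega>) + ?e \<omega>"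
      have "norm (Y x h \<omega>) \<le> norm (x + h *\<^sub>R b x) + norm (W h \<omega>) + ?e \<omega>"
        unfolding euler_error_def
        by (smt (verit) norm_triangle_ineq norm_triangle_sub)
      also have "\<dots> \<le> (1 - \<delta>) * norm x + u"
        using norm_euler_drift_le[of h x] h by (simp add: u_def c_def \<delta>_def)
      finally have "(norm (Y x h \<omega>))\<^sup>2 \<le> ((1 - \<delta>) * norm x + u)\<^sup>2"
        by (intro power_mono) auto
      \<comment> \<open>Convexity of the square with weights \<open>1 - \<delta>\<close> and
        \<delta>, written as an identity with its remainder.\<close>
      also have "\<dots> = (1 - \<delta>) * (norm x)\<^sup>2 + u\<^sup>2 / \<delta> - (1 - \<delta>) / \<delta> * (\<delta> * norm x - u)\<^sup>2"
        using \<delta> by (simp add: field_simps power2_eq_square)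
      also have "\<dots> \<le> (1 - \<delta>) * (norm x)\<^sup>2 + u\<^sup>2 / \<delta>"
        using \<delta> by simp
      finally have 1: "(norm (Y x h \<omega>))\<^sup>2 \<le> (1 - \<delta>) * (norm x)\<^sup>2 + u\<^sup>2 / \<delta>" .
      have "u\<^sup>2 \<le> 3 * (c\<^sup>2 + (norm (W h \<omega>))\<^sup>2 + (?e \<omega>)\<^sup>2)"
        unfolding u_def using sum_squares_bound[of c "norm (W h \<omega>)"] sum_squares_bound[of c "?e \<omega>"] sum_squares_bound[of "norm (W h \<omega>)" "?e \<omega>"]
        by (simp add: power2_eq_square algebra_simps)
      then have "u\<^sup>2 / \<delta> \<le> 3 * (c\<^sup>2 + (norm (W h \<omega>))\<^sup>2 + (?e \<omega>)\<^sup>2) / \<delta>"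
        using \<delta> by (intro divide_right_mono) auto
      with 1 show ?thesis
        by (simp add: add_divide_distrib algebra_simps)
    qed
    then have "(\<integral>\<^sup>+\<omega>. ennreal ((norm (Y x h \<omega>))\<^sup>2) \<partial>M)
      \<le> (\<integral>\<^sup>+\<omega>. ennreal ((1 - \<delta>) * (norm x)\<^sup>2 + 3 / \<delta> * c\<^sup>2) +
            (ennreal (3 / \<delta>) * ennreal ((norm (W h \<omega>))\<^sup>2) + ennreal (3 / \<delta>) * ennreal ((?e \<omega>)\<^sup>2)) \<partial>M)"
      using \<delta> by (intro nn_integral_mono)
        (simp add: ennreal_mult[symmetric] ennreal_plus[symmetric] ennreal_leI del: ennreal_plus)
    also have "\<dots> = ennreal ((1 - \<delta>) * (norm x)\<^sup>2 + 3 / \<delta> * c\<^sup>2) +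
            (ennreal (3 / \<delta>) * ennreal (h * d) + ennreal (3 / \<delta>) * (\<integral>\<^sup>+\<omega>. ennreal ((?e \<omega>)\<^sup>2) \<partial>M))"
      using h by (simp add: nn_integral_add nn_integral_cmult nn_integral_W_sq emeasure_space_1 d_def)
    also have "\<dots> \<le> ennreal ((1 - \<delta>) * (norm x)\<^sup>2 + 3 / \<delta> * c\<^sup>2) +
            (ennreal (3 / \<delta>) * ennreal (h * d) + ennreal (3 / \<delta>) * ennreal (8 * L\<^sup>2 * (h ^ 4 * (norm (b x))\<^sup>2 + h ^ 3 * d)))"
      unfolding d_def using h euler_error_second_moment[of h x] by (intro add_left_mono mult_left_mono) auto
    also have "\<dots> = ennreal ((1 - \<delta>) * (norm x)\<^sup>2 + 3 / \<delta> * c\<^sup>2 + (3 / \<delta> * (h * d) + 3 / \<delta> * (8 * L\<^sup>2 * (h ^ 4 * (norm (b x))\<^sup>2 + h ^ 3 * d))))"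
      using \<delta> h by (simp add: ennreal_mult[symmetric] ennreal_plus[symmetric] d_def del: ennreal_plus)
    also have "\<dots> \<le> ennreal ((1 - K * h / 4) * (norm x)\<^sup>2 + C)"
    proof (rule ennreal_leI)
      have "h ^ 4 * (norm (b x))\<^sup>2 \<le> h ^ 4 * (2 * (norm (b 0))\<^sup>2 + 2 * L\<^sup>2 * (norm x)\<^sup>2)"
        using h norm_b_sq_le[of x] by (intro mult_left_mono) auto
      then have "3 / \<delta> * (8 * L\<^sup>2 * (h ^ 4 * (norm (b x))\<^sup>2 + h ^ 3 * d))
        \<le> 3 / \<delta> * (8 * L\<^sup>2 * (h ^ 4 * (2 * (norm (b 0))\<^sup>2 + 2 * L\<^sup>2 * (norm x)\<^sup>2) + h ^ 3 * d))"
        using \<delta> h norm_b_sq_le[of x] by (intro mult_left_mono add_right_mono) auto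
      also have "\<dots> = 3 / \<delta> * (8 * L\<^sup>2 * (h ^ 4 * (2 * (norm (b 0))\<^sup>2) + h ^ 3 * d)) + (48 / \<delta> * L ^ 4 * h ^ 4) * (norm x)\<^sup>2"
        by (simp add: algebra_simps eval_nat_numeral)
      finally have 1: "3 / \<delta> * (8 * L\<^sup>2 * (h ^ 4 * (norm (b x))\<^sup>2 + h ^ 3 * d))
        \<le> 3 / \<delta> * (8 * L\<^sup>2 * (h ^ 4 * (2 * (norm (b 0))\<^sup>2) + h ^ 3 * d)) + (48 / \<delta> * L ^ 4 * h ^ 4) * (norm x)\<^sup>2" .
      \<comment> \<open>The Euler error grows with the squared norm of x as well. For its
        coefficient to be at most half of \<delta>, \<open>96 * L ^ 4 * h ^ 4\<close> must not
        exceed \<open>\<delta>\<^sup>2\<close>, which is \<open>K\<^sup>2 * h\<^sup>2 / 4\<close>;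
        hence the number 384.\<close>
      have "96 * L ^ 4 * h ^ 4 = (384 * L ^ 4 * h\<^sup>2) * (h\<^sup>2 / 4)"
        by (simp add: eval_nat_numeral)
      also have "\<dots> \<le> K\<^sup>2 * (h\<^sup>2 / 4)"
        using h by (intro mult_right_mono) auto
      finally have "48 / \<delta> * L ^ 4 * h ^ 4 \<le> \<delta> / 2"
        using h KR by (simp add: \<delta>_def field_simps power2_eq_square)
      then have "(48 / \<delta> * L ^ 4 * h ^ 4) * (norm x)\<^sup>2 \<le> \<delta> / 2 * (norm x)\<^sup>2"
        by (intro mult_right_mono) auto
      moreover have "C = 3 / \<delta> * c\<^sup>2 + 3 / \<delta> * (h * d) + 3 / \<delta> * (8 * L\<^sup>2 * (h ^ 4 * (2 * (norm (b 0))\<^sup>2) + h ^ 3 * d))"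
        by (simp only: C_def distrib_left)
      moreover have "(1 - \<delta>) * (norm x)\<^sup>2 + \<delta> / 2 * (norm x)\<^sup>2 = (1 - K * h / 4) * (norm x)\<^sup>2"
        by (simp add: \<delta>_def algebra_simps)
      ultimately show "(1 - \<delta>) * (norm x)\<^sup>2 + 3 / \<delta> * c\<^sup>2 + (3 / \<delta> * (h * d) + 3 / \<delta> * (8 * L\<^sup>2 * (h ^ 4 * (norm (b x))\<^sup>2 + h ^ 3 * d)))
        \<le> (1 - K * h / 4) * (norm x)\<^sup>2 + C"
        using 1 by linarith
    qed
    finally show ?thesis .
  qed
  ultimately show thesis by (rule that)
qed

text \<open>Integrating the Lyapunov bound against \<pi> and subtracting \<theta> times the moment
  would presuppose that the moment is finite. So the squared norm is truncated at level N, the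
  subtraction is done between finite quantities, and Fatou's lemma removes N.\<close>

lemma invariant_measure_second_moment:
  assumes inv: "invariant_measure M Y \<pi>"
  shows "(\<integral>\<^sup>+x. ennreal ((norm x)\<^sup>2) \<partial>\<pi>) < \<infinity>"
proof -
  have [measurable_cong]: "sets \<pi> = sets borel" and "prob_space \<pi>"
    using inv by (auto simp: invariant_measure_def)
  interpret \<pi>: prob_space \<pi> by fact
  \<comment> \<open>The last entry yields \<open>400 * L ^ 4 * h\<^sup>2 \<le> K\<^sup>2\<close>, a
    round version of the condition with 384.\<close>
  define h where "h = Min {1 / (2 * L), K / L\<^sup>2, 1 / K, K / (20 * L\<^sup>2)}"
  have h: "h > 0" "h \<le> 1 / (2 * L)" "h \<le> K / L\<^sup>2" "h \<le> 1 / K" "h \<le> K / (20 * L\<^sup>2)"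
    using L KR by (auto simp: h_def)
  have "20 * L\<^sup>2 * h \<le> K"
    using h L by (simp add: field_simps)
  then have "(20 * L\<^sup>2 * h)\<^sup>2 \<le> K\<^sup>2"
    using h by (intro power_mono) auto
  then have "400 * L ^ 4 * h\<^sup>2 \<le> K\<^sup>2"
    by (simp add: power_mult_distrib)
  moreover have "L ^ 4 * h\<^sup>2 \<ge> 0" by simp
  ultimately have "384 * L ^ 4 * h\<^sup>2 \<le> K\<^sup>2" by linarith
  then have h': "L * h \<le> 1 / 2" "L\<^sup>2 * h \<le> K" "K * h \<le> 1" "384 * L ^ 4 * h\<^sup>2 \<le> K\<^sup>2"
    using h L KR by (auto simp: field_simps)
  define \<theta> where "\<theta> = 1 - K * h / 4"
  have \<theta>: "0 \<le> \<theta>" "\<theta> < 1"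
    using h' h KR by (auto simp: \<theta>_def)
  obtain C where C: "C \<ge> 0" "\<And>x. (\<integral>\<^sup>+\<omega>. ennreal ((norm (Y x h \<omega>))\<^sup>2) \<partial>M) \<le> ennreal (\<theta> * (norm x)\<^sup>2 + C)"
    using flow_second_moment[OF h(1) h'] unfolding \<theta>_def by blast
  obtain Z where Z: "case_prod Z \<in> borel \<Otimes>\<^sub>M M \<rightarrow>\<^sub>M borel" "\<And>x. AE \<omega> in M. Z x \<omega> = Y x h \<omega>"
    using jointly_measurable_flow[of h] h h' by auto
  note Z(1)[measurable]
  let ?V = "\<lambda>x::real ^ 'n. (norm x)\<^sup>2"
  let ?g = "\<lambda>N::nat. \<lambda>x::real ^ 'n. ennreal (if ?V x \<le> real N then ?V x else 0)"
  have B: "(\<integral>\<^sup>+x. ?g N x \<partial>\<pi>) \<le> ennreal (C / (1 - \<theta>))" for N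
  proof -
    let ?F = "\<integral>\<^sup>+x. ennreal (min (\<theta> * ?V x) N) \<partial>\<pi>"
    have "?F + ennreal (1 - \<theta>) * (\<integral>\<^sup>+x. ?g N x \<partial>\<pi>) = (\<integral>\<^sup>+x. ennreal (min (\<theta> * ?V x) N) + ennreal (1 - \<theta>) * ?g N x \<partial>\<pi>)"
      by (simp add: nn_integral_add nn_integral_cmult)
    also have "\<dots> \<le> (\<integral>\<^sup>+x. ennreal (min (?V x) N) \<partial>\<pi>)"
    proof (rule nn_integral_mono)
      fix x
      have "\<theta> * ?V x \<le> ?V x"
        using \<theta> by (intro mult_left_le_one_le) auto
      \<comment> \<open>Where V is at most N both minima are attained by the first argument and
        equality holds; elsewhere the second summand vanishes.\<close>
      then have "min (\<theta> * ?V x) N + (1 - \<theta>) * (if ?V x \<le> real N then ?V x else 0) \<le> min (?V x) N"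
        by (auto simp: algebra_simps)
      then show "ennreal (min (\<theta> * ?V x) N) + ennreal (1 - \<theta>) * ?g N x \<le> ennreal (min (?V x) N)"
        using \<theta> by (simp add: ennreal_mult[symmetric] ennreal_plus[symmetric] ennreal_leI del: ennreal_plus)
    qed
    also have "\<dots> = (\<integral>\<^sup>+x. ennreal (min (?V x) N) \<partial>distr (\<pi> \<Otimes>\<^sub>M M) borel (case_prod Z))"
      using invariant_measure_flow[OF inv _ Z] h by simp
    also have "\<dots> = (\<integral>\<^sup>+x. \<integral>\<^sup>+\<omega>. ennreal (min (?V (Z x \<omega>)) N) \<partial>M \<partial>\<pi>)"
      by (subst nn_integral_distr) (simp_all add: nn_integral_fst[symmetric] split_def)
    also have "\<dots> \<le> (\<integral>\<^sup>+x. ennreal (min (\<theta> * ?V x) N) + ennreal C \<partial>\<pi>)"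
    proof (rule nn_integral_mono)
      fix x
      have "(\<integral>\<^sup>+\<omega>. ennreal (min (?V (Z x \<omega>)) N) \<partial>M) \<le> (\<integral>\<^sup>+\<omega>. ennreal (?V (Z x \<omega>)) \<partial>M)"
        by (intro nn_integral_mono ennreal_leI) auto
      also have "\<dots> = (\<integral>\<^sup>+\<omega>. ennreal (?V (Y x h \<omega>)) \<partial>M)"
        using Z(2)[of x] by (intro nn_integral_cong_AE) auto
      also note C(2)
      finally have 1: "(\<integral>\<^sup>+\<omega>. ennreal (min (?V (Z x \<omega>)) N) \<partial>M) \<le> ennreal (\<theta> * ?V x + C)" .
      have "(\<integral>\<^sup>+\<omega>. ennreal (min (?V (Z x \<omega>)) N) \<partial>M) \<le> (\<integral>\<^sup>+\<omega>. ennreal N \<partial>M)"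
        by (intro nn_integral_mono ennreal_leI) auto
      then have 2: "(\<integral>\<^sup>+\<omega>. ennreal (min (?V (Z x \<omega>)) N) \<partial>M) \<le> ennreal N"
        by (simp add: emeasure_space_1)
      have "(\<integral>\<^sup>+\<omega>. ennreal (min (?V (Z x \<omega>)) N) \<partial>M) \<le> ennreal (min (\<theta> * ?V x + C) N)"
        using 1 2 by (simp add: min_def)
      also have "\<dots> \<le> ennreal (min (\<theta> * ?V x) N + C)"
        using C(1) by (intro ennreal_leI) auto
      also have "\<dots> = ennreal (min (\<theta> * ?V x) N) + ennreal C"
        using C(1) \<theta> by simp
      finally show "(\<integral>\<^sup>+\<omega>. ennreal (min (?V (Z x \<omega>)) N) \<partial>M) \<le> ennreal (min (\<theta> * ?V x) N) + ennreal C" .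
    qed
    also have "\<dots> = ?F + ennreal C"
      by (simp add: nn_integral_add \<pi>.emeasure_space_1)
    finally have *: "?F + ennreal (1 - \<theta>) * (\<integral>\<^sup>+x. ?g N x \<partial>\<pi>) \<le> ?F + ennreal C" .
    \<comment> \<open>Only this finiteness allows cancelling \<open>?F\<close> on both
      sides.\<close>
    have "?F \<le> (\<integral>\<^sup>+x. ennreal N \<partial>\<pi>)"
      by (intro nn_integral_mono ennreal_leI) auto
    then have "?F \<noteq> \<infinity>"
      by (auto simp: \<pi>.emeasure_space_1 top_unique)
    then have "ennreal (1 - \<theta>) * (\<integral>\<^sup>+x. ?g N x \<partial>\<pi>) \<le> ennreal C"
      using * by (simp add: ennreal_add_left_cancel_le)
    then have "ennreal (1 / (1 - \<theta>)) * (ennreal (1 - \<theta>) * (\<integral>\<^sup>+x. ?g N x \<partial>\<pi>)) \<le> ennreal (1 / (1 - \<theta>)) * ennreal C"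
      by (rule mult_left_mono) simp
    moreover have "ennreal (1 / (1 - \<theta>)) * ennreal (1 - \<theta>) = 1"
      using \<theta> by (simp add: ennreal_mult[symmetric])
    ultimately show ?thesis
      using \<theta> C(1) by (simp add: mult.assoc[symmetric] ennreal_mult[symmetric])
  qed
  have lim: "liminf (\<lambda>N. ?g N x) = ennreal (?V x)" for x
  proof (rule lim_imp_Liminf)
    obtain N :: nat where "?V x \<le> real N" using real_arch_simple by blast
    then have "\<forall>n\<ge>N. ?g n x = ennreal (?V x)" by auto
    then show "(\<lambda>N. ?g N x) \<longlonglongrightarrow> ennreal (?V x)"
      by (intro tendsto_eventually eventually_sequentiallyI[of N]) auto
  qed simp
  have "(\<integral>\<^sup>+x. ennreal (?V x) \<partial>\<pi>) = (\<integral>\<^sup>+x. liminf (\<lambda>N. ?g N x) \<partial>\<pi>)"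
    by (simp add: lim)
  also have "\<dots> \<le> liminf (\<lambda>N. \<integral>\<^sup>+x. ?g N x \<partial>\<pi>)"
    by (rule nn_integral_liminf) measurable
  also have "\<dots> \<le> limsup (\<lambda>N. \<integral>\<^sup>+x. ?g N x \<partial>\<pi>)"
    by (rule Liminf_le_Limsup) simp
  also have "\<dots> \<le> ennreal (C / (1 - \<theta>))"
    by (rule Limsup_bounded) (use B in auto)
  finally show ?thesis
    by (simp add: order_le_less_trans)
qed

end

section \<open>Contraction of the coupled Euler step\<close>

definition cost_fun :: "real \<Rightarrow> real \<Rightarrow> real \<Rightarrow> real" where
  "cost_fun a \<epsilon> r = 1 - exp (- (a * r)) + \<epsilon> * r\<^sup>2"

lemma cost_fun_measurable [measurable]: "cost_fun a \<epsilon> \<in> borel_measurable borel"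
  unfolding cost_fun_def[abs_def] by measurable

lemma one_minus_exp_add_le:
  assumes "x \<ge> 0" "y \<ge> 0"
  shows "1 - exp (- (x + y)) \<le> 1 - exp (- x) + (y::real)"
proof -
  have "exp (- x) * (1 - exp (- y)) \<le> 1 * y"
    using assms exp_ge_add_one_self[of "- y"] by (intro mult_mono) auto
  moreover have "exp (- (x + y)) = exp (- x) * exp (- y)"
    by (simp flip: exp_add)
  ultimately show ?thesis by (simp add: right_diff_distrib)
qed

context
  fixes a \<epsilon> :: real
  assumes a: "a > 0" and \<epsilon>: "\<epsilon> > 0"
begin

lemma cost_fun_strict_mono: "0 \<le> r \<Longrightarrow> r < s \<Longrightarrow> cost_fun a \<epsilon> r < cost_fun a \<epsilon> s"
  unfolding cost_fun_def using a \<epsilon>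
  by (intro add_less_le_mono) (auto intro!: mult_left_mono power_mono)

lemma cost_fun_mono: "0 \<le> r \<Longrightarrow> r \<le> s \<Longrightarrow> cost_fun a \<epsilon> r \<le> cost_fun a \<epsilon> s"
  using cost_fun_strict_mono[of r s] by (cases "r = s") auto

lemma cost_fun_nonneg: "0 \<le> r \<Longrightarrow> 0 \<le> cost_fun a \<epsilon> r"
  using cost_fun_mono[of 0 r] by (simp add: cost_fun_def)

lemma cost_fun_le: "cost_fun a \<epsilon> r \<le> 1 + \<epsilon> * r\<^sup>2"
  by (simp add: cost_fun_def)

lemma square_le_cost_fun: "0 \<le> r \<Longrightarrow> \<epsilon> * r\<^sup>2 \<le> cost_fun a \<epsilon> r"
  using a by (simp add: cost_fun_def)

text \<open>Governs the price of an additional error e: the slope of the cost at r is at most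
  \<open>a + 2 * \<epsilon> * r\<close>, and only the quadratic part has positive curvature.\<close>

lemma cost_fun_add_le:
  assumes "0 \<le> r" "0 \<le> e"
  shows "cost_fun a \<epsilon> (r + e) \<le> cost_fun a \<epsilon> r + (a + 2 * \<epsilon> * r) * e + \<epsilon> * e\<^sup>2"
proof -
  have "1 - exp (- (a * r + a * e)) \<le> 1 - exp (- (a * r)) + a * e"
    using assms a by (intro one_minus_exp_add_le) auto
  then show ?thesis
    by (simp add: cost_fun_def power2_sum algebra_simps)
qed

text \<open>Up to r = 1 the concave part is at least \<open>a * r / (1 + a * r)\<close>; beyond, r
  is below its square, which the quadratic part controls.\<close>

lemma linear_le_cost_fun:
  assumes "0 \<le> r"
  shows "r \<le> max ((1 + a) / a) (1 / \<epsilon>) * cost_fun a \<epsilon> r"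
proof (cases "r \<le> 1")
  case True
  have "exp (- (a * r)) \<le> 1 / (1 + a * r)"
    unfolding exp_minus inverse_eq_divide using assms a exp_ge_add_one_self[of "a * r"]
    by (intro divide_left_mono mult_pos_pos) (auto intro: add_pos_nonneg)
  moreover have "1 + a * r > 0"
    using assms a by (intro add_pos_nonneg) auto
  then have "a * r / (1 + a * r) = 1 - 1 / (1 + a * r)"
    by (simp add: field_simps)
  ultimately have "a * r / (1 + a * r) \<le> 1 - exp (- (a * r))"
    by linarith
  moreover have "a * r / (1 + a) \<le> a * r / (1 + a * r)"
    using assms a True by (intro divide_left_mono mult_pos_pos) (auto intro: add_pos_nonneg mult_left_le)
  moreover have "1 - exp (- (a * r)) \<le> cost_fun a \<epsilon> r"
    using \<epsilon> by (simp add: cost_fun_def)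
  ultimately have "a * r / (1 + a) \<le> cost_fun a \<epsilon> r" by linarith
  then have "r \<le> (1 + a) / a * cost_fun a \<epsilon> r"
    using a by (simp add: field_simps)
  also have "\<dots> \<le> max ((1 + a) / a) (1 / \<epsilon>) * cost_fun a \<epsilon> r"
    using assms by (intro mult_right_mono cost_fun_nonneg) auto
  finally show ?thesis .
next
  case False
  then have "r \<le> r\<^sup>2" by (simp add: power2_eq_square)
  also have "\<dots> \<le> 1 / \<epsilon> * cost_fun a \<epsilon> r"
    using square_le_cost_fun[OF assms] \<epsilon> by (simp add: field_simps)
  also have "\<dots> \<le> max ((1 + a) / a) (1 / \<epsilon>) * cost_fun a \<epsilon> r"
    using assms by (intro mult_right_mono cost_fun_nonneg) auto
  finally show ?thesis .
qed

end

text \<open>The left side minus 2 is the square of \<open>exp (u / 2) - exp (- (u / 2))\<close>. For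
  v \<ge> 0 the difference \<open>exp v - exp (- v)\<close> is at least 2 v, since
  \<open>1 - v + v\<^sup>2 / 2\<close> dominates \<open>exp (- v)\<close>: its product with the
  quadratic Taylor polynomial of \<open>exp v\<close> is \<open>1 + v ^ 4 / 4\<close>.\<close>

lemma exp_add_exp_minus_ge: "exp u + exp (- u) \<ge> 2 + u\<^sup>2" for u :: real
proof -
  have half: "(exp v - exp (- v))\<^sup>2 \<ge> (2 * v)\<^sup>2" if v: "v \<ge> 0" for v :: real
  proof (rule power_mono)
    have "(1 + v + v\<^sup>2 / 2) * (1 - v + v\<^sup>2 / 2) = 1 + v ^ 4 / 4"
      by (simp add: field_simps power2_eq_square eval_nat_numeral)
    moreover have "(1 + v + v\<^sup>2 / 2) * (1 - v + v\<^sup>2 / 2) \<le> exp v * (1 - v + v\<^sup>2 / 2)"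
    proof (rule mult_right_mono[OF exp_lower_Taylor_quadratic[OF v]])
      have "0 \<le> (1 - v)\<^sup>2" by simp
      then show "0 \<le> 1 - v + v\<^sup>2 / 2" by (simp add: power2_eq_square algebra_simps)
    qed
    ultimately have "1 \<le> exp v * (1 - v + v\<^sup>2 / 2)"
      using zero_le_power[OF v, of 4] by linarith
    then have "exp (- v) \<le> 1 - v + v\<^sup>2 / 2"
      by (simp add: exp_minus field_simps)
    then show "2 * v \<le> exp v - exp (- v)"
      using exp_lower_Taylor_quadratic[OF v] by linarith
  qed (use v in simp)
  have "(exp (\<bar>u\<bar> / 2) - exp (- (\<bar>u\<bar> / 2)))\<^sup>2 = exp \<bar>u\<bar> + exp (- \<bar>u\<bar>) - 2"
    by (simp add: power2_diff flip: exp_double exp_add)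
  moreover have "exp \<bar>u\<bar> + exp (- \<bar>u\<bar>) = exp u + exp (- u)"
    by (cases "u \<ge> 0") auto
  ultimately show ?thesis
    using half[of "\<bar>u\<bar> / 2"] by simp
qed

text \<open>The symmetrised cost gains from the concavity of \<open>1 - exp (- a r)\<close>.\<close>

lemma cost_fun_symmetric_le:
  assumes "\<epsilon> \<ge> 0"
  shows "cost_fun a \<epsilon> (\<rho> - s) + cost_fun a \<epsilon> (\<rho> + s)
    \<le> 2 * (1 - exp (- (a * \<rho>)) + \<epsilon> * \<rho>\<^sup>2 - (exp (- (a * \<rho>)) * a\<^sup>2 / 2 - \<epsilon>) * s\<^sup>2)"
proof -
  have "exp (- (a * (\<rho> - s))) + exp (- (a * (\<rho> + s))) = exp (- (a * \<rho>)) * (exp (a * s) + exp (- (a * s)))"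
    by (simp add: algebra_simps flip: exp_add)
  moreover have "exp (- (a * \<rho>)) * (2 + (a * s)\<^sup>2) \<le> exp (- (a * \<rho>)) * (exp (a * s) + exp (- (a * s)))"
    by (intro mult_left_mono exp_add_exp_minus_ge) auto
  ultimately show ?thesis
    by (simp add: cost_fun_def power2_sum power2_diff algebra_simps)
qed

text \<open>The unit of account is u = a L R h, a bound for the amount the drift adds to
  \<open>a * r\<close>. The choice of a makes the concave gain
  \<open>a\<^sup>2 / 2 * (h * s2)\<close> equal to 4 u, of which 2 u survive the drift. The choice
  of \<epsilon> makes the growth of the quadratic part, through the drift and through the variance,
  cost exactly one u with the factor \<open>exp (- (a * R))\<close>. One u with that factor
  remains.\<close>

lemma reflection_gain_arith:
  fixes a L R s2 \<epsilon> h r \<rho> :: real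
  assumes pos: "L > 0" "R > 0" "s2 > 0" "h > 0" and r: "0 \<le> r" "r \<le> R" "0 \<le> \<rho>" "\<rho> \<le> (1 + L * h) * r"
    and a: "a = 8 * L * R / s2"
    and \<epsilon>: "\<epsilon> = exp (- (a * R)) * a * L * R / (3 * L * R\<^sup>2 + s2)"
    and small: "L * h \<le> 1" "a * L * R * h \<le> 1 / 4"
  shows "1 - exp (- (a * \<rho>)) + \<epsilon> * \<rho>\<^sup>2 - (exp (- (a * \<rho>)) * a\<^sup>2 / 2 - \<epsilon>) * (h * s2)
    \<le> cost_fun a \<epsilon> r - h * (exp (- (a * R)) * a * L * R)"
proof -
  define u where "u = a * L * R * h"
  have a0: "a > 0" using pos a by simp
  have den: "3 * L * R\<^sup>2 + s2 > 0"
    using pos by (intro add_pos_pos) auto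
  have \<epsilon>0: "\<epsilon> > 0" using pos a0 den \<epsilon> by simp
  have u: "0 \<le> u" "u \<le> 1 / 4" using pos a0 small by (auto simp: u_def)
  have v: "a\<^sup>2 / 2 * (h * s2) = 4 * u"
    using pos by (simp add: a u_def power2_eq_square)
  have "\<epsilon> * (3 * L * R\<^sup>2 + s2) = exp (- (a * R)) * a * L * R"
    unfolding \<epsilon> using den by simp
  then have \<epsilon>eq: "h * (\<epsilon> * (3 * L * R\<^sup>2 + s2)) = exp (- (a * R)) * u"
    by (simp add: u_def)
  have "a * \<rho> \<le> a * ((1 + L * h) * r)"
    using a0 r by (intro mult_left_mono) auto
  also have "\<dots> = a * r + a * L * h * r" by (simp add: algebra_simps)
  also have "\<dots> \<le> a * r + a * L * h * R"
    using a0 pos r by (intro add_left_mono mult_left_mono) auto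
  finally have "a * \<rho> \<le> a * r + u" by (simp add: u_def mult_ac)
  then have "exp (- (a * r)) * exp (- u) \<le> exp (- (a * \<rho>))"
    by (simp flip: exp_add)
  moreover have "exp (- (a * r)) * (1 - u) \<le> exp (- (a * r)) * exp (- u)"
    using exp_ge_add_one_self[of "- u"] by (intro mult_left_mono) auto
  ultimately have "exp (- (a * r)) * (1 - u) \<le> exp (- (a * \<rho>))" by linarith
  then have "exp (- (a * r)) * (1 - u) * (1 + 4 * u) \<le> exp (- (a * \<rho>)) * (1 + 4 * u)"
    using u by (intro mult_right_mono) auto
  \<comment> \<open>Here u \<le> 1/4 is used: the product is 1 + 3 u - 4 u^2.\<close>
  moreover have "1 + 2 * u \<le> (1 - u) * (1 + 4 * u)"
    using mult_left_mono[OF u(2), of u] u(1) by (simp add: algebra_simps)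
  then have "exp (- (a * r)) * (1 + 2 * u) \<le> exp (- (a * r)) * ((1 - u) * (1 + 4 * u))"
    by (intro mult_left_mono) auto
  moreover have "exp (- (a * R)) * (2 * u) \<le> exp (- (a * r)) * (2 * u)"
    using u a0 r by (intro mult_right_mono) auto
  ultimately have E: "exp (- (a * r)) + exp (- (a * R)) * (2 * u) \<le> exp (- (a * \<rho>)) * (1 + 4 * u)"
    by (simp add: algebra_simps)
  have "\<rho>\<^sup>2 \<le> ((1 + L * h) * r)\<^sup>2"
    using r by (intro power_mono) auto
  also have "\<dots> = r\<^sup>2 + (2 + L * h) * (L * h) * r\<^sup>2"
    by (simp add: power2_eq_square algebra_simps)
  also have "\<dots> \<le> r\<^sup>2 + 3 * (L * h) * R\<^sup>2"
    using pos small r by (intro add_left_mono mult_mono power_mono) auto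
  finally have "\<epsilon> * \<rho>\<^sup>2 \<le> \<epsilon> * (r\<^sup>2 + 3 * (L * h) * R\<^sup>2)"
    using \<epsilon>0 by (intro mult_left_mono) auto
  then have "\<epsilon> * \<rho>\<^sup>2 + \<epsilon> * (h * s2) \<le> \<epsilon> * r\<^sup>2 + exp (- (a * R)) * u"
    unfolding \<epsilon>eq[symmetric] by (simp add: algebra_simps)
  moreover have "(exp (- (a * \<rho>)) * a\<^sup>2 / 2 - \<epsilon>) * (h * s2) = exp (- (a * \<rho>)) * (1 + 4 * u) - exp (- (a * \<rho>)) - \<epsilon> * (h * s2)"
    unfolding v[symmetric] by (simp add: algebra_simps)
  moreover have "h * (exp (- (a * R)) * a * L * R) = exp (- (a * R)) * u"
    "exp (- (a * R)) * (2 * u) = exp (- (a * R)) * u + exp (- (a * R)) * u"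
    by (simp_all add: u_def)
  ultimately show ?thesis
    using E unfolding cost_fun_def by linarith
qed

section \<open>The coupled step and its three ranges of distance\<close>

context dissipative_sde
begin

text \<open>The axis is the difference after the Euler drift, not x - y, so the step stays on a line
  and its new length is explicit.\<close>

definition coupled_noise :: "real \<Rightarrow> real ^ 'n \<Rightarrow> real ^ 'n \<Rightarrow> real ^ 'n \<Rightarrow> real ^ 'n" where
  "coupled_noise h x y w =
     (if 4 * sqrt h < norm (x - y) \<and> norm (x - y) \<le> R
      then trunc_reflect (sqrt h) (drift_diff h x y /\<^sub>R norm (drift_diff h x y)) w else w)"

lemma drift_diff_measurable [measurable]:
  "case_prod (drift_diff h) \<in> borel \<Otimes>\<^sub>M borel \<rightarrow>\<^sub>M borel"
  unfolding drift_diff_def[abs_def] split_def by measurable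

lemma coupled_noise_measurable [measurable]:
  "(\<lambda>(x, y, w). coupled_noise h x y w) \<in> borel \<Otimes>\<^sub>M borel \<Otimes>\<^sub>M borel \<rightarrow>\<^sub>M borel"
  unfolding coupled_noise_def[abs_def] split_def by measurable

text \<open>With \<open>L * h \<le> 1 / 2\<close> the drift at most halves the distance. This fixes
  the threshold \<open>4 * sqrt h\<close>, as the truncated reflection moves the chain by at most
  \<open>2 * sqrt h\<close>.\<close>

lemma drift_diff_near:
  assumes h: "0 < h" "L * h \<le> 1 / 2" and r: "4 * sqrt h < norm (x - y)"
  shows "norm (drift_diff h x y) > 2 * sqrt h" "drift_diff h x y \<noteq> 0"
proof -
  have "1 / 2 * norm (x - y) \<le> (1 - L * h) * norm (x - y)"
    using h by (intro mult_right_mono) auto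
  also have "\<dots> \<le> norm (drift_diff h x y)"
    using h by (intro norm_drift_diff_ge) auto
  finally show *: "norm (drift_diff h x y) > 2 * sqrt h" using r by simp
  then show "drift_diff h x y \<noteq> 0" using h by (auto simp: not_less)
qed

lemma distr_coupled_noise:
  assumes h: "0 < h" "L * h \<le> 1 / 2"
  shows "distr (gaussian (sqrt h)) borel (coupled_noise h x y) = gaussian (sqrt h)"
proof (cases "4 * sqrt h < norm (x - y) \<and> norm (x - y) \<le> R")
  case True
  then have "coupled_noise h x y = trunc_reflect (sqrt h) (drift_diff h x y /\<^sub>R norm (drift_diff h x y))"
    by (auto simp: coupled_noise_def)
  moreover have "drift_diff h x y \<noteq> 0"
    using drift_diff_near[OF h, of x y] True by auto
  ultimately show ?thesis
    using h by (simp add: distr_gaussian_trunc_reflect)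
next
  case False
  then have "coupled_noise h x y = (\<lambda>w. w)"
    by (auto simp: coupled_noise_def)
  then show ?thesis
    by (simp add: distr_id2)
qed

text \<open>The point is the missing absolute value: the displacement is smaller than \<rho>, so the
  difference never changes direction and the new distance is affine in it.\<close>

lemma coupled_step_near:
  assumes h: "0 < h" "L * h \<le> 1 / 2" and r: "4 * sqrt h < norm (x - y)" "norm (x - y) \<le> R"
  defines "\<rho> \<equiv> norm (drift_diff h x y)"
  defines "s \<equiv> trunc_coord (sqrt h) (drift_diff h x y /\<^sub>R norm (drift_diff h x y))"
  shows "norm (drift_diff h x y + (coupled_noise h x y w - w)) = \<rho> - s w"
proof -
  define e where "e = drift_diff h x y /\<^sub>R \<rho>"
  have z: "\<rho> > 2 * sqrt h" "\<rho> > 0"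
    using drift_diff_near[OF h r(1)] by (auto simp: \<rho>_def)
  have "drift_diff h x y = \<rho> *\<^sub>R e"
    using z by (simp add: e_def)
  moreover have "coupled_noise h x y w - w = - (s w *\<^sub>R e)"
    using r by (simp add: coupled_noise_def trunc_reflect_def s_def e_def \<rho>_def)
  ultimately have "drift_diff h x y + (coupled_noise h x y w - w) = (\<rho> - s w) *\<^sub>R e"
    by (simp add: scaleR_diff_left)
  moreover have "norm e = 1" using z by (simp add: e_def \<rho>_def)
  moreover have "\<bar>s w\<bar> \<le> 2 * sqrt h"
    unfolding s_def using h by (intro abs_trunc_coord_le) auto
  ultimately show ?thesis using z by simp
qed

lemma coupled_step_sync:
  assumes "\<not> (4 * sqrt h < norm (x - y) \<and> norm (x - y) \<le> R)"
  shows "drift_diff h x y + (coupled_noise h x y w - w) = drift_diff h x y"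
  using assms by (auto simp: coupled_noise_def)

text \<open>A crude bound, meant for the slope of the cost at which the Euler error of the diffusion
  is charged.\<close>

lemma norm_coupled_step_le:
  assumes h: "0 < h" "L * h \<le> 1 / 2"
  shows "norm (drift_diff h x y + (coupled_noise h x y w - w)) \<le> 2 * norm (x - y) + 2 * sqrt h"
proof -
  have "norm (drift_diff h x y) \<le> (1 + L * h) * norm (x - y)"
    using h by (intro norm_drift_diff_le) auto
  also have "\<dots> \<le> 2 * norm (x - y)"
    using h by (intro mult_right_mono) auto
  finally have 1: "norm (drift_diff h x y) \<le> 2 * norm (x - y)" .
  show ?thesis
  proof (cases "4 * sqrt h < norm (x - y) \<and> norm (x - y) \<le> R")
    case True
    have "\<bar>trunc_coord (sqrt h) (drift_diff h x y /\<^sub>R norm (drift_diff h x y)) w\<bar> \<le> 2 * sqrt h"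
      using h by (intro abs_trunc_coord_le) auto
    then show ?thesis
      using coupled_step_near[OF h, of x y w] True 1 by simp
  next
    case False
    have "0 \<le> sqrt h" using h by simp
    then show ?thesis unfolding coupled_step_sync[OF False] using 1 by linarith
  qed
qed

text \<open>The gains, \<open>exp (- (a * R)) * a * L * R\<close> per unit time in the reflection
  range and \<open>K * (\<epsilon> * r\<^sup>2)\<close> beyond R, are turned into fractions of the
  cost. Up to R the cost is at most \<open>1 + \<epsilon> * R\<^sup>2\<close>; beyond R the fraction
  increases with r, so r = R is the worst case. The rate \<kappa> is the smaller of the two.\<close>

lemma coupled_step_contraction:
  assumes s2: "s2 > 0" "\<And>(e :: real ^ 'n) c. norm e = 1 \<Longrightarrow> c > 0 \<Longrightarrow> (\<integral>w. (trunc_coord c e w)\<^sup>2 \<partial>gaussian c) = c\<^sup>2 * s2"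
    and a: "a = 8 * L * R / s2"
    and \<epsilon>: "\<epsilon> = exp (- (a * R)) * a * L * R / (3 * L * R\<^sup>2 + s2)"
    and \<kappa>: "\<kappa> = min (exp (- (a * R)) * a * L * R) (K * (\<epsilon> * R\<^sup>2)) / (1 + \<epsilon> * R\<^sup>2)"
    and h: "0 < h" "L * h \<le> 1 / 2" "a * L * R * h \<le> 1 / 4" "L\<^sup>2 * h \<le> K" "K * h \<le> 1"
  shows "(\<integral>\<^sup>+w. ennreal (cost_fun a \<epsilon> (norm (drift_diff h x y + (coupled_noise h x y w - w)))) \<partial>gaussian (sqrt h))
    \<le> ennreal ((1 - \<kappa> * h) * cost_fun a \<epsilon> (norm (x - y)) + 4 * (a * L + 3 * \<epsilon> * L * R + \<kappa> * (a + \<epsilon> * R)) * (h * sqrt h))"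
    (is "?I \<le> ennreal (?A + ?B)")
proof -
  interpret G: prob_space "gaussian (sqrt h) :: (real ^ 'n) measure"
    using h by (intro prob_space_gaussian) auto
  define r where "r = norm (x - y)"
  define \<rho> where "\<rho> = norm (drift_diff h x y)"
  define c1 where "c1 = exp (- (a * R)) * a * L * R"
  have a0: "a > 0" using a s2 L KR by simp
  have "3 * L * R\<^sup>2 + s2 > 0"
    using L KR(2) s2 by (intro add_pos_pos) auto
  then have \<epsilon>0: "\<epsilon> > 0" using \<epsilon> a0 L KR by simp
  have den: "1 + \<epsilon> * R\<^sup>2 > 0" using \<epsilon>0 by (intro add_pos_nonneg) auto
  have c1: "c1 > 0" using a0 L KR by (simp add: c1_def)
  have \<kappa>0: "\<kappa> > 0" using \<epsilon>0 c1 KR(1,2) den by (simp add: \<kappa> c1_def)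
  have \<kappa>1: "\<kappa> * (1 + \<epsilon> * R\<^sup>2) \<le> c1" "\<kappa> * (1 + \<epsilon> * R\<^sup>2) \<le> K * (\<epsilon> * R\<^sup>2)"
    using den by (simp_all add: \<kappa> c1_def)
  have r0: "r \<ge> 0" "\<rho> \<ge> 0" by (simp_all add: r_def \<rho>_def)
  have \<rho>r: "\<rho> \<le> (1 + L * h) * r"
    unfolding \<rho>_def r_def using h by (intro norm_drift_diff_le) auto
  have B: "?B \<ge> 0" using a0 \<epsilon>0 L KR(1,2) \<kappa>0 h by simp
  have sync: "?I \<le> ennreal (?A + ?B)"
    if s: "\<not> (4 * sqrt h < norm (x - y) \<and> norm (x - y) \<le> R)" and le: "cost_fun a \<epsilon> \<rho> \<le> ?A + ?B"
    using le by (simp add: coupled_step_sync[OF s] G.emeasure_space_1[simplified] flip: \<rho>_def) (simp add: ennreal_leI)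
  consider "4 * sqrt h < r" "r \<le> R" | "r \<le> 4 * sqrt h" "r \<le> R" | "r > R" by linarith
  then show ?thesis
  proof cases
    case 1
    define s where "s = trunc_coord (sqrt h) (drift_diff h x y /\<^sub>R norm (drift_diff h x y))"
    have [measurable]: "s \<in> borel_measurable borel"
      unfolding s_def by measurable
    have z: "drift_diff h x y \<noteq> 0" "\<rho> > 2 * sqrt h"
      using drift_diff_near[OF h(1,2), of x y] 1 by (auto simp: r_def \<rho>_def)
    have sb: "\<bar>s w\<bar> \<le> 2 * sqrt h" for w
      unfolding s_def using h by (intro abs_trunc_coord_le) auto
    have eq: "norm (drift_diff h x y + (coupled_noise h x y w - w)) = \<rho> - s w" for w
      unfolding \<rho>_def s_def using 1 by (intro coupled_step_near h) (auto simp: r_def)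
    have rng: "0 \<le> cost_fun a \<epsilon> (\<rho> - s w)" "cost_fun a \<epsilon> (\<rho> - s w) \<le> cost_fun a \<epsilon> (\<rho> + 2 * sqrt h)"
      "0 \<le> cost_fun a \<epsilon> (\<rho> + s w)" "cost_fun a \<epsilon> (\<rho> + s w) \<le> cost_fun a \<epsilon> (\<rho> + 2 * sqrt h)" for w
      using sb[of w] z by (auto intro!: cost_fun_nonneg[OF a0 \<epsilon>0] cost_fun_mono[OF a0 \<epsilon>0])
    let ?G = "gaussian (sqrt h) :: (real ^ 'n) measure"
    have i1: "integrable ?G (\<lambda>w. cost_fun a \<epsilon> (\<rho> - s w))"
      using rng by (intro G.integrable_const_bound[where B="cost_fun a \<epsilon> (\<rho> + 2 * sqrt h)"]) auto
    have i2: "integrable ?G (\<lambda>w. cost_fun a \<epsilon> (\<rho> + s w))"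
      using rng by (intro G.integrable_const_bound[where B="cost_fun a \<epsilon> (\<rho> + 2 * sqrt h)"]) auto
    have i3: "integrable ?G (\<lambda>w. (s w)\<^sup>2)"
      unfolding s_def using h by (intro integrable_trunc_coord_sq) auto
    have i4: "(\<integral>w. (s w)\<^sup>2 \<partial>?G) = h * s2"
      unfolding s_def using h z by (subst s2) auto
    define P where "P = 1 - exp (- (a * \<rho>)) + \<epsilon> * \<rho>\<^sup>2"
    define Q where "Q = exp (- (a * \<rho>)) * a\<^sup>2 / 2 - \<epsilon>"
    \<comment> \<open>The map w to -w preserves the Gaussian and reverses the increment.\<close>
    have sym: "(\<integral>w. cost_fun a \<epsilon> (\<rho> - s w) \<partial>?G) = (\<integral>w. cost_fun a \<epsilon> (\<rho> + s w) \<partial>?G)"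
    proof -
      have "(\<integral>w. cost_fun a \<epsilon> (\<rho> - s w) \<partial>?G) = (\<integral>w. cost_fun a \<epsilon> (\<rho> - s w) \<partial>distr ?G borel uminus)"
        using h by (simp add: distr_gaussian_uminus)
      also have "\<dots> = (\<integral>w. cost_fun a \<epsilon> (\<rho> - s (- w)) \<partial>?G)"
        by (subst integral_distr) auto
      finally show ?thesis by (simp add: s_def trunc_coord_uminus)
    qed
    have "2 * (\<integral>w. cost_fun a \<epsilon> (\<rho> - s w) \<partial>?G) = (\<integral>w. cost_fun a \<epsilon> (\<rho> - s w) + cost_fun a \<epsilon> (\<rho> + s w) \<partial>?G)"
      using i1 i2 sym by simp
    also have "\<dots> \<le> (\<integral>w. 2 * (P - Q * (s w)\<^sup>2) \<partial>?G)"
      using i1 i2 i3 \<epsilon>0 cost_fun_symmetric_le[of \<epsilon> a \<rho>]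
      by (intro integral_mono) (auto simp: P_def Q_def)
    also have "\<dots> = 2 * (P - Q * (h * s2))"
      using i3 i4 G.prob_space by simp
    finally have I: "(\<integral>w. cost_fun a \<epsilon> (\<rho> - s w) \<partial>?G) \<le> P - Q * (h * s2)" by simp
    have PQ: "P - Q * (h * s2) \<le> cost_fun a \<epsilon> r - h * c1"
      unfolding P_def Q_def c1_def
      using L KR s2 h r0 1 \<rho>r a \<epsilon> by (intro reflection_gain_arith) auto
    have "h * (\<kappa> * cost_fun a \<epsilon> r) \<le> h * c1"
    proof (intro mult_left_mono)
      have "cost_fun a \<epsilon> r \<le> 1 + \<epsilon> * R\<^sup>2"
        using cost_fun_le[OF a0 \<epsilon>0, of r] 1 r0 \<epsilon>0 power_mono[of r R 2]
        by (smt (verit) mult_left_mono)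
      then have "\<kappa> * cost_fun a \<epsilon> r \<le> \<kappa> * (1 + \<epsilon> * R\<^sup>2)"
        using \<kappa>0 by (intro mult_left_mono) auto
      then show "\<kappa> * cost_fun a \<epsilon> r \<le> c1" using \<kappa>1(1) by linarith
    qed (use h in simp)
    with I PQ have "(\<integral>w. cost_fun a \<epsilon> (\<rho> - s w) \<partial>?G) \<le> (1 - \<kappa> * h) * cost_fun a \<epsilon> r"
      by (simp add: algebra_simps)
    then have "(\<integral>w. cost_fun a \<epsilon> (\<rho> - s w) \<partial>?G) \<le> ?A + ?B"
      using B by (simp add: r_def)
    moreover have "?I = ennreal (\<integral>w. cost_fun a \<epsilon> (\<rho> - s w) \<partial>?G)"
      unfolding eq using i1 rng by (intro nn_integral_eq_integral) auto
    ultimately show ?thesis by (simp add: ennreal_leI)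
  next
    case 2
    have "cost_fun a \<epsilon> \<rho> \<le> cost_fun a \<epsilon> (r + L * h * r)"
      using \<rho>r r0 by (intro cost_fun_mono[OF a0 \<epsilon>0]) (auto simp: algebra_simps)
    also have "\<dots> \<le> cost_fun a \<epsilon> r + (a + 2 * \<epsilon> * r) * (L * h * r) + \<epsilon> * (L * h * r)\<^sup>2"
      using r0 L h by (intro cost_fun_add_le[OF a0 \<epsilon>0]) auto
    also have "\<dots> = cost_fun a \<epsilon> r + (a * L + 2 * \<epsilon> * L * r + \<epsilon> * L * (L * h) * r) * (h * r)"
      by (simp add: power2_eq_square algebra_simps)
    also have "\<dots> \<le> cost_fun a \<epsilon> r + (a * L + 2 * \<epsilon> * L * R + \<epsilon> * L * 1 * R) * (h * (4 * sqrt h))"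
      using r0 2 L h a0 \<epsilon>0 by (intro add_left_mono mult_mono add_mono mult_nonneg_nonneg) (auto intro!: add_nonneg_nonneg mult_nonneg_nonneg)
    finally have 1: "cost_fun a \<epsilon> \<rho> \<le> cost_fun a \<epsilon> r + 4 * (a * L + 3 * \<epsilon> * L * R) * (h * sqrt h)"
      by (simp add: algebra_simps)
    \<comment> \<open>Nothing is gained at such small distances. The decrease
      \<open>\<kappa> * h * cost_fun a \<epsilon> r\<close> claimed by the bound is itself of order
      h^(3/2) and is booked in the remainder.\<close>
    have "cost_fun a \<epsilon> r \<le> a * r + \<epsilon> * R * r"
      unfolding cost_fun_def power2_eq_square using exp_ge_add_one_self[of "- (a * r)"] \<epsilon>0 2 r0
      by (intro add_mono) (auto simp: mult.assoc intro!: mult_left_mono mult_right_mono)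
    also have "\<dots> \<le> (a + \<epsilon> * R) * (4 * sqrt h)"
      unfolding distrib_right[symmetric] using a0 \<epsilon>0 KR(2) 2 by (intro mult_left_mono) auto
    finally have "\<kappa> * h * cost_fun a \<epsilon> r \<le> \<kappa> * h * ((a + \<epsilon> * R) * (4 * sqrt h))"
      using \<kappa>0 h by (intro mult_left_mono) auto
    with 1 have "cost_fun a \<epsilon> \<rho> \<le> ?A + ?B"
      by (simp add: algebra_simps flip: r_def)
    then show ?thesis
      using 2 by (intro sync) (auto simp: r_def)
  next
    case 3
    have far: "\<rho>\<^sup>2 \<le> (1 - K * h) * r\<^sup>2"
      unfolding \<rho>_def r_def using h 3 by (intro norm_drift_diff_far) (auto simp: r_def)
    also have "\<dots> \<le> 1 * r\<^sup>2"
      using KR(1) h by (intro mult_right_mono) auto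
    finally have "\<rho>\<^sup>2 \<le> r\<^sup>2" by simp
    then have "\<rho> \<le> r"
      by (rule power2_le_imp_le) (rule r0)
    then have "exp (- (a * r)) \<le> exp (- (a * \<rho>))" using a0 by simp
    moreover have "\<epsilon> * \<rho>\<^sup>2 \<le> \<epsilon> * ((1 - K * h) * r\<^sup>2)"
      using far \<epsilon>0 by (intro mult_left_mono) auto
    then have "\<epsilon> * \<rho>\<^sup>2 \<le> \<epsilon> * r\<^sup>2 - h * (K * (\<epsilon> * r\<^sup>2))"
      by (simp add: algebra_simps)
    ultimately have 1: "cost_fun a \<epsilon> \<rho> \<le> cost_fun a \<epsilon> r - h * (K * (\<epsilon> * r\<^sup>2))"
      unfolding cost_fun_def by linarith
    have rr: "R\<^sup>2 \<le> r\<^sup>2" using 3 KR(2) by (intro power_mono) auto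
    have "\<kappa> \<le> K"
    proof -
      have "\<kappa> * (1 + \<epsilon> * R\<^sup>2) \<le> K * (1 + \<epsilon> * R\<^sup>2)"
        using \<kappa>1(2) KR(1) by (simp add: algebra_simps)
      then show ?thesis using den by simp
    qed
    \<comment> \<open>The condition on \<kappa> holds at R; as \<kappa> \<le> K, it carries over to
      every larger r.\<close>
    then have "(K - \<kappa>) * (\<epsilon> * R\<^sup>2) \<le> (K - \<kappa>) * (\<epsilon> * r\<^sup>2)"
      using rr \<epsilon>0 by (intro mult_left_mono) auto
    then have "\<kappa> * (1 + \<epsilon> * r\<^sup>2) \<le> K * (\<epsilon> * r\<^sup>2)"
      using \<kappa>1(2) by (simp add: algebra_simps)
    moreover have "\<kappa> * cost_fun a \<epsilon> r \<le> \<kappa> * (1 + \<epsilon> * r\<^sup>2)"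
      using \<kappa>0 cost_fun_le[OF a0 \<epsilon>0] by (intro mult_left_mono) auto
    ultimately have "h * (\<kappa> * cost_fun a \<epsilon> r) \<le> h * (K * (\<epsilon> * r\<^sup>2))"
      using h by (intro mult_left_mono) auto
    with 1 have "cost_fun a \<epsilon> \<rho> \<le> ?A + ?B"
      using B by (simp add: algebra_simps flip: r_def)
    then show ?thesis
      using 3 by (intro sync) (auto simp: r_def)
  qed
qed

end

section \<open>Transport costs\<close>

text \<open>For a > 0, multiplication by \<open>ennreal a\<close> is invertible, so a bound valid
  for each coupling passes to the infimum, even if the infimum is infinite.\<close>

lemma ennreal_le_affine_INF:
  fixes F :: "'i \<Rightarrow> ennreal"
  assumes a: "a > 0" and c: "c \<ge> 0" and le: "\<And>i. i \<in> I \<Longrightarrow> x \<le> ennreal a * F i + ennreal c"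
  shows "x \<le> ennreal a * (INF i\<in>I. F i) + ennreal c"
proof -
  have inv: "ennreal (1 / a) * (ennreal a * y) = y" "ennreal a * (ennreal (1 / a) * y) = y" for y
    using a by (simp_all add: mult.assoc[symmetric] ennreal_mult[symmetric])
  have "ennreal (1 / a) * (x - ennreal c) \<le> (INF i\<in>I. F i)"
  proof (rule INF_greatest)
    fix i assume "i \<in> I"
    then have "x - ennreal c \<le> ennreal a * F i"
      using le by (simp add: ennreal_minus_le_iff add.commute)
    then have "ennreal (1 / a) * (x - ennreal c) \<le> ennreal (1 / a) * (ennreal a * F i)"
      by (rule mult_left_mono) simp
    then show "ennreal (1 / a) * (x - ennreal c) \<le> F i"
      by (simp add: inv)
  qed
  then have "ennreal a * (ennreal (1 / a) * (x - ennreal c)) \<le> ennreal a * (INF i\<in>I. F i)"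
    by (rule mult_left_mono) simp
  then show ?thesis
    by (simp add: inv ennreal_minus_le_iff add.commute)
qed

lemma ennreal_powr_one: "ennreal_powr x 1 = x"
  by (cases x) (auto simp: ennreal_powr_def)

lemma ennreal_powr_mono: "x \<le> y \<Longrightarrow> p \<ge> 0 \<Longrightarrow> ennreal_powr x p \<le> ennreal_powr y p"
  by (auto simp: ennreal_powr_def top_unique less_top intro!: ennreal_leI powr_mono2 enn2real_mono)

text \<open>Subadditivity of the square root; it halves the exponents of the contraction factor and
  of h in the bound for W_2.\<close>

lemma ennreal_powr_half_affine_le:
  assumes "a \<ge> 0" "c \<ge> 0"
  shows "ennreal_powr (ennreal a * x + ennreal c) (1 / 2) \<le> ennreal (sqrt a) * ennreal_powr x (1 / 2) + ennreal (sqrt c)"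
proof (cases x)
  case (real t)
  then have "ennreal_powr (ennreal a * x + ennreal c) (1 / 2) = ennreal (sqrt (a * t + c))"
    using assms by (simp add: ennreal_mult[symmetric] ennreal_plus[symmetric] ennreal_powr_def powr_half_sqrt del: ennreal_plus)
  also have "\<dots> \<le> ennreal (sqrt (a * t) + sqrt c)"
    using assms real by (intro ennreal_leI sqrt_add_le_add_sqrt) auto
  also have "\<dots> = ennreal (sqrt a) * ennreal_powr x (1 / 2) + ennreal (sqrt c)"
    using assms real by (simp add: real_sqrt_mult ennreal_mult ennreal_powr_def powr_half_sqrt)
  finally show ?thesis .
next
  case top
  show ?thesis
  proof (cases "a = 0")
    case True
    then show ?thesis using assms top by (simp add: ennreal_powr_def powr_half_sqrt)
  next
    case False
    then have "ennreal (sqrt a) \<noteq> 0" using assms by (simp add: ennreal_eq_0_iff)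
    then show ?thesis using top by (simp add: ennreal_powr_def ennreal_mult_top)
  qed
qed

lemma couplingsD:
  assumes "\<gamma> \<in> couplings \<mu> \<nu>"
  shows "prob_space \<gamma>" "sets \<gamma> = sets (borel \<Otimes>\<^sub>M borel)" "distr \<gamma> borel fst = \<mu>" "distr \<gamma> borel snd = \<nu>"
  using assms by (auto simp: couplings_def)

lemma transport_cost_cmult_le:
  assumes C: "C > 0" and le: "\<And>r. r \<ge> 0 \<Longrightarrow> g r \<le> C * f r"
    and [measurable]: "f \<in> borel_measurable borel"
  shows "transport_cost g \<mu> \<nu> \<le> ennreal C * transport_cost f \<mu> \<nu>"
proof -
  have "transport_cost g \<mu> \<nu> \<le> ennreal C * transport_cost f \<mu> \<nu> + ennreal 0"
    unfolding transport_cost_def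
  proof (rule ennreal_le_affine_INF[OF C])
    fix \<gamma> :: "('a \<times> 'a) measure" assume \<gamma>: "\<gamma> \<in> couplings \<mu> \<nu>"
    note [measurable_cong] = couplingsD(2)[OF \<gamma>]
    have "(INF \<gamma>\<in>couplings \<mu> \<nu>. \<integral>\<^sup>+z. ennreal (g (norm (fst z - snd z))) \<partial>\<gamma>)
      \<le> (\<integral>\<^sup>+z. ennreal (g (norm (fst z - snd z))) \<partial>\<gamma>)"
      using \<gamma> by (rule INF_lower)
    also have "\<dots> \<le> (\<integral>\<^sup>+z. ennreal C * ennreal (f (norm (fst z - snd z))) \<partial>\<gamma>)"
      using C le by (intro nn_integral_mono) (simp add: ennreal_mult'[symmetric] ennreal_leI)
    also have "\<dots> = ennreal C * (\<integral>\<^sup>+z. ennreal (f (norm (fst z - snd z))) \<partial>\<gamma>)"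
      by (rule nn_integral_cmult) measurable
    finally show "(INF \<gamma>\<in>couplings \<mu> \<nu>. \<integral>\<^sup>+z. ennreal (g (norm (fst z - snd z))) \<partial>\<gamma>)
      \<le> ennreal C * (\<integral>\<^sup>+z. ennreal (f (norm (fst z - snd z))) \<partial>\<gamma>) + ennreal 0" by simp
  qed simp
  then show ?thesis by simp
qed

lemma pair_measure_in_couplings:
  fixes \<mu> \<nu> :: "'a::euclidean_space measure"
  assumes "prob_space \<mu>" "sets \<mu> = sets borel" "prob_space \<nu>" "sets \<nu> = sets borel"
  shows "\<mu> \<Otimes>\<^sub>M \<nu> \<in> couplings \<mu> \<nu>"
proof -
  interpret \<mu>: prob_space \<mu> by fact
  interpret \<nu>: prob_space \<nu> by fact
  interpret pair_prob_space \<mu> \<nu> ..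
  have "distr (\<mu> \<Otimes>\<^sub>M \<nu>) borel fst = distr (\<mu> \<Otimes>\<^sub>M \<nu>) \<mu> fst"
    by (rule distr_cong) (simp_all add: assms)
  moreover have "distr (\<mu> \<Otimes>\<^sub>M \<nu>) borel snd = distr (\<mu> \<Otimes>\<^sub>M \<nu>) \<nu> snd"
    by (rule distr_cong) (simp_all add: assms)
  moreover have "distr (\<mu> \<Otimes>\<^sub>M \<nu>) \<nu> snd = \<nu>"
  proof (rule measure_eqI)
    fix A assume "A \<in> sets (distr (\<mu> \<Otimes>\<^sub>M \<nu>) \<nu> snd)"
    then have A: "A \<in> sets \<nu>" by simp
    have "snd -` A \<inter> space (\<mu> \<Otimes>\<^sub>M \<nu>) = space \<mu> \<times> A"
      using sets.sets_into_space[OF A] by (auto simp: space_pair_measure)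
    then show "emeasure (distr (\<mu> \<Otimes>\<^sub>M \<nu>) \<nu> snd) A = emeasure \<nu> A"
      using A by (simp add: emeasure_distr \<nu>.emeasure_pair_measure_Times \<mu>.emeasure_space_1)
  qed simp
  moreover have "sets (\<mu> \<Otimes>\<^sub>M \<nu>) = sets (borel \<Otimes>\<^sub>M borel)"
    by (intro sets_pair_measure_cong assms)
  ultimately show ?thesis
    using prob_space_axioms \<nu>.distr_pair_fst[of \<mu>] by (simp add: couplings_def)
qed

text \<open>The cost grows at most quadratically, so the independent coupling already has finite
  cost.\<close>

lemma transport_cost_cost_fun_finite:
  fixes \<mu> \<nu> :: "'a::euclidean_space measure"
  assumes "prob_space \<mu>" and [measurable_cong]: "sets \<mu> = sets borel" and "prob_space \<nu>" and [measurable_cong]: "sets \<nu> = sets borel"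
    and a: "a > 0" and \<epsilon>: "\<epsilon> > 0"
    and fin: "(\<integral>\<^sup>+x. ennreal ((norm x)\<^sup>2) \<partial>\<mu>) < \<infinity>" "(\<integral>\<^sup>+x. ennreal ((norm x)\<^sup>2) \<partial>\<nu>) < \<infinity>"
  shows "transport_cost (cost_fun a \<epsilon>) \<mu> \<nu> < \<infinity>"
proof -
  interpret \<mu>: prob_space \<mu> by fact
  interpret \<nu>: prob_space \<nu> by fact
  have "transport_cost (cost_fun a \<epsilon>) \<mu> \<nu> \<le> (\<integral>\<^sup>+z. ennreal (cost_fun a \<epsilon> (norm (fst z - snd z))) \<partial>(\<mu> \<Otimes>\<^sub>M \<nu>))"
    unfolding transport_cost_def by (intro INF_lower pair_measure_in_couplings assms)
  also have "\<dots> = (\<integral>\<^sup>+x. \<integral>\<^sup>+y. ennreal (cost_fun a \<epsilon> (norm (x - y))) \<partial>\<nu> \<partial>\<mu>)"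
    by (subst \<nu>.nn_integral_fst[symmetric]) simp_all
  also have "\<dots> \<le> (\<integral>\<^sup>+x. \<integral>\<^sup>+y. ennreal 1 + (ennreal (2 * \<epsilon>) * ennreal ((norm x)\<^sup>2) + ennreal (2 * \<epsilon>) * ennreal ((norm y)\<^sup>2)) \<partial>\<nu> \<partial>\<mu>)"
  proof (intro nn_integral_mono)
    fix x y :: 'a
    have "(norm (x - y))\<^sup>2 \<le> (norm x + norm y)\<^sup>2"
      by (intro power_mono norm_triangle_ineq4) auto
    also have "\<dots> \<le> 2 * (norm x)\<^sup>2 + 2 * (norm y)\<^sup>2"
      using sum_squares_bound[of "norm x" "norm y"] by (simp add: power2_sum)
    finally have "\<epsilon> * (norm (x - y))\<^sup>2 \<le> \<epsilon> * (2 * (norm x)\<^sup>2 + 2 * (norm y)\<^sup>2)"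
      using \<epsilon> by (intro mult_left_mono) auto
    then have "cost_fun a \<epsilon> (norm (x - y)) \<le> 1 + (2 * \<epsilon> * (norm x)\<^sup>2 + 2 * \<epsilon> * (norm y)\<^sup>2)"
      using cost_fun_le[OF a \<epsilon>, of "norm (x - y)"] by (simp add: algebra_simps)
    then show "ennreal (cost_fun a \<epsilon> (norm (x - y)))
      \<le> ennreal 1 + (ennreal (2 * \<epsilon>) * ennreal ((norm x)\<^sup>2) + ennreal (2 * \<epsilon>) * ennreal ((norm y)\<^sup>2))"
      using \<epsilon> by (simp add: ennreal_mult[symmetric] ennreal_plus[symmetric] ennreal_leI del: ennreal_plus ennreal_1)
  qed
  also have "\<dots> = 1 + (ennreal (2 * \<epsilon>) * (\<integral>\<^sup>+x. ennreal ((norm x)\<^sup>2) \<partial>\<mu>) + ennreal (2 * \<epsilon>) * (\<integral>\<^sup>+x. ennreal ((norm x)\<^sup>2) \<partial>\<nu>))"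
    by (simp add: nn_integral_add nn_integral_cmult \<mu>.emeasure_space_1 \<nu>.emeasure_space_1)
  also have "\<dots> < \<infinity>"
    using fin by (simp add: ennreal_mult_less_top)
  finally show ?thesis .
qed

context dissipative_sde
begin

text \<open>The diffusion is the ideal step plus the Euler error e, which the cost charges linearly,
  with a slope growing in r. Young's inequality with weight q = h^(3/2) balances the two parts: q
  times the squared slope, and e^2 / q, whose mean is of order q because e^2 has mean of order q^2.
  The part of the squared slope that grows with r is paid by half of the contraction, so the
  resulting rate is \<open>\<kappa> / 2\<close>.\<close>

lemma coupled_step_cost:
  obtains a \<epsilon> \<kappa> C h0 where "a > 0" "\<epsilon> > 0" "\<kappa> > 0" "C > 0" "h0 > 0" "\<kappa> * h0 \<le> 1" "L * h0 \<le> 1 / 2"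
    "\<And>h x y. 0 < h \<Longrightarrow> h < h0 \<Longrightarrow>
       (\<integral>\<^sup>+\<omega>. ennreal (cost_fun a \<epsilon> (norm (x + h *\<^sub>R b x + coupled_noise h x y (W h \<omega>) - Y y h \<omega>))) \<partial>M)
       \<le> ennreal ((1 - \<kappa> * h) * cost_fun a \<epsilon> (norm (x - y)) + C * (h * sqrt h) * (1 + (norm y)\<^sup>2))"
proof -
  obtain s2 where s2: "s2 > 0"
    "\<And>(e :: real ^ 'n) c. norm e = 1 \<Longrightarrow> c > 0 \<Longrightarrow> (\<integral>w. (trunc_coord c e w)\<^sup>2 \<partial>gaussian c) = c\<^sup>2 * s2"
    using trunc_coord_second_moment by blast
  define a where "a = 8 * L * R / s2"
  define \<epsilon> where "\<epsilon> = exp (- (a * R)) * a * L * R / (3 * L * R\<^sup>2 + s2)"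
  define \<kappa> where "\<kappa> = min (exp (- (a * R)) * a * L * R) (K * (\<epsilon> * R\<^sup>2)) / (1 + \<epsilon> * R\<^sup>2)"
  define C1 where "C1 = 4 * (a * L + 3 * \<epsilon> * L * R + \<kappa> * (a + \<epsilon> * R))"
  define d where "d = real CARD('n)"
  \<comment> \<open>The summands stem from the ideal step, from the constant part of the squared
    slope, and from the second moment of the Euler error, whose dependence on y is dominated by
    \<open>1 + (norm y)\<^sup>2\<close>.\<close>
  define C where "C = C1 + (a + 4 * \<epsilon>)\<^sup>2 + (4 + 8 * \<epsilon>) * L\<^sup>2 * (2 * (norm (b 0))\<^sup>2 + 2 * L\<^sup>2 + d)"
  \<comment> \<open>The entry with 32 makes
    \<open>16 * \<epsilon> * sqrt h \<le> \<kappa> / 2\<close>, by which the slope term is absorbed;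
    the last entry keeps \<open>1 - \<kappa> * h\<close> nonnegative. The others bound q by 1 and
    supply the hypotheses of the ideal step.\<close>
  define h0 where "h0 = Min {1, 1 / (2 * L), 1 / (4 * a * L * R), K / L\<^sup>2, 1 / K, (\<kappa> / (32 * \<epsilon>))\<^sup>2, 1 / \<kappa>}"
  have a: "a > 0" using s2 L KR by (simp add: a_def)
  have "3 * L * R\<^sup>2 + s2 > 0"
    using L KR(2) s2 by (intro add_pos_pos) auto
  then have \<epsilon>: "\<epsilon> > 0" using a L KR by (simp add: \<epsilon>_def)
  then have den: "1 + \<epsilon> * R\<^sup>2 > 0" by (intro add_pos_nonneg) auto
  then have \<kappa>: "\<kappa> > 0" using \<epsilon> a L KR(1,2) by (simp add: \<kappa>_def)
  have C1: "C1 > 0"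
    using a \<epsilon> \<kappa> L(1) KR(2) unfolding C1_def by (intro mult_pos_pos add_pos_pos) auto
  have C: "C > 0"
    using C1 \<epsilon> by (auto simp: C_def d_def intro!: add_pos_nonneg add_nonneg_nonneg mult_nonneg_nonneg)
  have h0: "h0 > 0" "h0 \<le> 1" "h0 \<le> 1 / (2 * L)" "h0 \<le> 1 / (4 * a * L * R)" "h0 \<le> K / L\<^sup>2" "h0 \<le> 1 / K"
    "h0 \<le> (\<kappa> / (32 * \<epsilon>))\<^sup>2" "h0 \<le> 1 / \<kappa>"
  proof -
    show "h0 > 0"
      unfolding h0_def using a \<epsilon> \<kappa> L(1) KR(1,2) by (subst Min_gr_iff) auto
  qed (unfold h0_def, (rule Min_le, simp, simp)+)
  show thesis
  proof (rule that[of a \<epsilon> "\<kappa> / 2" C h0])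
    show "\<kappa> / 2 * h0 \<le> 1" "L * h0 \<le> 1 / 2"
      using h0 \<kappa> L by (auto simp: field_simps)
    fix h :: real and x y :: "real ^ 'n"
    assume h: "0 < h" "h < h0"
    have h': "h \<le> 1" "L * h \<le> 1 / 2" "a * L * R * h \<le> 1 / 4" "L\<^sup>2 * h \<le> K" "K * h \<le> 1"
    proof -
      have le: "h \<le> h0" using h by simp
      show "h \<le> 1" using h h0 by simp
      show "L * h \<le> 1 / 2" using order_trans[OF le h0(3)] L by (simp add: field_simps)
      show "a * L * R * h \<le> 1 / 4" using order_trans[OF le h0(4)] a L KR(2) by (simp add: field_simps)
      show "L\<^sup>2 * h \<le> K" using order_trans[OF le h0(5)] L by (simp add: field_simps)
      show "K * h \<le> 1" using order_trans[OF le h0(6)] KR(1) by (simp add: field_simps)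
    qed
    have "sqrt h \<le> sqrt ((\<kappa> / (32 * \<epsilon>))\<^sup>2)"
      using h h0 by (intro real_sqrt_le_mono) auto
    also have "\<dots> = \<kappa> / (32 * \<epsilon>)"
      unfolding real_sqrt_abs using \<epsilon> \<kappa> by (intro abs_of_pos divide_pos_pos) auto
    finally have sq: "16 * \<epsilon> * sqrt h \<le> \<kappa> / 2"
      using \<epsilon> by (simp add: pos_le_divide_eq mult_ac)
    define q where "q = h * sqrt h"
    have q: "q > 0" using h by (simp add: q_def)
    have q2: "q\<^sup>2 = h ^ 3"
      using h by (simp add: q_def power_mult_distrib eval_nat_numeral)
    have "sqrt h \<le> 1" using h' by simp
    then have q1: "q \<le> 1"
      using h h' by (auto simp: q_def intro: mult_le_one)
    define r where "r = norm (x - y)"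
    define f where "f = cost_fun a \<epsilon>"
    have [measurable]: "f \<in> borel_measurable borel" by (simp add: f_def)
    let ?e = "euler_error h y"
    have [measurable]: "?e \<in> borel_measurable M"
      using h by (intro euler_error_measurable) simp
    have [measurable]: "W h \<in> borel_measurable M"
      using h by simp
    define \<Delta> where "\<Delta> w = norm (drift_diff h x y + (coupled_noise h x y w - w))" for w
    have [measurable]: "\<Delta> \<in> borel_measurable borel"
      unfolding \<Delta>_def by measurable
    define A where "A = q * ((a + 4 * \<epsilon>)\<^sup>2 + 16 * \<epsilon>\<^sup>2 * r\<^sup>2)"
    define B where "B = (1 / 2 + \<epsilon>) / q"
    have AB: "A \<ge> 0" "B \<ge> 0" using q \<epsilon> by (auto simp: A_def B_def)
    have pt: "f (norm (x + h *\<^sub>R b x + coupled_noise h x y (W h \<omega>) - Y y h \<omega>)) \<le> f (\<Delta> (W h \<omega>)) + A + B * (?e \<omega>)\<^sup>2" for \<omega>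
    proof -
      let ?D = "\<Delta> (W h \<omega>)" and ?c = "a + 4 * \<epsilon> + 4 * \<epsilon> * r"
      have e0: "?e \<omega> \<ge> 0" by (simp add: euler_error_def)
      have D0: "?D \<ge> 0" by (simp add: \<Delta>_def)
      have "?D \<le> 2 * r + 2 * sqrt h"
        unfolding \<Delta>_def r_def using h h' by (intro norm_coupled_step_le) auto
      then have D: "?D \<le> 2 * r + 2" using \<open>sqrt h \<le> 1\<close> by linarith
      have "x + h *\<^sub>R b x + coupled_noise h x y (W h \<omega>) - Y y h \<omega>
        = (drift_diff h x y + (coupled_noise h x y (W h \<omega>) - W h \<omega>)) - (Y y h \<omega> - (y + h *\<^sub>R b y + W h \<omega>))"
        by (simp add: drift_diff_def algebra_simps)
      then have "norm (x + h *\<^sub>R b x + coupled_noise h x y (W h \<omega>) - Y y h \<omega>) \<le> ?D + ?e \<omega>"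
        unfolding \<Delta>_def euler_error_def by (metis norm_triangle_ineq4)
      then have "f (norm (x + h *\<^sub>R b x + coupled_noise h x y (W h \<omega>) - Y y h \<omega>)) \<le> f (?D + ?e \<omega>)"
        unfolding f_def by (intro cost_fun_mono[OF a \<epsilon>]) auto
      also have "\<dots> \<le> f ?D + (a + 2 * \<epsilon> * ?D) * ?e \<omega> + \<epsilon> * (?e \<omega>)\<^sup>2"
        unfolding f_def by (intro cost_fun_add_le[OF a \<epsilon>] D0 e0)
      finally have 1: "f (norm (x + h *\<^sub>R b x + coupled_noise h x y (W h \<omega>) - Y y h \<omega>)) \<le> \<dots>" .
      have 2: "(a + 2 * \<epsilon> * ?D) * ?e \<omega> \<le> ?c * ?e \<omega>"
        using mult_left_mono[OF D, of "2 * \<epsilon>"] \<epsilon> e0 by (intro mult_right_mono) (auto simp: algebra_simps)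
      have 3: "?c * ?e \<omega> \<le> q * ?c\<^sup>2 / 2 + (?e \<omega>)\<^sup>2 / (2 * q)"
      proof -
        have "q * ?c\<^sup>2 / 2 + (?e \<omega>)\<^sup>2 / (2 * q) - ?c * ?e \<omega> = (q * ?c - ?e \<omega>)\<^sup>2 / (2 * q)"
          using q by (simp add: field_simps power2_eq_square)
        moreover have "(q * ?c - ?e \<omega>)\<^sup>2 / (2 * q) \<ge> 0" using q by simp
        ultimately show ?thesis by linarith
      qed
      have 4: "q * ?c\<^sup>2 / 2 \<le> A"
      proof -
        have "?c\<^sup>2 \<le> 2 * ((a + 4 * \<epsilon>)\<^sup>2 + (4 * \<epsilon> * r)\<^sup>2)"
          using sum_squares_bound[of "a + 4 * \<epsilon>" "4 * \<epsilon> * r"] by (simp add: power2_sum[of "a + 4 * \<epsilon>" "4 * \<epsilon> * r"])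
        then have "q * ?c\<^sup>2 \<le> q * (2 * ((a + 4 * \<epsilon>)\<^sup>2 + (4 * \<epsilon> * r)\<^sup>2))"
          using q by (intro mult_left_mono) auto
        then show ?thesis by (simp add: A_def power_mult_distrib algebra_simps)
      qed
      \<comment> \<open>As q \<le> 1, the quadratic error term can be merged with the one from
        Young's inequality.\<close>
      have 5: "\<epsilon> * (?e \<omega>)\<^sup>2 \<le> \<epsilon> / q * (?e \<omega>)\<^sup>2"
        using q q1 \<epsilon> by (intro mult_right_mono) (auto simp: field_simps)
      have "B * (?e \<omega>)\<^sup>2 = (?e \<omega>)\<^sup>2 / (2 * q) + \<epsilon> / q * (?e \<omega>)\<^sup>2"
        using q by (simp add: B_def field_simps)
      then show ?thesis using 1 2 3 4 5 by linarith
    qed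
    have fnn: "f s \<ge> 0" if "s \<ge> 0" for s
      unfolding f_def using that by (rule cost_fun_nonneg[OF a \<epsilon>])
    have "(\<integral>\<^sup>+\<omega>. ennreal (f (norm (x + h *\<^sub>R b x + coupled_noise h x y (W h \<omega>) - Y y h \<omega>))) \<partial>M)
      \<le> (\<integral>\<^sup>+\<omega>. ennreal (f (\<Delta> (W h \<omega>))) + (ennreal A + ennreal B * ennreal ((?e \<omega>)\<^sup>2)) \<partial>M)"
      using pt AB by (intro nn_integral_mono)
        (simp add: ennreal_mult[symmetric] ennreal_plus[symmetric] ennreal_leI fnn \<Delta>_def add.assoc del: ennreal_plus)
    also have "\<dots> = (\<integral>\<^sup>+\<omega>. ennreal (f (\<Delta> (W h \<omega>))) \<partial>M) + (ennreal A + ennreal B * (\<integral>\<^sup>+\<omega>. ennreal ((?e \<omega>)\<^sup>2) \<partial>M))"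
      by (simp add: nn_integral_add nn_integral_cmult emeasure_space_1)
    finally have I: "(\<integral>\<^sup>+\<omega>. ennreal (f (norm (x + h *\<^sub>R b x + coupled_noise h x y (W h \<omega>) - Y y h \<omega>))) \<partial>M) \<le> \<dots>" .
    have "(\<integral>\<^sup>+\<omega>. ennreal (f (\<Delta> (W h \<omega>))) \<partial>M) = (\<integral>\<^sup>+w. ennreal (f (\<Delta> w)) \<partial>gaussian (sqrt h))"
      using h by (subst distr_W[symmetric]) (auto simp: nn_integral_distr)
    also have "\<dots> \<le> ennreal ((1 - \<kappa> * h) * f r + C1 * q)"
      using coupled_step_contraction[OF s2 a_def \<epsilon>_def \<kappa>_def h(1) h'(2-5), of x y]
      by (simp add: f_def \<Delta>_def r_def C1_def q_def)
    finally have I1: "(\<integral>\<^sup>+\<omega>. ennreal (f (\<Delta> (W h \<omega>))) \<partial>M) \<le> ennreal ((1 - \<kappa> * h) * f r + C1 * q)" .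
    have I2: "(\<integral>\<^sup>+\<omega>. ennreal ((?e \<omega>)\<^sup>2) \<partial>M) \<le> ennreal (8 * L\<^sup>2 * (h ^ 4 * (norm (b y))\<^sup>2 + h ^ 3 * d))"
      unfolding d_def using h h' by (intro euler_error_second_moment) auto
    note I
    also have "(\<integral>\<^sup>+\<omega>. ennreal (f (\<Delta> (W h \<omega>))) \<partial>M) + (ennreal A + ennreal B * (\<integral>\<^sup>+\<omega>. ennreal ((?e \<omega>)\<^sup>2) \<partial>M))
      \<le> ennreal ((1 - \<kappa> * h) * f r + C1 * q) + (ennreal A + ennreal B * ennreal (8 * L\<^sup>2 * (h ^ 4 * (norm (b y))\<^sup>2 + h ^ 3 * d)))"
      by (intro add_mono mult_left_mono I1 I2) auto
    also have "ennreal ((1 - \<kappa> * h) * f r + C1 * q) + (ennreal A + ennreal B * ennreal (8 * L\<^sup>2 * (h ^ 4 * (norm (b y))\<^sup>2 + h ^ 3 * d)))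
      = ennreal ((1 - \<kappa> * h) * f r + C1 * q + (A + B * (8 * L\<^sup>2 * (h ^ 4 * (norm (b y))\<^sup>2 + h ^ 3 * d))))"
    proof -
      have "\<kappa> * h \<le> 1"
        using order_trans[OF less_imp_le[OF h(2)] h0(8)] \<kappa> by (simp add: field_simps)
      then have "(1 - \<kappa> * h) * f r + C1 * q \<ge> 0"
        using C1 q fnn[of r] by (simp add: r_def)
      moreover have "8 * L\<^sup>2 * (h ^ 4 * (norm (b y))\<^sup>2 + h ^ 3 * d) \<ge> 0"
        using h by (simp add: d_def)
      ultimately show ?thesis
        using AB by (simp add: ennreal_mult[symmetric] ennreal_plus[symmetric] del: ennreal_plus)
    qed
    also have "\<dots> \<le> ennreal ((1 - \<kappa> / 2 * h) * f r + C * q * (1 + (norm y)\<^sup>2))"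
    proof (rule ennreal_leI)
      have "h ^ 4 * (norm (b y))\<^sup>2 \<le> h ^ 3 * (norm (b y))\<^sup>2"
        using h h' by (intro mult_right_mono power_decreasing) auto
      then have "h ^ 4 * (norm (b y))\<^sup>2 + h ^ 3 * d \<le> q\<^sup>2 * ((norm (b y))\<^sup>2 + d)"
        by (simp add: q2 algebra_simps)
      also have "\<dots> \<le> q\<^sup>2 * ((2 * (norm (b 0))\<^sup>2 + 2 * L\<^sup>2 * (norm y)\<^sup>2) + d)"
        using norm_b_sq_le[of y] by (intro mult_left_mono add_right_mono) auto
      also have "\<dots> \<le> q\<^sup>2 * ((2 * (norm (b 0))\<^sup>2 + 2 * L\<^sup>2 + d) * (1 + (norm y)\<^sup>2))"
        by (intro mult_left_mono) (auto simp: algebra_simps d_def)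
      finally have "B * (8 * L\<^sup>2 * (h ^ 4 * (norm (b y))\<^sup>2 + h ^ 3 * d))
         \<le> B * (8 * L\<^sup>2 * (q\<^sup>2 * ((2 * (norm (b 0))\<^sup>2 + 2 * L\<^sup>2 + d) * (1 + (norm y)\<^sup>2))))"
        using AB by (intro mult_left_mono) auto
      also have "\<dots> = q * ((4 + 8 * \<epsilon>) * L\<^sup>2 * (2 * (norm (b 0))\<^sup>2 + 2 * L\<^sup>2 + d)) * (1 + (norm y)\<^sup>2)"
        using q by (simp add: B_def power2_eq_square field_simps)
      finally have 1: "B * (8 * L\<^sup>2 * (h ^ 4 * (norm (b y))\<^sup>2 + h ^ 3 * d)) \<le> \<dots>" .
      \<comment> \<open>The growing part of the squared slope is itself controlled by the cost and
        carries the extra factor \<open>sqrt h\<close>.\<close>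
      have "16 * \<epsilon>\<^sup>2 * r\<^sup>2 = 16 * \<epsilon> * (\<epsilon> * r\<^sup>2)" by (simp add: power2_eq_square)
      also have "\<dots> \<le> 16 * \<epsilon> * f r"
        unfolding f_def using \<epsilon> by (intro mult_left_mono square_le_cost_fun[OF a \<epsilon>]) (auto simp: r_def)
      finally have "q * (16 * \<epsilon>\<^sup>2 * r\<^sup>2) \<le> q * (16 * \<epsilon> * f r)"
        using q by (intro mult_left_mono) auto
      also have "\<dots> = h * f r * (16 * \<epsilon> * sqrt h)" by (simp add: q_def)
      also have "\<dots> \<le> h * f r * (\<kappa> / 2)"
        using sq h fnn[of r] by (intro mult_left_mono) (auto simp: r_def)
      finally have 2: "q * (16 * \<epsilon>\<^sup>2 * r\<^sup>2) \<le> h * f r * (\<kappa> / 2)" .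
      have "q * (C1 + (a + 4 * \<epsilon>)\<^sup>2) * 1 \<le> q * (C1 + (a + 4 * \<epsilon>)\<^sup>2) * (1 + (norm y)\<^sup>2)"
        using q C1 by (intro mult_left_mono) auto
      then show "(1 - \<kappa> * h) * f r + C1 * q + (A + B * (8 * L\<^sup>2 * (h ^ 4 * (norm (b y))\<^sup>2 + h ^ 3 * d)))
        \<le> (1 - \<kappa> / 2 * h) * f r + C * q * (1 + (norm y)\<^sup>2)"
        using 1 2 unfolding A_def C_def by (simp add: algebra_simps)
    qed
    finally show "(\<integral>\<^sup>+\<omega>. ennreal (cost_fun a \<epsilon> (norm (x + h *\<^sub>R b x + coupled_noise h x y (W h \<omega>) - Y y h \<omega>))) \<partial>M)
       \<le> ennreal ((1 - \<kappa> / 2 * h) * cost_fun a \<epsilon> (norm (x - y)) + C * (h * sqrt h) * (1 + (norm y)\<^sup>2))"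
      by (simp only: f_def q_def r_def)
  qed (use a \<epsilon> \<kappa> C h0 in auto)
qed

end

section \<open>Couplings of the chain with the invariant measure\<close>

lemma emeasure_distr_nn_integral:
  assumes "f \<in> M \<rightarrow>\<^sub>M N" "A \<in> sets N"
  shows "emeasure (distr M N f) A = (\<integral>\<^sup>+x. indicator A (f x) \<partial>M)"
proof -
  have "emeasure (distr M N f) A = (\<integral>\<^sup>+y. indicator A y \<partial>distr M N f)"
    using assms by simp
  also have "\<dots> = (\<integral>\<^sup>+x. indicator A (f x) \<partial>M)"
    using assms by (subst nn_integral_distr) auto
  finally show ?thesis .
qed

context dissipative_sde
begin

definition euler_step :: "real \<Rightarrow> (real ^ 'n) measure \<Rightarrow> (real ^ 'n) measure" where
  "euler_step h \<mu> = distr (\<mu> \<Otimes>\<^sub>M gaussian (sqrt h)) borel (\<lambda>(x, w). x + h *\<^sub>R b x + w)"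

text \<open>On the product of \<gamma> and M the pair of positions is independent of the Brownian
  path by construction. For a fixed pair the coupled noise is still Gaussian, which gives the first
  marginal; the second follows from invariance. The measurable flow builds the coupling, but the
  cost may be stated with Y since the inner integral has a fixed starting point.\<close>

lemma coupling_step:
  assumes inv: "invariant_measure M Y \<pi>" and h: "0 < h" "L * h \<le> 1 / 2" and \<gamma>: "\<gamma> \<in> couplings \<mu> \<pi>"
  obtains \<gamma>' where "\<gamma>' \<in> couplings (euler_step h \<mu>) \<pi>"
    "\<And>f. f \<in> borel_measurable borel \<Longrightarrow>
      (\<integral>\<^sup>+z. ennreal (f (norm (fst z - snd z))) \<partial>\<gamma>') =
      (\<integral>\<^sup>+z. \<integral>\<^sup>+\<omega>. ennreal (f (norm (fst z + h *\<^sub>R b (fst z) + coupled_noise h (fst z) (snd z) (W h \<omega>) - Y (snd z) h \<omega>))) \<partial>M \<partial>\<gamma>)"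
proof -
  note \<gamma>D = couplingsD[OF \<gamma>]
  note \<gamma>D(2)[measurable_cong]
  interpret \<gamma>: prob_space \<gamma> by (rule \<gamma>D)
  interpret G: prob_space "gaussian (sqrt h) :: (real ^ 'n) measure"
    using h by (intro prob_space_gaussian) auto
  interpret \<gamma>M: pair_prob_space \<gamma> M ..
  obtain Z where Z: "case_prod Z \<in> borel \<Otimes>\<^sub>M M \<rightarrow>\<^sub>M borel" "\<And>x. AE \<omega> in M. Z x \<omega> = Y x h \<omega>"
    using jointly_measurable_flow[of h] h by auto
  note Z(1)[measurable]
  have [measurable]: "W h \<in> borel_measurable M" using h by simp
  define N where "N = (\<lambda>(z, \<omega>). fst z + h *\<^sub>R b (fst z) + coupled_noise h (fst z) (snd z) (W h \<omega>))"
  have cn[measurable]: "(\<lambda>p. coupled_noise h (fst (fst p)) (snd (fst p)) (W h (snd p))) \<in> \<gamma> \<Otimes>\<^sub>M M \<rightarrow>\<^sub>M borel"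
  proof -
    have "(\<lambda>p. (fst (fst p), snd (fst p), W h (snd p))) \<in> \<gamma> \<Otimes>\<^sub>M M \<rightarrow>\<^sub>M borel \<Otimes>\<^sub>M borel \<Otimes>\<^sub>M borel"
      by measurable
    from measurable_compose[OF this coupled_noise_measurable[of h]] show ?thesis by simp
  qed
  have [measurable]: "N \<in> \<gamma> \<Otimes>\<^sub>M M \<rightarrow>\<^sub>M borel"
    unfolding N_def split_def by measurable
  have [measurable]: "(\<lambda>p. Z (snd (fst p)) (snd p)) \<in> \<gamma> \<Otimes>\<^sub>M M \<rightarrow>\<^sub>M borel"
    by measurable
  define H where "H p = (N p, Z (snd (fst p)) (snd p))" for p
  have H[measurable]: "H \<in> \<gamma> \<Otimes>\<^sub>M M \<rightarrow>\<^sub>M borel \<Otimes>\<^sub>M borel"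
    unfolding H_def by measurable
  define \<gamma>' where "\<gamma>' = distr (\<gamma> \<Otimes>\<^sub>M M) (borel \<Otimes>\<^sub>M borel) H"
  have cw[measurable]: "coupled_noise h x y \<in> borel_measurable borel" for x y
  proof -
    have "(\<lambda>w. (x, y, w)) \<in> borel \<rightarrow>\<^sub>M borel \<Otimes>\<^sub>M borel \<Otimes>\<^sub>M borel" by measurable
    from measurable_compose[OF this coupled_noise_measurable[of h]] show ?thesis by simp
  qed
  have fst: "distr \<gamma>' borel fst = euler_step h \<mu>"
  proof (rule measure_eqI)
    fix A assume "A \<in> sets (distr \<gamma>' borel fst)"
    then have A[measurable]: "A \<in> sets borel" by simp
    have "emeasure (distr \<gamma>' borel fst) A = (\<integral>\<^sup>+p. indicator A (N p) \<partial>(\<gamma> \<Otimes>\<^sub>M M))"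
      by (simp add: \<gamma>'_def distr_distr comp_def H_def emeasure_distr_nn_integral)
    also have "\<dots> = (\<integral>\<^sup>+z. \<integral>\<^sup>+\<omega>. indicator A (N (z, \<omega>)) \<partial>M \<partial>\<gamma>)"
      by (subst nn_integral_fst[symmetric]) simp_all
    also have "\<dots> = (\<integral>\<^sup>+z. \<integral>\<^sup>+w. indicator A (fst z + h *\<^sub>R b (fst z) + w) \<partial>gaussian (sqrt h) \<partial>\<gamma>)"
    \<comment> \<open>With the pair frozen, \<open>coupled_noise\<close> preserves the law of
      \<open>W h\<close>; its dependence on both positions therefore leaves the law of the chain
      unchanged.\<close>
    proof (rule nn_integral_cong)
      fix z :: "(real ^ 'n) \<times> (real ^ 'n)"
      let ?u = "fst z + h *\<^sub>R b (fst z)" and ?T = "coupled_noise h (fst z) (snd z)"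
      have "(\<integral>\<^sup>+w. indicator A (?u + w) \<partial>gaussian (sqrt h)) = (\<integral>\<^sup>+w. indicator A (?u + w) \<partial>distr (gaussian (sqrt h)) borel ?T)"
        unfolding distr_coupled_noise[OF h] ..
      also have "\<dots> = (\<integral>\<^sup>+w. indicator A (?u + ?T w) \<partial>gaussian (sqrt h))"
        by (subst nn_integral_distr) auto
      also have "\<dots> = (\<integral>\<^sup>+w. indicator A (?u + ?T w) \<partial>distr M borel (W h))"
        using distr_W[OF h(1)] by simp
      also have "\<dots> = (\<integral>\<^sup>+\<omega>. indicator A (?u + ?T (W h \<omega>)) \<partial>M)"
        by (subst nn_integral_distr) auto
      finally show "(\<integral>\<^sup>+\<omega>. indicator A (N (z, \<omega>)) \<partial>M) = (\<integral>\<^sup>+w. indicator A (?u + w) \<partial>gaussian (sqrt h))"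
        by (simp add: N_def)
    qed
    also have "\<dots> = (\<integral>\<^sup>+x. \<integral>\<^sup>+w. indicator A (x + h *\<^sub>R b x + w) \<partial>gaussian (sqrt h) \<partial>distr \<gamma> borel fst)"
      by (subst nn_integral_distr) auto
    also have "\<dots> = (\<integral>\<^sup>+x. \<integral>\<^sup>+w. indicator A (x + h *\<^sub>R b x + w) \<partial>gaussian (sqrt h) \<partial>\<mu>)"
      unfolding \<gamma>D(3) ..
    also have "\<dots> = emeasure (euler_step h \<mu>) A"
    proof -
      have [measurable_cong]: "sets \<mu> = sets borel" using \<gamma>D(3) by auto
      have "emeasure (euler_step h \<mu>) A = (\<integral>\<^sup>+p. indicator A (fst p + h *\<^sub>R b (fst p) + snd p) \<partial>(\<mu> \<Otimes>\<^sub>M gaussian (sqrt h)))"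
        unfolding euler_step_def by (subst emeasure_distr_nn_integral) (simp_all add: split_def)
      also have "\<dots> = (\<integral>\<^sup>+x. \<integral>\<^sup>+w. indicator A (x + h *\<^sub>R b x + w) \<partial>gaussian (sqrt h) \<partial>\<mu>)"
        by (subst G.nn_integral_fst[symmetric]) simp_all
      finally show ?thesis ..
    qed
    finally show "emeasure (distr \<gamma>' borel fst) A = emeasure (euler_step h \<mu>) A" .
  qed (simp add: euler_step_def)
  have snd: "distr \<gamma>' borel snd = \<pi>"
  proof -
    have \<pi>: "distr (\<pi> \<Otimes>\<^sub>M M) borel (case_prod Z) = \<pi>"
      using h by (intro invariant_measure_flow[OF inv _ Z]) auto
    have [measurable_cong]: "sets \<pi> = sets borel" using \<gamma>D(4) by auto
    show ?thesis
    proof (rule measure_eqI)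
      fix A assume "A \<in> sets (distr \<gamma>' borel snd)"
      then have A[measurable]: "A \<in> sets borel" by simp
      have "emeasure (distr \<gamma>' borel snd) A = (\<integral>\<^sup>+p. indicator A (Z (snd (fst p)) (snd p)) \<partial>(\<gamma> \<Otimes>\<^sub>M M))"
        by (simp add: \<gamma>'_def distr_distr comp_def H_def emeasure_distr_nn_integral)
      also have "\<dots> = (\<integral>\<^sup>+z. \<integral>\<^sup>+\<omega>. indicator A (Z (snd z) \<omega>) \<partial>M \<partial>\<gamma>)"
        by (subst nn_integral_fst[symmetric]) simp_all
      also have "\<dots> = (\<integral>\<^sup>+y. \<integral>\<^sup>+\<omega>. indicator A (Z y \<omega>) \<partial>M \<partial>distr \<gamma> borel snd)"
        by (subst nn_integral_distr) auto
      also have "\<dots> = (\<integral>\<^sup>+y. \<integral>\<^sup>+\<omega>. indicator A (Z y \<omega>) \<partial>M \<partial>\<pi>)"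
        unfolding \<gamma>D(4) ..
      also have "\<dots> = (\<integral>\<^sup>+p. indicator A (Z (fst p) (snd p)) \<partial>(\<pi> \<Otimes>\<^sub>M M))"
        by (subst nn_integral_fst[symmetric]) simp_all
      also have "\<dots> = emeasure (distr (\<pi> \<Otimes>\<^sub>M M) borel (case_prod Z)) A"
        by (subst emeasure_distr_nn_integral) (simp_all add: split_def)
      finally show "emeasure (distr \<gamma>' borel snd) A = emeasure \<pi> A"
        by (simp add: \<pi>)
    qed (use \<gamma>D(4) in auto)
  qed
  have "\<gamma>' \<in> couplings (euler_step h \<mu>) \<pi>"
    unfolding couplings_def using fst snd H by (auto simp: \<gamma>'_def intro: \<gamma>M.prob_space_distr)
  moreover have "(\<integral>\<^sup>+z. ennreal (f (norm (fst z - snd z))) \<partial>\<gamma>') =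
      (\<integral>\<^sup>+z. \<integral>\<^sup>+\<omega>. ennreal (f (norm (fst z + h *\<^sub>R b (fst z) + coupled_noise h (fst z) (snd z) (W h \<omega>) - Y (snd z) h \<omega>))) \<partial>M \<partial>\<gamma>)"
    if [measurable]: "f \<in> borel_measurable borel" for f :: "real \<Rightarrow> real"
  proof -
    have "(\<integral>\<^sup>+z. ennreal (f (norm (fst z - snd z))) \<partial>\<gamma>') = (\<integral>\<^sup>+p. ennreal (f (norm (N p - Z (snd (fst p)) (snd p)))) \<partial>(\<gamma> \<Otimes>\<^sub>M M))"
      unfolding \<gamma>'_def by (subst nn_integral_distr) (simp_all add: H_def)
    also have "\<dots> = (\<integral>\<^sup>+z. \<integral>\<^sup>+\<omega>. ennreal (f (norm (N (z, \<omega>) - Z (snd z) \<omega>))) \<partial>M \<partial>\<gamma>)"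
      by (subst nn_integral_fst[symmetric]) simp_all
    also have "\<dots> = (\<integral>\<^sup>+z. \<integral>\<^sup>+\<omega>. ennreal (f (norm (N (z, \<omega>) - Y (snd z) h \<omega>))) \<partial>M \<partial>\<gamma>)"
    proof (rule nn_integral_cong)
      fix z :: "(real ^ 'n) \<times> (real ^ 'n)"
      show "(\<integral>\<^sup>+\<omega>. ennreal (f (norm (N (z, \<omega>) - Z (snd z) \<omega>))) \<partial>M) = (\<integral>\<^sup>+\<omega>. ennreal (f (norm (N (z, \<omega>) - Y (snd z) h \<omega>))) \<partial>M)"
        using Z(2)[of "snd z"] by (intro nn_integral_cong_AE) auto
    qed
    finally show ?thesis by (simp add: N_def)
  qed
  ultimately show thesis by (rule that)
qed

text \<open>The remainder involves the position only through the second moment m of the second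
  marginal, which is \<pi> for every coupling. The bound is thus uniform over couplings and survives
  the infimum.\<close>

lemma transport_cost_euler_step:
  assumes inv: "invariant_measure M Y \<pi>"
  obtains a \<epsilon> \<kappa> C h0 where "a > 0" "\<epsilon> > 0" "\<kappa> > 0" "C > 0" "h0 > 0" "\<kappa> * h0 \<le> 1"
    "\<And>h \<mu>. 0 < h \<Longrightarrow> h < h0 \<Longrightarrow>
      transport_cost (cost_fun a \<epsilon>) (euler_step h \<mu>) \<pi>
        \<le> ennreal (1 - \<kappa> * h) * transport_cost (cost_fun a \<epsilon>) \<mu> \<pi> + ennreal (C * (h * sqrt h))"
proof -
  obtain a \<epsilon> \<kappa> C h0 where *: "a > 0" "\<epsilon> > 0" "\<kappa> > 0" "C > 0" "h0 > 0" "\<kappa> * h0 \<le> 1" "L * h0 \<le> 1 / 2"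
    and step: "\<And>h x y. 0 < h \<Longrightarrow> h < h0 \<Longrightarrow>
       (\<integral>\<^sup>+\<omega>. ennreal (cost_fun a \<epsilon> (norm (x + h *\<^sub>R b x + coupled_noise h x y (W h \<omega>) - Y y h \<omega>))) \<partial>M)
       \<le> ennreal ((1 - \<kappa> * h) * cost_fun a \<epsilon> (norm (x - y)) + C * (h * sqrt h) * (1 + (norm y)\<^sup>2))"
    by (rule coupled_step_cost) (rule that; (assumption | simp only:))
  define m where "m = enn2real (\<integral>\<^sup>+x. ennreal ((norm x)\<^sup>2) \<partial>\<pi>)"
  have m: "(\<integral>\<^sup>+x. ennreal ((norm x)\<^sup>2) \<partial>\<pi>) = ennreal m" "m \<ge> 0"
    using invariant_measure_second_moment[OF inv] by (auto simp: m_def)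
  show thesis
  proof (rule that[of a \<epsilon> \<kappa> "C * (1 + m)" h0])
    show "C * (1 + m) > 0" using * m by simp
    fix h \<mu> assume h: "0 < h" "h < h0"
    have "\<kappa> * h < \<kappa> * h0" using h * by simp
    then have \<kappa>h: "1 - \<kappa> * h > 0" using * by linarith
    have "L * h \<le> L * h0" using h L by simp
    then have Lh: "L * h \<le> 1 / 2" using * by linarith
    define q where "q = C * (h * sqrt h)"
    have q: "q \<ge> 0" using * h by (simp add: q_def)
    have "transport_cost (cost_fun a \<epsilon>) (euler_step h \<mu>) \<pi>
        \<le> ennreal (1 - \<kappa> * h) * transport_cost (cost_fun a \<epsilon>) \<mu> \<pi> + ennreal (q * (1 + m))"
      unfolding transport_cost_def[of _ \<mu>]
    proof (rule ennreal_le_affine_INF[OF \<kappa>h])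
      show "q * (1 + m) \<ge> 0" using q m by simp
      fix \<gamma> assume \<gamma>: "\<gamma> \<in> couplings \<mu> \<pi>"
      note \<gamma>D = couplingsD[OF \<gamma>]
      note \<gamma>D(2)[measurable_cong]
      interpret \<gamma>: prob_space \<gamma> by (rule \<gamma>D)
      obtain \<gamma>' where \<gamma>': "\<gamma>' \<in> couplings (euler_step h \<mu>) \<pi>"
        "\<And>f. f \<in> borel_measurable borel \<Longrightarrow>
          (\<integral>\<^sup>+z. ennreal (f (norm (fst z - snd z))) \<partial>\<gamma>') =
          (\<integral>\<^sup>+z. \<integral>\<^sup>+\<omega>. ennreal (f (norm (fst z + h *\<^sub>R b (fst z) + coupled_noise h (fst z) (snd z) (W h \<omega>) - Y (snd z) h \<omega>))) \<partial>M \<partial>\<gamma>)"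
        using coupling_step[OF inv h(1) Lh \<gamma>] by blast
      have "transport_cost (cost_fun a \<epsilon>) (euler_step h \<mu>) \<pi> \<le> (\<integral>\<^sup>+z. ennreal (cost_fun a \<epsilon> (norm (fst z - snd z))) \<partial>\<gamma>')"
        unfolding transport_cost_def by (rule INF_lower) (rule \<gamma>')
      also have "\<dots> = (\<integral>\<^sup>+z. \<integral>\<^sup>+\<omega>. ennreal (cost_fun a \<epsilon> (norm (fst z + h *\<^sub>R b (fst z) + coupled_noise h (fst z) (snd z) (W h \<omega>) - Y (snd z) h \<omega>))) \<partial>M \<partial>\<gamma>)"
        by (rule \<gamma>'(2)) measurable
      also have "\<dots> \<le> (\<integral>\<^sup>+z. ennreal ((1 - \<kappa> * h) * cost_fun a \<epsilon> (norm (fst z - snd z)) + q * (1 + (norm (snd z))\<^sup>2)) \<partial>\<gamma>)"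
        unfolding q_def by (intro nn_integral_mono step h)
      also have "\<dots> = (\<integral>\<^sup>+z. ennreal (1 - \<kappa> * h) * ennreal (cost_fun a \<epsilon> (norm (fst z - snd z))) + (ennreal q + ennreal q * ennreal ((norm (snd z))\<^sup>2)) \<partial>\<gamma>)"
        using \<kappa>h q * cost_fun_nonneg[of a \<epsilon>]
        by (intro nn_integral_cong) (simp add: ennreal_mult[symmetric] ennreal_plus[symmetric] distrib_left del: ennreal_plus)
      also have "\<dots> = ennreal (1 - \<kappa> * h) * (\<integral>\<^sup>+z. ennreal (cost_fun a \<epsilon> (norm (fst z - snd z))) \<partial>\<gamma>)
          + (ennreal q + ennreal q * (\<integral>\<^sup>+z. ennreal ((norm (snd z))\<^sup>2) \<partial>\<gamma>))"
        by (simp add: nn_integral_add nn_integral_cmult \<gamma>.emeasure_space_1)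
      also have "(\<integral>\<^sup>+z. ennreal ((norm (snd z))\<^sup>2) \<partial>\<gamma>) = (\<integral>\<^sup>+y. ennreal ((norm y)\<^sup>2) \<partial>distr \<gamma> borel snd)"
        by (subst nn_integral_distr) auto
      also have "\<dots> = ennreal m"
        unfolding \<gamma>D(4) by (rule m)
      also have "ennreal q + ennreal q * ennreal m = ennreal (q * (1 + m))"
        using q m by (simp add: ennreal_mult[symmetric] ennreal_plus[symmetric] distrib_left del: ennreal_plus)
      finally show "transport_cost (cost_fun a \<epsilon>) (euler_step h \<mu>) \<pi>
        \<le> ennreal (1 - \<kappa> * h) * (\<integral>\<^sup>+z. ennreal (cost_fun a \<epsilon> (norm (fst z - snd z))) \<partial>\<gamma>) + ennreal (q * (1 + m))" .
    qed
    then show "transport_cost (cost_fun a \<epsilon>) (euler_step h \<mu>) \<pi>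
        \<le> ennreal (1 - \<kappa> * h) * transport_cost (cost_fun a \<epsilon>) \<mu> \<pi> + ennreal (C * (1 + m) * (h * sqrt h))"
      by (simp add: q_def mult_ac)
  qed (use * in auto)
qed

text \<open>The fresh noise must be independent of \<open>X k\<close>. This follows by exhibiting
  \<open>X k\<close> as a measurable function of the variables with index at most k and splitting
  the independent family into disjoint blocks.\<close>

lemma distr_euler_chain_Suc:
  assumes E: "euler_chain b \<mu>\<^sub>0 h N \<xi> X" and h: "h > 0"
  shows "distr N borel (X (Suc k)) = euler_step h (distr N borel (X k))"
proof -
  define Z where "Z i = (if i = 0 then X 0 else \<xi> i)" for i
  have E': "prob_space N" "prob_space.indep_vars N (\<lambda>_. borel) Z UNIV"
    "\<And>k. k \<ge> 1 \<Longrightarrow> distr N borel (\<xi> k) = gaussian 1"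
    "\<And>k \<omega>. \<omega> \<in> space N \<Longrightarrow> X (Suc k) \<omega> = X k \<omega> + h *\<^sub>R b (X k \<omega>) + sqrt h *\<^sub>R \<xi> (Suc k) \<omega>"
    using E by (auto simp: euler_chain_def Z_def[abs_def])
  interpret N: prob_space N by fact
  interpret G: prob_space "gaussian 1 :: (real ^ 'n) measure"
    by (rule prob_space_gaussian) simp
  have "\<exists>\<Phi>. \<Phi> \<in> PiM {..k} (\<lambda>_. borel) \<rightarrow>\<^sub>M borel \<and> (\<forall>\<omega>\<in>space N. X k \<omega> = \<Phi> (\<lambda>i\<in>{..k}. Z i \<omega>))" for k
  proof (induction k)
    case 0
    show ?case
      by (intro exI[of _ "\<lambda>v. v 0"] conjI) (auto simp: Z_def)
  next
    case (Suc k)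
    then obtain \<Phi> where \<Phi>[measurable]: "\<Phi> \<in> PiM {..k} (\<lambda>_. borel) \<rightarrow>\<^sub>M borel"
      and eq: "\<And>\<omega>. \<omega> \<in> space N \<Longrightarrow> X k \<omega> = \<Phi> (\<lambda>i\<in>{..k}. Z i \<omega>)" by blast
    have [measurable]: "(\<lambda>v. \<Phi> (restrict v {..k})) \<in> PiM {..Suc k} (\<lambda>_. borel) \<rightarrow>\<^sub>M borel"
      by (rule measurable_compose[OF measurable_restrict_subset \<Phi>]) auto
    have res: "restrict (\<lambda>i\<in>{..Suc k}. Z i \<omega>) {..k} = (\<lambda>i\<in>{..k}. Z i \<omega>)" for \<omega>
      by (auto simp: restrict_def fun_eq_iff)
    show ?case
    proof (intro exI conjI ballI)
      show "(\<lambda>v. \<Phi> (restrict v {..k}) + h *\<^sub>R b (\<Phi> (restrict v {..k})) + sqrt h *\<^sub>R v (Suc k))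
        \<in> PiM {..Suc k} (\<lambda>_. borel) \<rightarrow>\<^sub>M borel"
        by measurable
      fix \<omega> assume \<omega>: "\<omega> \<in> space N"
      then show "X (Suc k) \<omega> = \<Phi> (restrict (\<lambda>i\<in>{..Suc k}. Z i \<omega>) {..k})
          + h *\<^sub>R b (\<Phi> (restrict (\<lambda>i\<in>{..Suc k}. Z i \<omega>) {..k})) + sqrt h *\<^sub>R (\<lambda>i\<in>{..Suc k}. Z i \<omega>) (Suc k)"
        unfolding res E'(4)[OF \<omega>] eq[OF \<omega>] by (simp add: Z_def)
    qed
  qed
  then obtain \<Phi> where \<Phi>[measurable]: "\<Phi> \<in> PiM {..k} (\<lambda>_. borel) \<rightarrow>\<^sub>M borel"
    and eq: "\<And>\<omega>. \<omega> \<in> space N \<Longrightarrow> X k \<omega> = \<Phi> (\<lambda>i\<in>{..k}. Z i \<omega>)" by blast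
  have "N.indep_var borel (\<Phi> \<circ> (\<lambda>\<omega>. \<lambda>i\<in>{..k}. Z i \<omega>)) borel ((\<lambda>v. v (Suc k)) \<circ> (\<lambda>\<omega>. \<lambda>i\<in>{Suc k}. Z i \<omega>))"
    by (rule N.indep_var_compose[OF N.indep_var_restrict[OF E'(2)]]) auto
  then have iv: "N.indep_var borel (\<lambda>\<omega>. \<Phi> (\<lambda>i\<in>{..k}. Z i \<omega>)) borel (\<xi> (Suc k))"
    by (simp add: comp_def Z_def)
  have m[measurable]: "(\<lambda>\<omega>. \<Phi> (\<lambda>i\<in>{..k}. Z i \<omega>)) \<in> borel_measurable N" "\<xi> (Suc k) \<in> borel_measurable N"
    using iv by (auto simp: N.indep_var_distribution_eq)
  have Xm[measurable]: "X k \<in> borel_measurable N"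
    using m(1) eq by (simp cong: measurable_cong)
  have law: "distr N borel (\<lambda>\<omega>. \<Phi> (\<lambda>i\<in>{..k}. Z i \<omega>)) = distr N borel (X k)"
    by (rule distr_cong) (auto simp: eq)
  have joint: "distr N (borel \<Otimes>\<^sub>M borel) (\<lambda>\<omega>. (X k \<omega>, \<xi> (Suc k) \<omega>)) = distr N borel (X k) \<Otimes>\<^sub>M gaussian 1"
  proof -
    have "distr N (borel \<Otimes>\<^sub>M borel) (\<lambda>\<omega>. (X k \<omega>, \<xi> (Suc k) \<omega>))
      = distr N (borel \<Otimes>\<^sub>M borel) (\<lambda>\<omega>. (\<Phi> (\<lambda>i\<in>{..k}. Z i \<omega>), \<xi> (Suc k) \<omega>))"
      by (rule distr_cong) (auto simp: eq)
    also have "\<dots> = distr N borel (X k) \<Otimes>\<^sub>M gaussian 1"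
      using iv E'(3)[of "Suc k"] by (simp add: N.indep_var_distribution_eq law)
    finally show ?thesis .
  qed
  interpret S: prob_space "distr (gaussian 1 :: (real ^ 'n) measure) borel (\<lambda>x. sqrt h *\<^sub>R x)"
    by (rule G.prob_space_distr) simp
  interpret X: prob_space "distr N borel (X k)"
    by (rule N.prob_space_distr) simp
  have "distr N borel (X (Suc k)) = distr N borel (\<lambda>\<omega>. X k \<omega> + h *\<^sub>R b (X k \<omega>) + sqrt h *\<^sub>R \<xi> (Suc k) \<omega>)"
    by (rule distr_cong) (auto simp: E'(4))
  also have "\<dots> = distr (distr N (borel \<Otimes>\<^sub>M borel) (\<lambda>\<omega>. (X k \<omega>, \<xi> (Suc k) \<omega>))) borel (\<lambda>p. fst p + h *\<^sub>R b (fst p) + sqrt h *\<^sub>R snd p)"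
    by (subst distr_distr) (auto simp: comp_def)
  also have "\<dots> = distr (distr N borel (X k) \<Otimes>\<^sub>M gaussian 1) borel (\<lambda>p. fst p + h *\<^sub>R b (fst p) + sqrt h *\<^sub>R snd p)"
    unfolding joint ..
  also have "\<dots> = distr (distr (distr N borel (X k) \<Otimes>\<^sub>M gaussian 1) (borel \<Otimes>\<^sub>M borel) (\<lambda>(x, w). (x, sqrt h *\<^sub>R w))) borel (\<lambda>(x, w). x + h *\<^sub>R b x + w)"
    by (subst distr_distr) (auto simp: comp_def split_def)
  \<comment> \<open>The factor \<open>sqrt h\<close> is moved from the update map into the law of
    the noise.\<close>
  also have "distr (distr N borel (X k) \<Otimes>\<^sub>M gaussian 1) (borel \<Otimes>\<^sub>M borel) (\<lambda>(x, w). (x, sqrt h *\<^sub>R w))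
    = distr (distr N borel (X k)) borel (\<lambda>x. x) \<Otimes>\<^sub>M distr (gaussian 1 :: (real ^ 'n) measure) borel (\<lambda>w. sqrt h *\<^sub>R w)"
    by (rule pair_measure_distr[symmetric]) (auto intro: S.sigma_finite_measure_axioms)
  also have "\<dots> = distr N borel (X k) \<Otimes>\<^sub>M gaussian (sqrt h)"
    using h by (simp add: distr_gaussian_scale distr_id2)
  finally show ?thesis by (simp add: euler_step_def)
qed

end

text \<open>One recursion for the cost serves both distances, hence equal rates. Recording that the
  initial cost is finite keeps the bounds from holding with an infinite right side, and the limits
  on \<open>h\<^sub>0\<close> keep the bases of the powers nonnegative.\<close>

theorem theorem1p2:
  fixes b :: "real ^ 'n \<Rightarrow> real ^ 'n"
    and L K R :: real
    and \<mu>\<^sub>0 \<pi> :: "(real ^ 'n) measure"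
    and M :: "'w measure"
    and W :: "real \<Rightarrow> 'w \<Rightarrow> real ^ 'n"
    and Y :: "real ^ 'n \<Rightarrow> real \<Rightarrow> 'w \<Rightarrow> real ^ 'n"
  assumes L: "L > 0" "\<And>x y. norm (b x - b y) \<le> L * norm (x - y)"
    and KR: "K > 0" "R > 0"
      "\<And>x y. norm (x - y) > R \<Longrightarrow> (x - y) \<bullet> (b x - b y) \<le> - K * (norm (x - y))\<^sup>2"
    and mu0: "\<mu>\<^sub>0 \<in> prob_measures_moment 2"
    and W: "brownian_motion M W"
    and Y: "\<And>x. sde_solution M W b x (Y x)"
    and inv: "invariant_measure M Y \<pi>"
  shows "\<exists>(f :: real \<Rightarrow> real) h\<^sub>0 \<kappa>\<^sub>1 \<kappa>\<^sub>2 C\<^sub>1 C\<^sub>2 c\<^sub>1 c\<^sub>2.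
    f ` {0..} \<subseteq> {0..} \<and> strict_mono_on {0..} f \<and>
    h\<^sub>0 > 0 \<and> \<kappa>\<^sub>1 > 0 \<and> \<kappa>\<^sub>2 > 0 \<and> C\<^sub>1 > 0 \<and> C\<^sub>2 > 0 \<and> c\<^sub>1 > 0 \<and> c\<^sub>2 > 0 \<and>
    \<kappa>\<^sub>1 * h\<^sub>0 \<le> 1 \<and> \<kappa>\<^sub>2 * h\<^sub>0 \<le> 1 \<and>
    transport_cost f \<mu>\<^sub>0 \<pi> < \<infinity> \<and>
    (\<forall>h\<in>{0<..<h\<^sub>0}. \<forall>(N :: 's measure) \<xi> X. euler_chain b \<mu>\<^sub>0 h N \<xi> X \<longrightarrow> (\<forall>k\<ge>1.
       wasserstein 2 (distr N borel (X k)) \<pi>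
         \<le> ennreal (C\<^sub>2 * (1 - \<kappa>\<^sub>2 * h) powr (real k / 2))
             * ennreal_powr (transport_cost f (distr N borel (X 0)) \<pi>) (1 / 2)
           + ennreal (c\<^sub>2 * h powr (1 / 4)) \<and>
       wasserstein 1 (distr N borel (X k)) \<pi>
         \<le> ennreal (C\<^sub>1 * (1 - \<kappa>\<^sub>1 * h) ^ k)
             * transport_cost f (distr N borel (X 0)) \<pi>
           + ennreal (c\<^sub>1 * h powr (1 / 2))))"
proof -
  interpret dissipative_sde b L K R M W Y
    by unfold_locales (use L KR W Y in auto)
  obtain a \<epsilon> \<kappa> C h0 where *: "a > 0" "\<epsilon> > 0" "\<kappa> > 0" "C > 0" "h0 > 0" "\<kappa> * h0 \<le> 1"
    and step: "\<And>h \<mu>. 0 < h \<Longrightarrow> h < h0 \<Longrightarrow>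
      transport_cost (cost_fun a \<epsilon>) (euler_step h \<mu>) \<pi>
        \<le> ennreal (1 - \<kappa> * h) * transport_cost (cost_fun a \<epsilon>) \<mu> \<pi> + ennreal (C * (h * sqrt h))"
    by (rule transport_cost_euler_step[OF inv]) (rule that; (assumption | simp only:))
  define f where "f = cost_fun a \<epsilon>"
  define B where "B = max ((1 + a) / a) (1 / \<epsilon>)"
  have B: "B > 0" using * by (simp add: B_def less_max_iff_disj)
  have [measurable]: "f \<in> borel_measurable borel" by (simp add: f_def)
  have fin: "transport_cost f \<mu>\<^sub>0 \<pi> < \<infinity>"
    unfolding f_def
  proof (rule transport_cost_cost_fun_finite)
    have "integrable \<mu>\<^sub>0 (\<lambda>x. norm x powr 2)"
      using mu0 by (simp add: prob_measures_moment_def)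
    then have "(\<integral>\<^sup>+x. ennreal (norm (norm x powr 2)) \<partial>\<mu>\<^sub>0) < \<infinity>"
      by (simp add: integrable_iff_bounded)
    then show "(\<integral>\<^sup>+x. ennreal ((norm x)\<^sup>2) \<partial>\<mu>\<^sub>0) < \<infinity>" by simp
    show "(\<integral>\<^sup>+x. ennreal ((norm x)\<^sup>2) \<partial>\<pi>) < \<infinity>"
      by (rule invariant_measure_second_moment[OF inv])
  qed (use mu0 inv * in \<open>auto simp: prob_measures_moment_def invariant_measure_def\<close>)
  have main: "wasserstein 2 (distr N borel (X k)) \<pi>
         \<le> ennreal (sqrt (1 / \<epsilon>) * (1 - \<kappa> * h) powr (real k / 2))
             * ennreal_powr (transport_cost f (distr N borel (X 0)) \<pi>) (1 / 2)
           + ennreal (sqrt (C / \<kappa> / \<epsilon>) * h powr (1 / 4)) \<and>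
       wasserstein 1 (distr N borel (X k)) \<pi>
         \<le> ennreal (B * (1 - \<kappa> * h) ^ k)
             * transport_cost f (distr N borel (X 0)) \<pi>
           + ennreal (B * (C / \<kappa>) * h powr (1 / 2))"
    if h: "h \<in> {0<..<h0}" and E: "euler_chain b \<mu>\<^sub>0 h N \<xi> X"
    for h k and N :: "'s measure" and \<xi> X
  proof -
    have h': "0 < h" "h < h0" using h by auto
    have "\<kappa> * h < \<kappa> * h0" using h' * by simp
    then have \<kappa>h: "1 - \<kappa> * h > 0" using * by linarith
    let ?D = "\<lambda>k. transport_cost f (distr N borel (X k)) \<pi>"
    \<comment> \<open>The fixed point of the affine recursion, so the induction carries the additive
      term along unchanged.\<close>
    define c where "c = C / \<kappa> * sqrt h"
    have c: "c \<ge> 0" using * h' by (simp add: c_def)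
    have D: "?D k \<le> ennreal ((1 - \<kappa> * h) ^ k) * ?D 0 + ennreal c"
    proof (induction k)
      case (Suc k)
      have "?D (Suc k) \<le> ennreal (1 - \<kappa> * h) * ?D k + ennreal (C * (h * sqrt h))"
        unfolding distr_euler_chain_Suc[OF E h'(1)] f_def by (rule step[OF h'])
      also have "\<dots> \<le> ennreal (1 - \<kappa> * h) * (ennreal ((1 - \<kappa> * h) ^ k) * ?D 0 + ennreal c) + ennreal (C * (h * sqrt h))"
        by (intro add_right_mono mult_left_mono Suc) auto
      also have "\<dots> = ennreal ((1 - \<kappa> * h) ^ Suc k) * ?D 0 + (ennreal ((1 - \<kappa> * h) * c) + ennreal (C * (h * sqrt h)))"
        using \<kappa>h c by (simp add: distrib_left ennreal_mult mult.assoc add.assoc)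
      also have "ennreal ((1 - \<kappa> * h) * c) + ennreal (C * (h * sqrt h)) = ennreal ((1 - \<kappa> * h) * c + C * (h * sqrt h))"
        using \<kappa>h c * h' by (intro ennreal_plus[symmetric]) auto
      also have "(1 - \<kappa> * h) * c + C * (h * sqrt h) = c"
        using * by (simp add: c_def field_simps)
      finally show ?case .
    qed simp
    have p: "(1 - \<kappa> * h) ^ k \<ge> 0" using \<kappa>h by simp
    have aff: "ennreal A * ?D k \<le> ennreal (A * (1 - \<kappa> * h) ^ k) * ?D 0 + ennreal (A * c)" if "A \<ge> 0" for A
    proof -
      have "ennreal A * ?D k \<le> ennreal A * (ennreal ((1 - \<kappa> * h) ^ k) * ?D 0 + ennreal c)"
        by (intro mult_left_mono D) auto
      then show ?thesis
        using that p c by (simp add: distrib_left ennreal_mult mult.assoc)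
    qed
    have "wasserstein 1 (distr N borel (X k)) \<pi> = transport_cost (\<lambda>r. r powr 1) (distr N borel (X k)) \<pi>"
      by (simp add: wasserstein_def ennreal_powr_one)
    also have "\<dots> \<le> ennreal B * ?D k"
      using linear_le_cost_fun[OF *(1,2)] by (intro transport_cost_cmult_le B) (auto simp: B_def f_def)
    also have "\<dots> \<le> ennreal (B * (1 - \<kappa> * h) ^ k) * ?D 0 + ennreal (B * c)"
      using B by (intro aff) simp
    also have "B * c = B * (C / \<kappa>) * h powr (1 / 2)"
      using h' by (simp add: c_def powr_half_sqrt)
    finally have W1: "wasserstein 1 (distr N borel (X k)) \<pi>
      \<le> ennreal (B * (1 - \<kappa> * h) ^ k) * ?D 0 + ennreal (B * (C / \<kappa>) * h powr (1 / 2))" .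
    \<comment> \<open>The quadratic part of f bounds the square of W_2; the root is taken only after
      the recursion has been solved.\<close>
    have "transport_cost (\<lambda>r. r powr 2) (distr N borel (X k)) \<pi> \<le> ennreal (1 / \<epsilon>) * ?D k"
      using square_le_cost_fun[OF *(1,2)] *
      by (intro transport_cost_cmult_le) (auto simp: f_def field_simps)
    also have "\<dots> \<le> ennreal (1 / \<epsilon> * (1 - \<kappa> * h) ^ k) * ?D 0 + ennreal (1 / \<epsilon> * c)"
      using * by (intro aff) simp
    finally have "wasserstein 2 (distr N borel (X k)) \<pi>
      \<le> ennreal_powr (ennreal (1 / \<epsilon> * (1 - \<kappa> * h) ^ k) * ?D 0 + ennreal (1 / \<epsilon> * c)) (1 / 2)"
      unfolding wasserstein_def by (intro ennreal_powr_mono) auto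
    also have "\<dots> \<le> ennreal (sqrt (1 / \<epsilon> * (1 - \<kappa> * h) ^ k)) * ennreal_powr (?D 0) (1 / 2) + ennreal (sqrt (1 / \<epsilon> * c))"
      using * p c by (intro ennreal_powr_half_affine_le) auto
    also have "sqrt (1 / \<epsilon> * (1 - \<kappa> * h) ^ k) = sqrt (1 / \<epsilon>) * (1 - \<kappa> * h) powr (real k / 2)"
    proof -
      have "sqrt ((1 - \<kappa> * h) ^ k) = (1 - \<kappa> * h) powr (real k / 2)"
        using \<kappa>h by (simp add: powr_half_sqrt[symmetric] powr_realpow[symmetric] powr_powr)
      then show ?thesis by (simp only: real_sqrt_mult)
    qed
    also have "sqrt (1 / \<epsilon> * c) = sqrt (C / \<kappa> / \<epsilon>) * h powr (1 / 4)"
    proof -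
      have "sqrt (sqrt h) = h powr (1 / 4)"
        using h' by (simp add: powr_half_sqrt[symmetric] powr_powr)
      moreover have "1 / \<epsilon> * c = C / \<kappa> / \<epsilon> * sqrt h" by (simp add: c_def)
      ultimately show ?thesis by (simp only: real_sqrt_mult)
    qed
    finally show ?thesis using W1 by simp
  qed
  have f: "f ` {0..} \<subseteq> {0..}" "strict_mono_on {0..} f"
    using cost_fun_nonneg[OF *(1,2)] cost_fun_strict_mono[OF *(1,2)]
    by (auto simp: f_def strict_mono_on_def)
  have pos: "sqrt (1 / \<epsilon>) > 0" "sqrt (C / \<kappa> / \<epsilon>) > 0" "B * (C / \<kappa>) > 0"
    using * B by auto
  show ?thesis
    by (rule exI[of _ f], rule exI[of _ h0], rule exI[of _ \<kappa>], rule exI[of _ \<kappa>], rule exI[of _ B],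
        rule exI[of _ "sqrt (1 / \<epsilon>)"], rule exI[of _ "B * (C / \<kappa>)"], rule exI[of _ "sqrt (C / \<kappa> / \<epsilon>)"])
      (intro conjI ballI allI impI;
        (rule f | rule * | rule B | rule pos | rule fin | (rule main[THEN conjunct1]; assumption)
          | (rule main[THEN conjunct2]; assumption)))
qed

end
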